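(* Let $m,s\ge1$ be integers, $\varepsilon\in\{-1,1\}$, and let $\mathbf{a}=(a_1,\dots,a_m)$ be an $m$-tuple of nonnegative integers and $\mathbf{b}=(b_1,\dots,b_m)$ an $m$-tuple of positive integers such that $(a_i,b_i)\ne(a_j,b_j)$ for all $i\ne j$. Let $\beta_1,\dots,\beta_k$ be the distinct values of the coordinates of $\mathbf{b}$, and let $A_i$, $S_i$, $\mathcal{K}_{\max}$, $T(K)$, $\Lambda(\mathcal{K})$ be as in the context. Put $$\alpha=\sum_{i=1}^k|S_i|,\quad b=\max\{\beta_1,\dots,\beta_k\},\quad e=\sum_{K\in\mathcal{K}_{\max}}|T(K)|(|K|-1),$$ $$q_\varepsilon(p)=\big|\{A\in AP(\mathbf{a},\mathbf{b};s)\cap2^{[1,p-1]}:\chi_p(a)=\varepsilon\text{ for all }a\in A\}\big|.$$ Consider the condition $( * )$ whenever $(i,j)\in[1,k]\times[1,k]$ with $i\ne j$ and $(a,a')\in A_i\times A_j$, either $\beta_i\beta_j$ does not divide $a'\beta_i-a\beta_j$, or $\beta_i\beta_j$ divides $a'\beta_i-a\beta_j$ with a quotient that exceeds $s-1$ in modulus. If $( * )$ holds, then $q_\varepsilon(p)\sim(b\cdot2^{\alpha})^{-1}p$ as $p\to+\infty$. If $( * )$ does not hold, then $e$ is a positive integer with $e<\alpha$, and: (i) if $\prod_{i\in I}\beta_i$ is a square for all $I\in\Lambda(\mathcal{K})$, then $q_\varepsilon(p)\sim(b\cdot2^{\alpha-e})^{-1}p$ as $p\to+\infty$; (ii) if there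 is $I\in\Lambda(\mathcal{K})$ such that $\prod_{i\in I}\beta_i$ is not a square, then there exist two disjoint infinite sets of primes $\Pi_+$ and $\Pi_-$ whose union contains all but finitely many of the primes and such that $q_\varepsilon(p)=0$ for all $p\in\Pi_-$, while $q_\varepsilon(p)\sim(b\cdot2^{\alpha-e})^{-1}p$ as $p\to+\infty$ inside $\Pi_+$.
   Context: Notation: $[m,n]$ is the set of integers $x$ with $m\le x\le n$, and $[m,+\infty)$ the set of integers $\ge m$; $2^A$ is the set of all subsets of $A$; $\mathcal{E}(A)$ is the set of all nonempty subsets of $A$ of even cardinality. $p$ always denotes an odd prime and $\chi_p$ the Legendre symbol modulo $p$. For sequences indexed by an infinite set $\Pi$ of primes, $a(p)\sim b(p)$ as $p\to+\infty$ inside $\Pi$ means $a(p)/b(p)\to1$ as $p\to+\infty$, $p\in\Pi$; if no set is mentioned, $\Pi$ is the set of all odd primes. $AP(\mathbf{a},\mathbf{b};s)=\big\{\bigcup_{j=1}^{m}\{a_j+b_j(n+i):i\in[0,s-1]\}:n\in[0,+\infty)\big\}$. For $i\in[1,k]$: $A_i=\{a_j:j\in[1,m],\ b_j=\beta_i\}$ and $S_i=\bigcup_{a\in A_i}\{a+\beta_il:l\in[0,s-1]\}$. For $S\subseteq[0,+\infty)$ and $\beta\ge1$, $\beta^{-1}S=\{z/\beta:z\in S\}\subseteq\mathbb{Q}$. Let $\mathcal{K}=\{\emptyset\ne K\subseteq[1,k]:\bigcap_{i\in K}\beta_i^{-1}S_i\ne\emptyset\}$, and for $K\in\mathcal{K}$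 let $$T(K)=\Big(\bigcap_{i\in K}\beta_i^{-1}S_i\Big)\cap\bigcap_{i\in[1,k]\setminus K}(\mathbb{Q}\setminus\beta_i^{-1}S_i).$$ Let $\mathcal{K}_{\max}=\{K\in\mathcal{K}:T(K)\ne\emptyset\}$ and $\Lambda(\mathcal{K})=\bigcup_{K\in\mathcal{K}_{\max}}\mathcal{E}(K)$. *)

theory Defs
  imports
    "HOL-Analysis.Analysis"
    "HOL-Computational_Algebra.Nth_Powers"
    "HOL-Number_Theory.Number_Theory"
begin

text \<open>
  An m-tuple is a function on \<open>{1..m}\<close>; likewise \<open>\<beta>\<close> lists the distinct
  coordinates of \<open>b\<close> along \<open>{1..k}\<close>. Values outside these ranges are never used.
\<close>

definition odd_primes :: "nat set" where
  "odd_primes = {p. prime p \<and> odd p}"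

definition sim_inside :: "nat set \<Rightarrow> (nat \<Rightarrow> real) \<Rightarrow> (nat \<Rightarrow> real) \<Rightarrow> bool" where
  "sim_inside P f g \<longleftrightarrow> ((\<lambda>p. f p / g p) \<longlongrightarrow> 1) (inf at_top (principal P))"

definition AP :: "nat \<Rightarrow> (nat \<Rightarrow> nat) \<Rightarrow> (nat \<Rightarrow> nat) \<Rightarrow> nat \<Rightarrow> nat set set" where
  "AP m a b s = {\<Union>j\<in>{1..m}. {a j + b j * (n + i) | i. i \<in> {0..<s}} | n. True}"

definition A_set :: "nat \<Rightarrow> (nat \<Rightarrow> nat) \<Rightarrow> (nat \<Rightarrow> nat) \<Rightarrow> (nat \<Rightarrow> nat) \<Rightarrow> nat \<Rightarrow> nat set" where
  "A_set m a b \<beta> i = {a j | j. j \<in> {1..m} \<and> b j = \<beta> i}"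

definition S_set ::
  "nat \<Rightarrow> (nat \<Rightarrow> nat) \<Rightarrow> (nat \<Rightarrow> nat) \<Rightarrow> nat \<Rightarrow> (nat \<Rightarrow> nat) \<Rightarrow> nat \<Rightarrow> nat set" where
  "S_set m a b s \<beta> i = (\<Union>x\<in>A_set m a b \<beta> i. {x + \<beta> i * l | l. l \<in> {0..<s}})"

definition inv_scale :: "nat \<Rightarrow> nat set \<Rightarrow> rat set" where
  "inv_scale c S = {of_nat z / of_nat c | z. z \<in> S}"

definition nonempty_even_subsets :: "'a set \<Rightarrow> 'a set set" where
  "nonempty_even_subsets A = {I. I \<subseteq> A \<and> I \<noteq> {} \<and> finite I \<and> even (card I)}"

text \<open>
  The next definitions take the family \<open>R i = \<beta>\<^sub>i\<^sup>-\<^sup>1 S\<^sub>i\<close> as an argument.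
\<close>

definition K_family :: "nat \<Rightarrow> (nat \<Rightarrow> rat set) \<Rightarrow> nat set set" where
  "K_family k R = {K. K \<noteq> {} \<and> K \<subseteq> {1..k} \<and> (\<Inter>i\<in>K. R i) \<noteq> {}}"

definition T_set :: "nat \<Rightarrow> (nat \<Rightarrow> rat set) \<Rightarrow> nat set \<Rightarrow> rat set" where
  "T_set k R K = (\<Inter>i\<in>K. R i) \<inter> (\<Inter>i\<in>{1..k} - K. UNIV - R i)"

definition K_max :: "nat \<Rightarrow> (nat \<Rightarrow> rat set) \<Rightarrow> nat set set" where
  "K_max k R = {K \<in> K_family k R. T_set k R K \<noteq> {}}"

definition Lambda_K :: "nat \<Rightarrow> (nat \<Rightarrow> rat set) \<Rightarrow> nat set set" where
  "Lambda_K k R = (\<Union>K\<in>K_max k R. nonempty_even_subsets K)"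

definition q_count ::
  "nat \<Rightarrow> (nat \<Rightarrow> nat) \<Rightarrow> (nat \<Rightarrow> nat) \<Rightarrow> nat \<Rightarrow> int \<Rightarrow> nat \<Rightarrow> nat" where
  "q_count m a b s \<epsilon> p =
     card {A \<in> AP m a b s \<inter> Pow {1..p - 1}. \<forall>x\<in>A. Legendre (int x) (int p) = \<epsilon>}"

definition star_condition ::
  "nat \<Rightarrow> (nat \<Rightarrow> nat) \<Rightarrow> (nat \<Rightarrow> nat) \<Rightarrow> nat \<Rightarrow> nat \<Rightarrow> (nat \<Rightarrow> nat) \<Rightarrow> bool" where
  "star_condition m a b s k \<beta> \<longleftrightarrow>
     (\<forall>i\<in>{1..k}. \<forall>j\<in>{1..k}. i \<noteq> j \<longrightarrow>
        (\<forall>x\<in>A_set m a b \<beta> i. \<forall>x'\<in>A_set m a b \<beta> j.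
           let d = int (\<beta> i) * int (\<beta> j);
               t = int x' * int (\<beta> i) - int x * int (\<beta> j)
           in \<not> d dvd t \<or> (d dvd t \<and> \<bar>t div d\<bar> > int s - 1)))"

end

theory Submission
  imports Defs
begin

text \<open>
  Dividing by \<open>\<beta>\<^sub>i\<close> turns the conditions \<open>\<chi>\<^sub>p(\<beta>\<^sub>i n + z) = \<epsilon>\<close> into sign conditions on
  \<open>\<chi>\<^sub>p(n + r)\<close>, where \<open>r\<close> runs through the union of the sets \<open>\<beta>\<^sub>i\<^sup>-\<^sup>1 S\<^sub>i\<close>, which has \<open>\<alpha> - e\<close>
  elements. The conditions at one \<open>r\<close> are compatible iff \<open>\<chi>\<^sub>p(\<beta>\<^sub>i)\<close> does not depend on the index
  \<open>i\<close> with \<open>r \<in> \<beta>\<^sub>i\<^sup>-\<^sup>1 S\<^sub>i\<close>, that is, iff \<open>\<chi>\<^sub>p\<close> is \<open>1\<close> at the products over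
  \<open>I \<in> \<Lambda>(K)\<close>. If they are, each of the \<open>2 ^ (\<alpha> - e)\<close> sign patterns occurs
  asymptotically equally often among the \<open>n \<le> p / b\<close>.

  Equidistribution needs incomplete sums of \<open>\<chi>\<^sub>p\<close> over products of distinct linear factors
  to be \<open>o(p)\<close>. Averaging over a bounded number of shifts (van der Corput) and Cauchy-Schwarz
  reduce them to complete sums of the same kind, which are \<open>o(p)\<close> by Stepanov's method
  with a vanishing order that is fixed while \<open>p\<close> grows. Stepanov's argument is carried out with
  congruences modulo \<open>p\<close> in \<open>\<int>[X]\<close>, since there is no type of residues for a variable modulus.

  Infinitely many primes \<open>p\<close> with \<open>\<chi>\<^sub>p = 1\<close> at all \<open>\<beta>\<^sub>i\<close> are found in a residue class
  \<open>1\<close>; for a non-square \<open>D\<close>, reciprocity makes \<open>p \<mapsto> \<chi>\<^sub>p(D)\<close> the restriction of a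
  multiplicative periodic function, so that an integer where this function is \<open>-1\<close> has a prime
  factor where it is \<open>-1\<close>.
\<close>

section \<open>Polynomials modulo a prime\<close>

text \<open>The sets counted restrict \<open>n\<close> to a fixed fraction of a period, so complete
  sums alone do not suffice. Completion by additive characters would require bounds for mixed sums;
  averaging over shifts needs only correlations of \<open>\<chi>\<^sub>p\<close> with itself. As
  only the main term is claimed, any saving \<open>o(p)\<close> is enough, and this permits a
  vanishing order \<open>l\<close> independent of \<open>p\<close>: if \<open>f\<close> is a product
  of \<open>d\<close> linear factors, each of the fibres \<open>\<chi>\<^sub>p(f) = 1\<close> and
  \<open>\<chi>\<^sub>p(f) = -1\<close> has at most \<open>(p / 2) (1 + d / l) + O(1)\<close>
  elements. Together they contain all but at most \<open>d\<close> residues, so the two upper bounds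
  force both sizes close to \<open>p / 2\<close>. The numbers \<open>r\<close> are fractions. With
  \<open>B\<close> the product of all \<open>\<beta>\<^sub>i\<close>, each \<open>B r\<close> is an
  integer, and \<open>n + r\<close> is replaced by \<open>B n + B r\<close>; hence the linear forms
  of common slope \<open>B\<close> in the sums below. For (ii) both sets of primes only have to be
  infinite, so arguments in Euclid's style replace Dirichlet's theorem.\<close>

lemma siegel_mod:
  fixes M :: "'r \<Rightarrow> 'c \<Rightarrow> int" and p :: nat
  assumes "finite Rw" "finite Cs" "card Rw < card Cs" "p \<ge> 2"
  shows "\<exists>w. (\<exists>c\<in>Cs. \<not> int p dvd w c) \<and> (\<forall>r\<in>Rw. int p dvd (\<Sum>c\<in>Cs. w c * M r c))"
proof -
  \<comment> \<open>Pigeonhole: there are \<open>p ^ card Cs\<close> reduced coefficient vectors but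
    only \<open>p ^ card Rw\<close> possible vectors of residues, so two vectors collide; their
    difference is the solution.\<close>
  define X where "X = PiE Cs (\<lambda>_. {0..<int p})"
  define Y where "Y = PiE Rw (\<lambda>_. {0..<int p})"
  define F where "F v = (\<lambda>r\<in>Rw. (\<Sum>c\<in>Cs. v c * M r c) mod int p)" for v
  have "F ` X \<subseteq> Y" using assms(4) by (auto simp: F_def Y_def PiE_def extensional_def)
  moreover have fY: "finite Y" unfolding Y_def using assms(1) by (intro finite_PiE) auto
  ultimately have "card (F ` X) \<le> card Y" by (rule card_mono[rotated])
  also have "card Y = p ^ card Rw" unfolding Y_def using assms(1) by (simp add: card_PiE)
  also have "\<dots> < p ^ card Cs" using assms(3,4) by (intro power_strict_increasing) auto
  also have "\<dots> = card X" unfolding X_def using assms(2) by (simp add: card_PiE)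
  finally have "\<not> inj_on F X" by (rule pigeonhole)
  then obtain v v' where v: "v \<in> X" "v' \<in> X" "F v = F v'" "v \<noteq> v'" by (auto simp: inj_on_def)
  from v obtain c where c: "c \<in> Cs" "v c \<noteq> v' c" unfolding X_def by (metis PiE_ext)
  have r: "v c \<in> {0..<int p}" "v' c \<in> {0..<int p}" using v c unfolding X_def by (auto simp: PiE_iff)
  have "\<not> int p dvd v c - v' c"
  proof
    assume "int p dvd v c - v' c"
    then have "v c mod int p = v' c mod int p" by (simp add: mod_eq_dvd_iff)
    with r c show False by simp
  qed
  moreover have "int p dvd (\<Sum>c\<in>Cs. (v c - v' c) * M r c)" if "r \<in> Rw" for r
  proof -
    have "F v r = F v' r" using v by simp
    then have "int p dvd (\<Sum>c\<in>Cs. v c * M r c) - (\<Sum>c\<in>Cs. v' c * M r c)"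
      using that by (simp add: F_def mod_eq_dvd_iff)
    then show ?thesis by (simp add: left_diff_distrib sum_subtractf)
  qed
  ultimately show ?thesis using c by (intro exI[of _ "\<lambda>c. v c - v' c"]) blast
qed

text \<open>By Gauss's lemma a prime number stays prime in the ring of integer polynomials. This
  stands in for cancellation over the residue field.\<close>

lemma const_dvd_mult_cancel:
  fixes A B :: "int poly"
  assumes "prime p" "[:int p:] dvd A * B" "\<not> [:int p:] dvd A"
  shows "[:int p:] dvd B"
proof -
  have "prime_elem [:int p:]" using assms(1) by (intro lift_prime_elem_poly) auto
  then show ?thesis using assms(2,3) prime_elem_dvd_mult_iff by blast
qed

lemma const_dvd_poly: "[:c:] dvd (q::int poly) \<Longrightarrow> c dvd poly q x"
  by (auto elim!: dvdE)

lemma not_const_dvd_linear: "prime p \<Longrightarrow> \<not> [:int p:] dvd [:x, 1:]"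
  by (auto simp: const_poly_dvd_iff intro!: exI[of _ 1])

lemma const_dvd_minus_synthetic_div:
  fixes q :: "int poly"
  assumes "c dvd poly q x"
  shows "[:c:] dvd q - [:-x,1:] * synthetic_div q x"
proof -
  have "q - [:-x,1:] * synthetic_div q x = [:poly q x:]"
    using synthetic_div_correct'[of x q] by (metis add_diff_cancel_left')
  with assms show ?thesis by simp
qed

lemma const_dvd_pderiv: "[:c:] dvd (q::int poly) \<Longrightarrow> [:c:] dvd pderiv q"
  by (auto simp: const_poly_dvd_iff coeff_pderiv)

lemma const_dvd_pderiv_iter: "[:c:] dvd (q::int poly) \<Longrightarrow> [:c:] dvd (pderiv ^^ k) q"
  by (induction k) (auto simp: const_dvd_pderiv)

lemma pderiv_iter_diff: "(pderiv ^^ k) (f - g) = (pderiv ^^ k) f - (pderiv ^^ k) (g :: int poly)"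
  by (induction k) (auto simp: pderiv_diff)

lemma pderiv_iter_linear_mult:
  "(pderiv ^^ k) ([:-x,1:] * q) = [:-x,1:] * (pderiv ^^ k) q + Polynomial.smult (int k) ((pderiv ^^ (k - 1)) q)"
proof (induction k)
  case (Suc k)
  show ?case
  proof (cases k)
    case 0 then show ?thesis by (simp add: pderiv_pCons pderiv_diff pderiv_smult)
  next
    case (Suc j)
    have "(pderiv ^^ Suc k) ([:-x,1:] * q) =
        pderiv ([:-x,1:] * (pderiv ^^ k) q + Polynomial.smult (int k) ((pderiv ^^ (k - 1)) q))"
      using Suc.IH by simp
    also have "\<dots> = [:-x,1:] * pderiv ((pderiv ^^ k) q) + (pderiv ^^ k) q
        + Polynomial.smult (int k) (pderiv ((pderiv ^^ (k - 1)) q))"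
      unfolding pderiv_add pderiv_mult pderiv_smult by (simp add: pderiv_pCons)
    also have "\<dots> = [:-x,1:] * (pderiv ^^ Suc k) q + Polynomial.smult (int (Suc k)) ((pderiv ^^ k) q)"
      unfolding Suc by (simp add: smult_add_left algebra_simps numeral_poly)
    finally show ?thesis by simp
  qed
qed simp

text \<open>One linear factor is split off at a time, lowering \<open>mu\<close> by one at a single
  point \<open>x\<close>. The Leibniz rule transfers the vanishing to the quotient: at
  \<open>x\<close> through the factor \<open>k + 1\<close>, a unit because
  \<open>mu x \<le> p\<close>; at any other point \<open>y\<close> by induction on \<open>k\<close>,
  because \<open>y - x\<close> is a unit.\<close>

lemma mult_root_count_mod:
  fixes q :: "int poly" and mu :: "int \<Rightarrow> nat"
  assumes "prime p" "finite S" "S \<subseteq> {0..<int p}" "\<not> [:int p:] dvd q"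
    and "\<And>x. x \<in> S \<Longrightarrow> mu x \<le> p"
    and "\<And>x k. x \<in> S \<Longrightarrow> k < mu x \<Longrightarrow> int p dvd poly ((pderiv ^^ k) q) x"
  shows "(\<Sum>x\<in>S. mu x) \<le> degree q"
  using assms(4-6)
proof (induction "degree q" arbitrary: q mu rule: less_induct)
  case less
  show ?case
  proof (cases "\<forall>x\<in>S. mu x = 0")
    case True then show ?thesis by simp
  next
    case False
    then obtain x where x: "x \<in> S" "mu x > 0" by auto
    define q1 where "q1 = synthetic_div q x"
    have px: "int p dvd poly q x" using less.prems(3)[of x 0] x by simp
    have d1: "[:int p:] dvd q - [:-x,1:] * q1"
      unfolding q1_def by (rule const_dvd_minus_synthetic_div[OF px])
    have nz: "degree q > 0"
    proof (rule ccontr)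
      assume "\<not> degree q > 0"
      then have "q1 = 0" unfolding q1_def by (simp add: synthetic_div_eq_0_iff)
      with d1 less.prems(1) show False by simp
    qed
    have deg: "degree q1 = degree q - 1" unfolding q1_def by (rule degree_synthetic_div)
    have n1: "\<not> [:int p:] dvd q1"
    proof
      assume "[:int p:] dvd q1"
      then have "[:int p:] dvd (q - [:-x,1:] * q1) + [:-x,1:] * q1" using d1 by (intro dvd_add dvd_mult)
      with less.prems(1) show False by simp
    qed
    have ev: "int p dvd (y - x) * poly ((pderiv ^^ k) q1) y + int k * poly ((pderiv ^^ (k - 1)) q1) y"
      if "y \<in> S" "k < mu y" for y k
    proof -
      have "[:int p:] dvd (pderiv ^^ k) q - (pderiv ^^ k) ([:-x,1:] * q1)"
        using const_dvd_pderiv_iter[OF d1, of k] by (simp only: pderiv_iter_diff)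
      then have "int p dvd poly ((pderiv ^^ k) q - (pderiv ^^ k) ([:-x,1:] * q1)) y"
        by (rule const_dvd_poly)
      then have "int p dvd poly ((pderiv ^^ k) ([:-x,1:] * q1)) y"
        using less.prems(3)[OF that] by (simp add: dvd_diff_right_iff)
      then show ?thesis unfolding pderiv_iter_linear_mult by (simp add: algebra_simps)
    qed
    define mu1 where "mu1 = mu(x := mu x - 1)"
    have "(\<Sum>y\<in>S. mu1 y) \<le> degree q1"
    proof (rule less.hyps)
      show "degree q1 < degree q" using deg nz by simp
      show "\<not> [:int p:] dvd q1" by (rule n1)
      show "mu1 y \<le> p" if "y \<in> S" for y using less.prems(2)[OF that] by (auto simp: mu1_def)
      show "int p dvd poly ((pderiv ^^ k) q1) y" if y: "y \<in> S" "k < mu1 y" for y k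
      proof (cases "y = x")
        case True
        then have k: "Suc k < mu x" using y by (simp add: mu1_def)
        have "int p dvd int (Suc k) * poly ((pderiv ^^ k) q1) x" using ev[OF x(1) k] by simp
        moreover have "\<not> int p dvd int (Suc k)"
          using less.prems(2)[OF x(1)] k by (auto dest!: zdvd_imp_le)
        ultimately show ?thesis using assms(1) True
          by (meson prime_dvd_mult_iff prime_int_nat_transfer prime_nat_int_transfer)
      next
        case False
        then have k: "k < mu y" using y by (simp add: mu1_def)
        have nd: "\<not> int p dvd y - x"
        proof
          assume "int p dvd y - x"
          then have "y mod int p = x mod int p" by (simp add: mod_eq_dvd_iff)
          moreover have "y \<in> {0..<int p}" "x \<in> {0..<int p}" using x y assms(3) by auto
          ultimately have "y = x" by simp
          with False show False by simp
        qed
        have "k < mu y \<Longrightarrow> int p dvd poly ((pderiv ^^ k) q1) y"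
        proof (induction k)
          case 0
          have "int p dvd (y - x) * poly q1 y" using ev[OF y(1) 0] by simp
          with nd assms(1) show ?case by (simp add: prime_dvd_mult_iff)
        next
          case (Suc k)
          then have "int p dvd (y - x) * poly ((pderiv ^^ Suc k) q1) y"
            using ev[OF y(1) Suc.prems] by (simp add: dvd_add_left_iff)
          with nd assms(1) show ?case by (simp add: prime_dvd_mult_iff)
        qed
        with k show ?thesis by simp
      qed
    qed
    moreover have "(\<Sum>y\<in>S. mu y) = (\<Sum>y\<in>S. mu1 y) + 1"
      using x assms(2) by (simp add: mu1_def sum.remove[of S x])
    ultimately show ?thesis using deg nz by simp
  qed
qed

text \<open>The cofactor of \<open>f ^ (e - k)\<close> in the \<open>k\<close>-th derivative of
  \<open>f ^ e * s\<close>. Its degree is bounded independently of \<open>e\<close>, which is what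
  keeps the number of linear conditions small although the exponent \<open>l + c\<close> grows with
  \<open>p\<close>.\<close>

primrec twderiv :: "int poly \<Rightarrow> int \<Rightarrow> nat \<Rightarrow> int poly \<Rightarrow> int poly" where
  "twderiv f e 0 s = s"
| "twderiv f e (Suc k) s =
     f * pderiv (twderiv f e k s) + Polynomial.smult (e - int k) (pderiv f * twderiv f e k s)"

lemma pderiv_iter_power_mult:
  "k \<le> e \<Longrightarrow> (pderiv ^^ k) (f ^ e * s) = f ^ (e - k) * twderiv f (int e) k s"
proof (induction k)
  case (Suc k)
  then obtain j where j: "e - k = Suc j" "e - Suc k = j" "int e - int k = int (Suc j)"
    by (metis Suc_diff_Suc Suc_le_eq diff_Suc_Suc of_nat_diff Suc_leD)
  have "(pderiv ^^ Suc k) (f ^ e * s) = pderiv (f ^ Suc j * twderiv f (int e) k s)"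
    using Suc j by simp
  also have "\<dots> = f ^ j * twderiv f (int e) (Suc k) s"
    unfolding twderiv.simps j(3) pderiv_mult pderiv_power_Suc
    by (simp add: algebra_simps)
  finally show ?case using j by simp
qed simp

lemma degree_twderiv: "degree (twderiv f e k s) \<le> degree s + k * degree f"
proof (induction k)
  case (Suc k)
  have "degree (f * pderiv (twderiv f e k s)) \<le> degree f + (degree s + k * degree f)"
    by (rule order.trans[OF degree_mult_le]) (use Suc degree_pderiv[of "twderiv f e k s"] in linarith)
  moreover have "degree (Polynomial.smult (e - int k) (pderiv f * twderiv f e k s)) \<le> degree f + (degree s + k * degree f)"
    by (rule order.trans[OF degree_smult_le], rule order.trans[OF degree_mult_le])
       (use Suc degree_pderiv[of f] in linarith)
  ultimately show ?case by (simp add: degree_add_le algebra_simps)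
qed simp

lemma pderiv_iter_sum_smult:
  fixes g :: "'i \<Rightarrow> int poly"
  shows "(pderiv ^^ k) (\<Sum>i\<in>I. Polynomial.smult (w i) (g i)) = (\<Sum>i\<in>I. Polynomial.smult (w i) ((pderiv ^^ k) (g i)))"
proof (induction k)
  case (Suc k)
  have *: "pderiv (\<Sum>i\<in>I. Polynomial.smult (w i) (h i)) = (\<Sum>i\<in>I. Polynomial.smult (w i) (pderiv (h i)))"
    for h :: "'i \<Rightarrow> int poly"
    by (induction I rule: infinite_finite_induct) (auto simp: pderiv_add pderiv_smult)
  show ?case using Suc * by simp
qed simp

text \<open>The derivative of \<open>X ^ (j p)\<close> is divisible by \<open>p\<close>, so this
  monomial behaves like a constant under differentiation modulo \<open>p\<close>.\<close>

lemma pderiv_iter_monom_mult_mod: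
  "[:int p:] dvd (pderiv ^^ k) (Polynomial.monom 1 (j * p) * g) - Polynomial.monom 1 (j * p) * (pderiv ^^ k) g"
proof (induction k)
  case (Suc k)
  let ?m = "Polynomial.monom (1::int) (j * p)"
  have "[:int p:] dvd pderiv ((pderiv ^^ k) (?m * g) - ?m * (pderiv ^^ k) g)"
    using Suc by (rule const_dvd_pderiv)
  then have 1: "[:int p:] dvd (pderiv ^^ Suc k) (?m * g) - ?m * (pderiv ^^ Suc k) g - pderiv ?m * (pderiv ^^ k) g"
    by (simp add: pderiv_diff pderiv_mult algebra_simps)
  have "[:int p:] dvd pderiv ?m" by (simp add: pderiv_monom const_poly_dvd_iff)
  then have 2: "[:int p:] dvd pderiv ?m * (pderiv ^^ k) g" by (rule dvd_mult2)
  from dvd_add[OF 1 2] show ?case by simp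
qed simp

text \<open>Membership in the ideal generated by \<open>p\<close> and \<open>X ^ p\<close>.\<close>

definition low_coeffs_vanish :: "nat \<Rightarrow> int poly \<Rightarrow> bool" where
  "low_coeffs_vanish p q \<longleftrightarrow> (\<forall>i<p. int p dvd poly.coeff q i)"

lemma low_coeffs_vanish_mult: "low_coeffs_vanish p q \<Longrightarrow> low_coeffs_vanish p (q * g)"
  unfolding low_coeffs_vanish_def coeff_mult by (auto intro!: dvd_sum dvd_mult2)

lemma low_coeffs_vanish_mult2: "low_coeffs_vanish p q \<Longrightarrow> low_coeffs_vanish p (g * q)"
  using low_coeffs_vanish_mult[of p q g] by (simp add: mult.commute)

lemma low_coeffs_vanish_add:
  "low_coeffs_vanish p q \<Longrightarrow> low_coeffs_vanish p g \<Longrightarrow> low_coeffs_vanish p (q + g)"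
  unfolding low_coeffs_vanish_def by auto

lemma low_coeffs_vanish_diff:
  "low_coeffs_vanish p q \<Longrightarrow> low_coeffs_vanish p g \<Longrightarrow> low_coeffs_vanish p (q - g)"
  unfolding low_coeffs_vanish_def by auto

lemma low_coeffs_vanish_dvd: "[:int p:] dvd q \<Longrightarrow> low_coeffs_vanish p q"
  unfolding low_coeffs_vanish_def const_poly_dvd_iff by auto

lemma low_coeffs_vanish_monom: "low_coeffs_vanish p (Polynomial.monom 1 p * g)"
  unfolding low_coeffs_vanish_def coeff_monom_mult by auto

lemma fermat_power_cong:
  assumes "prime p"
  shows "[int u ^ p = int u] (mod int p)"
proof -
  have p0: "p > 0" using assms by (rule prime_gt_0_nat)
  have "[u ^ p = u] (mod p)"
  proof (cases "p dvd u")
    case False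
    then have "[u ^ (p - 1) = 1] (mod p)" by (rule fermat_theorem[OF assms])
    then have "[u ^ (p - 1) * u = 1 * u] (mod p)" by (rule cong_scalar_right)
    then show ?thesis using p0 by (simp add: power_eq_if mult.commute)
  next
    case True
    then have "p dvd u ^ p" using p0 by (meson dvd_power dvd_trans)
    with True show ?thesis by (simp add: cong_def mod_eq_0_iff_dvd)
  qed
  then show ?thesis by (metis cong_int_iff of_nat_power)
qed

text \<open>Frobenius: \<open>(X + u) ^ p\<close> is \<open>X ^ p + u\<close> modulo
  \<open>p\<close>, hence the constant \<open>u\<close> once \<open>X ^ p\<close> is discarded as
  well.\<close>

lemma low_coeffs_vanish_linear_power:
  assumes "prime p"
  shows "low_coeffs_vanish p ([:int u, 1:] ^ p - [:int u:])"
proof -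
  have c: "poly.coeff ([:int u, 1:] ^ p) i = int (p choose i) * int u ^ (p - i)" if "i \<le> p" for i
    using coeff_linear_poly_power[OF that, of "int u" 1] by simp
  have "int p dvd poly.coeff ([:int u, 1:] ^ p - [:int u:]) i" if "i < p" for i
  proof (cases "i = 0")
    case True
    have "[int u ^ p = int u] (mod int p)" by (rule fermat_power_cong[OF assms])
    then show ?thesis using True c[of 0] by (simp add: cong_iff_dvd_diff)
  next
    case False
    then have "p dvd p choose i" using that assms by (intro dvd_choose_prime) auto
    then have "int p dvd int (p choose i)" by simp
    then show ?thesis using False c[of i] that by (simp add: coeff_pCons split: nat.splits)
  qed
  then show ?thesis unfolding low_coeffs_vanish_def by blast
qed

lemma low_coeffs_vanish_prod_power:
  assumes "prime p" "finite U"
  shows "low_coeffs_vanish p ((\<Prod>u\<in>U. [:int u, 1:]) ^ p - [:\<Prod>u\<in>U. int u:])"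
  using assms(2)
proof (induction U rule: finite_induct)
  case empty
  then show ?case by (simp add: low_coeffs_vanish_def flip: one_pCons)
next
  case (insert x F)
  let ?A = "[:int x, 1:] ^ p" and ?B = "(\<Prod>u\<in>F. [:int u, 1:]) ^ p" and ?b = "[:\<Prod>u\<in>F. int u:]"
  have "?A * ?B - [:int x * (\<Prod>u\<in>F. int u):] = (?A - [:int x:]) * ?B + [:int x:] * (?B - ?b)"
    by (simp add: algebra_simps)
  moreover have "low_coeffs_vanish p \<dots>"
    by (intro low_coeffs_vanish_add low_coeffs_vanish_mult2 insert.IH
        low_coeffs_vanish_mult low_coeffs_vanish_linear_power assms(1))
  ultimately have "low_coeffs_vanish p (?A * ?B - [:int x * (\<Prod>u\<in>F. int u):])" by simp
  then show ?case unfolding prod.insert[OF insert.hyps] power_mult_distrib .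
qed

text \<open>Comparing the multiplicities of the simple root \<open>c\<close>, by infinite descent.\<close>

lemma squares_ratio_descent:
  fixes u v g :: "int poly"
  assumes "prime p" "\<not> int p dvd K" "\<not> int p dvd poly g c"
    and "[:int p:] dvd [:-c,1:] * g * u\<^sup>2 - Polynomial.smult K (v\<^sup>2)"
  shows "[:int p:] dvd u \<and> [:int p:] dvd v"
  using assms(4)
proof (induction "degree u" arbitrary: u v rule: less_induct)
  case less
  let ?X = "[:-c,1:]"
  have pp: "prime (int p)" using assms(1) by simp
  have nX: "\<not> [:int p:] dvd ?X" by (rule not_const_dvd_linear[OF assms(1)])
  have "int p dvd poly (?X * g * u\<^sup>2 - Polynomial.smult K (v\<^sup>2)) c" by (rule const_dvd_poly[OF less.prems])
  then have "int p dvd K * (poly v c)\<^sup>2" by (simp add: dvd_minus_iff)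
  then have vc: "int p dvd poly v c" using assms(2) pp
    by (metis prime_dvd_mult_iff prime_dvd_power_iff zero_less_numeral)
  define v1 where "v1 = synthetic_div v c"
  have v1: "[:int p:] dvd v - ?X * v1" unfolding v1_def by (rule const_dvd_minus_synthetic_div[OF vc])
  \<comment> \<open>Putting \<open>v = (X - c) v1\<close> and cancelling \<open>X - c\<close> moves
    the linear factor to the other side of the relation; evaluation at \<open>c\<close> then forces
    \<open>u\<close> to vanish there. A second cancellation restores the original shape for the
    quotients \<open>u1\<close> and \<open>v1\<close>.\<close>
  have "?X * (g * u\<^sup>2 - Polynomial.smult K (?X * v1\<^sup>2)) =
      (?X * g * u\<^sup>2 - Polynomial.smult K (v\<^sup>2)) + (v - ?X * v1) * (Polynomial.smult K (v + ?X * v1))"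
    by (simp add: algebra_simps power2_eq_square smult_diff_right smult_add_right)
  then have "[:int p:] dvd ?X * (g * u\<^sup>2 - Polynomial.smult K (?X * v1\<^sup>2))"
    using dvd_add[OF less.prems dvd_mult2[OF v1]] by metis
  then have 2: "[:int p:] dvd g * u\<^sup>2 - Polynomial.smult K (?X * v1\<^sup>2)"
    by (rule const_dvd_mult_cancel[OF assms(1) _ nX])
  have "int p dvd poly (g * u\<^sup>2 - Polynomial.smult K (?X * v1\<^sup>2)) c" by (rule const_dvd_poly[OF 2])
  then have "int p dvd poly g c * (poly u c)\<^sup>2" by simp
  then have uc: "int p dvd poly u c" using assms(3) pp
    by (metis prime_dvd_mult_iff prime_dvd_power_iff zero_less_numeral)
  define u1 where "u1 = synthetic_div u c"
  have u1: "[:int p:] dvd u - ?X * u1" unfolding u1_def by (rule const_dvd_minus_synthetic_div[OF uc])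
  have "?X * (?X * g * u1\<^sup>2 - Polynomial.smult K (v1\<^sup>2)) =
      (g * u\<^sup>2 - Polynomial.smult K (?X * v1\<^sup>2)) + (u - ?X * u1) * (- (u + ?X * u1) * g)"
    by (simp add: algebra_simps power2_eq_square smult_diff_right smult_add_right)
  then have "[:int p:] dvd ?X * (?X * g * u1\<^sup>2 - Polynomial.smult K (v1\<^sup>2))"
    using dvd_add[OF 2 dvd_mult2[OF u1]] by metis
  then have 3: "[:int p:] dvd ?X * g * u1\<^sup>2 - Polynomial.smult K (v1\<^sup>2)"
    by (rule const_dvd_mult_cancel[OF assms(1) _ nX])
  have conc: "[:int p:] dvd u1 \<Longrightarrow> [:int p:] dvd u" "[:int p:] dvd v1 \<Longrightarrow> [:int p:] dvd v"
    using u1 v1 by (metis dvd_add diff_add_cancel dvd_mult)+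
  show ?case
  proof (cases "degree u = 0")
    case False
    then have "degree u1 < degree u" unfolding u1_def degree_synthetic_div by simp
    from less.hyps[OF this 3] conc show ?thesis by simp
  next
    case True
    \<comment> \<open>The descent stops at constant \<open>u\<close>, whose synthetic quotient is
      zero.\<close>
    then have "u1 = 0" unfolding u1_def by (simp add: synthetic_div_eq_0_iff)
    with 3 have "[:int p:] dvd [:K:] * (v1 * v1)" by (simp add: power2_eq_square)
    then have "[:int p:] dvd v1 * v1"
      by (rule const_dvd_mult_cancel[OF assms(1)]) (use assms(2) in simp)
    then have "[:int p:] dvd v1" using const_dvd_mult_cancel[OF assms(1), of v1 v1] by blast
    with conc \<open>u1 = 0\<close> show ?thesis by simp
  qed
qed

section \<open>Stepanov's method\<close>

text \<open>Modulo \<open>p\<close> and \<open>X ^ p\<close> the power \<open>f ^ p\<close> is a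
  constant \<open>K\<close>, a unit because all \<open>u\<close> lie strictly between
  \<open>0\<close> and \<open>p\<close>. What remains, \<open>f r^2 - K s^2\<close>, has degree
  below \<open>p\<close>, so it vanishes modulo \<open>p\<close> altogether. A simple root of
  \<open>f\<close> has odd multiplicity in the first term and even multiplicity in the second, which
  leaves only zero.\<close>

lemma square_difference_eq_zero_mod:
  fixes r s :: "int poly"
  assumes p: "prime p" "odd p" and U: "finite U" "U \<noteq> {}" "U \<subseteq> {1..<p}"
    and f: "f = (\<Prod>u\<in>U. [:int u, 1:])"
    and deg: "2 * degree r + card U < p" "2 * degree s < p"
    and van: "low_coeffs_vanish p (f * r\<^sup>2 - f ^ p * s\<^sup>2)"
  shows "[:int p:] dvd r \<and> [:int p:] dvd s"
proof -
  define K where "K = (\<Prod>u\<in>U. int u)"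
  have "low_coeffs_vanish p ((f * r\<^sup>2 - f ^ p * s\<^sup>2) + (f ^ p - [:K:]) * s\<^sup>2)"
    unfolding f K_def using van[unfolded f] low_coeffs_vanish_prod_power[OF p(1) U(1)]
    by (intro low_coeffs_vanish_add low_coeffs_vanish_mult) auto
  then have 1: "low_coeffs_vanish p (f * r\<^sup>2 - Polynomial.smult K (s\<^sup>2))"
    by (simp add: algebra_simps)
  have "degree f = card U" unfolding f
    by (subst degree_prod_eq_sum_degree) auto
  then have "degree (f * r\<^sup>2) < p"
    using deg(1) degree_mult_le[of f "r\<^sup>2"] degree_power_le[of r 2] by linarith
  moreover have "degree (Polynomial.smult K (s\<^sup>2)) < p"
    using deg(2) degree_smult_le[of K "s\<^sup>2"] degree_power_le[of s 2] by linarith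
  ultimately have d0: "degree (f * r\<^sup>2 - Polynomial.smult K (s\<^sup>2)) < p" by (rule degree_diff_less)
  have d: "[:int p:] dvd f * r\<^sup>2 - Polynomial.smult K (s\<^sup>2)"
    unfolding const_poly_dvd_iff
  proof
    fix i
    show "int p dvd poly.coeff (f * r\<^sup>2 - Polynomial.smult K (s\<^sup>2)) i"
    proof (cases "i < p")
      case True then show ?thesis using 1 unfolding low_coeffs_vanish_def by blast
    next
      case False
      then have "poly.coeff (f * r\<^sup>2 - Polynomial.smult K (s\<^sup>2)) i = 0"
        using d0 by (intro coeff_eq_0) linarith
      then show ?thesis by simp
    qed
  qed
  from U(2) obtain v where v: "v \<in> U" by blast
  define g where "g = (\<Prod>u\<in>U-{v}. [:int u, 1:])"
  have fg: "f = [:-(-int v),1:] * g" unfolding f g_def using v U(1) by (simp add: prod.remove)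
  have pp: "prime (int p)" using p by simp
  have "\<not> int p dvd int u" if "u \<in> U" for u
    using that U(3) nat_dvd_not_less[of u p] by force
  then have nK: "\<not> int p dvd K"
    unfolding K_def using pp U(1) by (auto simp: prime_dvd_prod_iff)
  have "\<not> int p dvd int u - int v" if "u \<in> U - {v}" for u
  proof
    assume "int p dvd int u - int v"
    then have "int u mod int p = int v mod int p" by (simp add: mod_eq_dvd_iff)
    moreover have "u < p" "v < p" using that v U(3) by auto
    ultimately show False using that by simp
  qed
  then have ng: "\<not> int p dvd poly g (-int v)"
    unfolding g_def poly_prod using pp U(1) by (auto simp: prime_dvd_prod_iff)
  show ?thesis by (rule squares_ratio_descent[OF p(1) nK ng d[unfolded fg]])
qed

text \<open>Modulo \<open>X ^ p\<close> only the block \<open>j = 0\<close> survives. Multiplying it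
  by \<open>f (r 0 - f ^ c * s 0)\<close> gives \<open>f (r 0)^2 - f ^ p (s 0)^2\<close>: the
  additional factor \<open>f\<close> raises the exponent \<open>2 c\<close> to \<open>p\<close>.
  Once this block is zero, \<open>X ^ p\<close> can be cancelled and the next block takes its
  place.\<close>

lemma monom_combination_eq_zero_mod:
  fixes r s :: "nat \<Rightarrow> int poly"
  assumes p: "prime p" "odd p" and U: "finite U" "U \<noteq> {}" "U \<subseteq> {1..<p}"
    and f: "f = (\<Prod>u\<in>U. [:int u, 1:])"
    and deg: "\<And>j. 2 * degree (r j) + card U < p" "\<And>j. 2 * degree (s j) < p"
    and van: "[:int p:] dvd (\<Sum>j<J. Polynomial.monom 1 (j * p) * (r j + f ^ ((p - 1) div 2) * s j))"
  shows "\<forall>j<J. [:int p:] dvd r j \<and> [:int p:] dvd s j"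
  using deg van
proof (induction J arbitrary: r s)
  case (Suc J)
  let ?c = "(p - 1) div 2"
  let ?G = "\<Sum>j<J. Polynomial.monom 1 (j * p) * (r (Suc j) + f ^ ?c * s (Suc j))"
  have eq: "(\<Sum>j<Suc J. Polynomial.monom 1 (j * p) * (r j + f ^ ?c * s j)) =
      (r 0 + f ^ ?c * s 0) + Polynomial.monom 1 p * ?G"
    unfolding sum.lessThan_Suc_shift sum_distrib_left
    by (simp add: mult.assoc[symmetric] mult_monom del: mult_Suc) (simp add: one_pCons[symmetric] algebra_simps monom_0)
  have c: "2 * ?c + 1 = p" using p by (auto elim!: oddE)
  have id: "f * x\<^sup>2 - f ^ (2 * c + 1) * y\<^sup>2 =
      ((x + f ^ c * y) + z) * (f * (x - f ^ c * y)) - z * (f * (x - f ^ c * y))" for x y z and c :: nat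
  proof -
    have "f ^ (2 * c + 1) = f * (f ^ c * f ^ c)" by (simp add: power_even_eq power2_eq_square)
    then have "f * x\<^sup>2 - f ^ (2 * c + 1) * y\<^sup>2 = f * x\<^sup>2 - f * (f ^ c * f ^ c) * y\<^sup>2" by (rule arg_cong)
    then show ?thesis by (simp add: algebra_simps power2_eq_square)
  qed
  have "low_coeffs_vanish p (f * (r 0)\<^sup>2 - f ^ p * (s 0)\<^sup>2)"
    unfolding id[of "r 0" ?c "s 0" "Polynomial.monom 1 p * ?G", unfolded c]
    by (rule low_coeffs_vanish_diff[OF
          low_coeffs_vanish_mult[OF low_coeffs_vanish_dvd[OF Suc.prems(3)[unfolded eq]]]
          low_coeffs_vanish_mult[OF low_coeffs_vanish_monom]])
  then have 0: "[:int p:] dvd r 0 \<and> [:int p:] dvd s 0"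
    by (rule square_difference_eq_zero_mod[OF p U f Suc.prems(1,2)])
  have "[:int p:] dvd Polynomial.monom 1 p * ?G"
    using Suc.prems(3) 0 unfolding eq by (meson dvd_add dvd_add_right_iff dvd_mult)
  moreover have "\<not> [:int p:] dvd Polynomial.monom 1 p"
    using p(1) by (auto simp: const_poly_dvd_iff intro!: exI[of _ p])
  ultimately have "[:int p:] dvd ?G" by (rule const_dvd_mult_cancel[OF p(1)])
  then have "\<forall>j<J. [:int p:] dvd r (Suc j) \<and> [:int p:] dvd s (Suc j)"
    by (intro Suc.IH Suc.prems)
  with 0 show ?case by (metis less_Suc_eq_0_disj)
qed simp

lemma sum_product_weights:
  fixes w :: "nat \<times> bool \<times> nat \<Rightarrow> int" and G :: "nat \<times> bool \<times> nat \<Rightarrow> int poly"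
  shows "(\<Sum>c\<in>{..<J}\<times>UNIV\<times>{..<D}. F c) =
    (\<Sum>j<J. (\<Sum>i<D. F (j, False, i)) + (\<Sum>i<D. F (j, True, i :: nat) :: int poly))"
proof -
  have "(\<Sum>c\<in>{..<J}\<times>UNIV\<times>{..<D}. F c) = (\<Sum>j<J. \<Sum>b\<in>UNIV. \<Sum>i<D. F (j, b, i))"
    by (simp only: sum.cartesian_product) (simp add: case_prod_beta)
  then show ?thesis by (simp add: UNIV_bool)
qed

text \<open>
  The auxiliary polynomial is \<open>\<Sum>\<^sub>j X\<^sup>j\<^sup>p (f\<^sup>l r\<^sub>j + f\<^sup>l\<^sup>+\<^sup>c s\<^sub>j)\<close> with \<open>deg r\<^sub>j, deg s\<^sub>j < D\<close>. On \<open>S\<close> we have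
  \<open>X\<^sup>p = X\<close> and \<open>f\<^sup>c = a\<close>, so its first \<open>l\<close> derivatives vanish on \<open>S\<close> once \<open>l\<close> polynomials of degree less
  than \<open>J + D + l d\<close> vanish: fewer linear conditions than the \<open>2 J D\<close> unknown coefficients.
\<close>

theorem stepanov_bound:
  fixes p l J D :: nat and f :: "int poly" and a :: int
  assumes p: "prime p" "odd p" and U: "finite U" "U \<noteq> {}" "U \<subseteq> {1..<p}"
    and f: "f = (\<Prod>u\<in>U. [:int u, 1:])" and c_def: "c = (p - 1) div 2" and d_def: "d = card U"
    and J: "J \<ge> 1" "l = 2 * J - 1" "l \<le> p"
    and D: "D = c - d" "D > l * (l * d + J)"
    and S: "S \<subseteq> {0..<int p}" "\<And>x. x \<in> S \<Longrightarrow> [poly f x ^ c = a] (mod int p)"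
  shows "l * card S \<le> (J - 1) * p + (l + c) * d + D"
proof -
  define ex where "ex b = (if b then l + c else l)" for b
  \<comment> \<open>What is left on \<open>S\<close> of the \<open>k\<close>-th derivative of one
    column: \<open>X ^ (j p)\<close> is replaced by \<open>X ^ j\<close>, the power
    \<open>f ^ c\<close> by \<open>a\<close>, and the common factor \<open>f ^ (l - k)\<close> is
    removed.\<close>
  define base where "base k col = (case col of (j, b, i) \<Rightarrow>
      Polynomial.monom 1 j * Polynomial.smult (if b then a else 1)
        (twderiv f (int (ex b)) k (Polynomial.monom 1 i)))" for k :: nat and col :: "nat \<times> bool \<times> nat"
  define R0 where "R0 col = (case col of (j, b, i) \<Rightarrow>
      Polynomial.monom 1 (j * p) * (f ^ ex b * Polynomial.monom (1::int) i))" for col :: "nat \<times> bool \<times> nat"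
  define Cs where "Cs = {..<J} \<times> (UNIV :: bool set) \<times> {..<D}"
  define E where "E = J + D + l * d"
  define Rw where "Rw = {..<l} \<times> {..<E}"
  have fin: "finite Cs" "finite Rw" "finite S" unfolding Cs_def Rw_def
    using finite_subset[OF S(1)] by auto
  have degf: "degree f = d" unfolding f d_def by (subst degree_prod_eq_sum_degree) auto
  have l1: "l \<ge> 1" "2 * J = l + 1" using J by auto
  \<comment> \<open>Because \<open>2 J = l + 1\<close>, there are \<open>(l + 1) D\<close> unknowns
    against \<open>l D + l (l d + J)\<close> conditions; the hypothesis on \<open>D\<close> says
    exactly that the surplus \<open>D\<close> wins.\<close>
  have "l * E < (l + 1) * D" using D(2) unfolding E_def by (simp add: algebra_simps)
  also have "\<dots> = J * (2 * D)" unfolding l1(2)[symmetric] by simp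
  finally have "card Rw < card Cs" unfolding Rw_def Cs_def by (simp add: card_cartesian_product)
  from siegel_mod[OF fin(2) fin(1) this prime_ge_2_nat[OF p(1)],
      of "\<lambda>r col. poly.coeff (base (fst r) col) (snd r)"]
  obtain w where w: "(\<exists>col\<in>Cs. \<not> int p dvd w col) \<and>
      (\<forall>r\<in>Rw. int p dvd (\<Sum>col\<in>Cs. w col * poly.coeff (base (fst r) col) (snd r)))"
    by (rule exE)
  have w2: "int p dvd (\<Sum>col\<in>Cs. w col * poly.coeff (base k col) i)" if "k < l" "i < E" for k i
    using bspec[OF conjunct2[OF w], of "(k, i)"] that unfolding Rw_def by simp
  define Q where "Q k = (\<Sum>col\<in>Cs. Polynomial.smult (w col) (base k col))" for k
  define R where "R = (\<Sum>col\<in>Cs. Polynomial.smult (w col) (R0 col))"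
  have D0: "D > 0" using D(2) by simp
  have degb: "degree (base k col) < E" if kl: "k < l" and colc: "col \<in> Cs" for k col
  proof -
    obtain j b i where col: "col = (j, b, i)" "j < J" "i < D" using colc unfolding Cs_def by auto
    have "degree (base k col) \<le> j + (i + k * d)"
      unfolding base_def col(1) prod.case
      using degree_mult_le[of "Polynomial.monom (1::int) j" "Polynomial.smult (if b then a else 1)
        (twderiv f (int (ex b)) k (Polynomial.monom 1 i))"]
        degree_smult_le[of "if b then a else 1" "twderiv f (int (ex b)) k (Polynomial.monom 1 i)"]
        degree_twderiv[of f "int (ex b)" k "Polynomial.monom 1 i"]
        degree_monom_le[of "1::int" j] degree_monom_le[of "1::int" i]
      unfolding degf by linarith
    moreover have "k * d \<le> l * d" using kl by simp
    ultimately show ?thesis unfolding E_def using col by linarith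
  qed
  have Qz: "[:int p:] dvd Q k" if "k < l" for k
    unfolding const_poly_dvd_iff
  proof
    fix i
    show "int p dvd poly.coeff (Q k) i"
    proof (cases "i < E")
      case True
      then show ?thesis using w2[OF that True] unfolding Q_def by (simp add: coeff_sum)
    next
      case False
      then have "poly.coeff (base k col) i = 0" if "col \<in> Cs" for col
        using degb[OF \<open>k < l\<close> that] by (intro coeff_eq_0) linarith
      then show ?thesis unfolding Q_def by (simp add: coeff_sum)
    qed
  qed
  have van: "int p dvd poly ((pderiv ^^ k) R) x" if x: "x \<in> S" and k: "k < l" for x k
  proof -
    have xp: "[x ^ p = x] (mod int p)"
      using fermat_power_cong[OF p(1), of "nat x"] x S(1) by auto
    have term_cong: "[poly ((pderiv ^^ k) (R0 col)) x = poly f x ^ (l - k) * poly (base k col) x] (mod int p)"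
      if col: "col \<in> Cs" for col
    proof -
      obtain j b i where col: "col = (j, b, i)" by (metis prod.exhaust)
      let ?t = "twderiv f (int (ex b)) k (Polynomial.monom 1 i)"
      have "k \<le> ex b" using k by (simp add: ex_def)
      then have "[:int p:] dvd (pderiv ^^ k) (R0 col) - Polynomial.monom 1 (j * p) * (f ^ (ex b - k) * ?t)"
        unfolding R0_def col prod.case
        using pderiv_iter_monom_mult_mod[of p k j "f ^ ex b * Polynomial.monom 1 i"]
        by (simp only: pderiv_iter_power_mult)
      from const_dvd_poly[OF this, of x]
      have "[poly ((pderiv ^^ k) (R0 col)) x = x ^ (j * p) * (poly f x ^ (ex b - k) * poly ?t x)] (mod int p)"
        by (simp add: cong_iff_dvd_diff poly_monom)
      also have "[x ^ (j * p) * (poly f x ^ (ex b - k) * poly ?t x) =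
          x ^ j * ((poly f x ^ (l - k) * (if b then a else 1)) * poly ?t x)] (mod int p)"
      proof (intro cong_mult cong_refl)
        have "[(x ^ p) ^ j = x ^ j] (mod int p)" by (rule cong_pow[OF xp])
        then show "[x ^ (j * p) = x ^ j] (mod int p)" by (simp add: mult.commute flip: power_mult)
        have "[poly f x ^ (l - k) * poly f x ^ c = poly f x ^ (l - k) * a] (mod int p)"
          by (intro cong_mult cong_refl S(2) x)
        moreover have "l + c - k = (l - k) + c" using k by simp
        ultimately show "[poly f x ^ (ex b - k) = poly f x ^ (l - k) * (if b then a else 1)] (mod int p)"
          by (simp add: ex_def power_add)
      qed
      finally show ?thesis unfolding base_def col prod.case by (simp add: poly_monom algebra_simps)
    qed
    have "poly ((pderiv ^^ k) R) x = (\<Sum>col\<in>Cs. w col * poly ((pderiv ^^ k) (R0 col)) x)"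
      unfolding R_def pderiv_iter_sum_smult by (simp add: poly_sum)
    also have "[\<dots> = (\<Sum>col\<in>Cs. w col * (poly f x ^ (l - k) * poly (base k col) x))] (mod int p)"
      by (intro cong_sum cong_mult cong_refl term_cong)
    also have "(\<Sum>col\<in>Cs. w col * (poly f x ^ (l - k) * poly (base k col) x)) = poly f x ^ (l - k) * poly (Q k) x"
      unfolding Q_def by (simp add: poly_sum sum_distrib_left algebra_simps)
    also have "[\<dots> = 0] (mod int p)"
      using const_dvd_poly[OF Qz[OF k], of x] by (simp add: cong_0_iff)
    finally show ?thesis by (simp add: cong_0_iff)
  qed
  have degR: "degree R \<le> (J - 1) * p + (l + c) * d + D"
    unfolding R_def
  proof (rule degree_sum_le[OF fin(1)])
    fix col assume col: "col \<in> Cs"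
    then obtain j b i where col: "col = (j, b, i)" "j < J" "i < D" unfolding Cs_def by auto
    have "degree (f ^ ex b) \<le> d * (l + c)"
      using degree_power_le[of f "ex b"] unfolding degf ex_def
      by (auto intro: order.trans simp: algebra_simps)
    moreover have "j * p \<le> (J - 1) * p" using col by (intro mult_right_mono) auto
    ultimately have "degree (R0 col) \<le> (J - 1) * p + (d * (l + c) + D)"
      unfolding R0_def col(1) prod.case
      using degree_mult_le[of "Polynomial.monom (1::int) (j * p)" "f ^ ex b * Polynomial.monom (1::int) i"]
        degree_mult_le[of "f ^ ex b" "Polynomial.monom (1::int) i"]
        degree_monom_le[of "1::int" i] degree_monom_le[of "1::int" "j * p"] col(3) by linarith
    then show "degree (Polynomial.smult (w col) (R0 col)) \<le> (J - 1) * p + (l + c) * d + D"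
      using degree_smult_le[of "w col" "R0 col"] by (simp add: algebra_simps)
  qed
  have nz: "\<not> [:int p:] dvd R"
  proof
    assume pR: "[:int p:] dvd R"
    \<comment> \<open>\<open>part False j\<close> and \<open>part True j\<close> are the polynomials
      \<open>r\<close> and \<open>s\<close> of the block \<open>j\<close>, with the solution of the
      linear system as coefficients. If all of them vanish modulo \<open>p\<close>, so do all
      weights.\<close>
    define part where "part b j = (\<Sum>i<D. Polynomial.monom (w (j, b, i)) i)" for b j
    have degp: "degree (part b j) < D" for b j
      unfolding part_def
      by (rule degree_lessI) (use D0 in \<open>auto simp: coeff_sum\<close>)
    have t: "Polynomial.smult a (Polynomial.monom 1 n * (F * Polynomial.monom 1 i)) =
        F * (Polynomial.monom 1 n * Polynomial.monom a i)" for a :: int and n F i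
    proof -
      have "Polynomial.monom a i = Polynomial.smult a (Polynomial.monom 1 i)"
        by (simp add: smult_monom)
      then show ?thesis by (simp add: mult.left_commute)
    qed
    have "R = (\<Sum>j<J. f ^ l * (Polynomial.monom 1 (j * p) * part False j)
        + f ^ (l + c) * (Polynomial.monom 1 (j * p) * part True j))"
      unfolding R_def Cs_def sum_product_weights R0_def part_def ex_def sum_distrib_left prod.case t by simp
    also have "\<dots> = f ^ l * (\<Sum>j<J. Polynomial.monom 1 (j * p) * (part False j + f ^ c * part True j))"
      unfolding sum_distrib_left by (intro sum.cong refl) (simp add: power_add algebra_simps)
    finally have R_eq: "R = f ^ l * (\<Sum>j<J. Polynomial.monom 1 (j * p) * (part False j + f ^ c * part True j))" .
    have nf: "\<not> [:int p:] dvd f"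
    proof
      assume "[:int p:] dvd f"
      then have "int p dvd lead_coeff f" by (simp add: const_poly_dvd_iff)
      moreover have "lead_coeff f = 1" unfolding f lead_coeff_prod by simp
      ultimately show False using p(1) by simp
    qed
    have "prime_elem [:int p:]" using p(1) by (intro lift_prime_elem_poly) auto
    then have "\<not> [:int p:] dvd f ^ l" using nf prime_elem_dvd_power by blast
    from const_dvd_mult_cancel[OF p(1) pR[unfolded R_eq] this]
    have s: "[:int p:] dvd (\<Sum>j<J. Polynomial.monom 1 (j * p) * (part False j + f ^ ((p - 1) div 2) * part True j))"
      unfolding c_def .
    have c2: "2 * c < p" using p unfolding c_def by (auto elim!: oddE)
    have degs: "2 * degree (part False j) + card U < p" "2 * degree (part True j) < p" for j
      using degp[of False j] degp[of True j] c2 D(1) unfolding d_def by linarith+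
    from monom_combination_eq_zero_mod[OF p U f degs s]
    have parts: "\<forall>j<J. [:int p:] dvd part False j \<and> [:int p:] dvd part True j" .
    from conjunct1[OF w] obtain j b i where ji: "j < J" "i < D" "\<not> int p dvd w (j, b, i)" unfolding Cs_def by auto
    have "[:int p:] dvd part b j" using parts ji(1) by (cases b) auto
    then have "int p dvd poly.coeff (part b j) i" by (simp add: const_poly_dvd_iff)
    then show False using ji by (simp add: part_def coeff_sum)
  qed
  have "(\<Sum>x\<in>S. l) \<le> degree R"
    by (rule mult_root_count_mod[OF p(1) fin(3) S(1) nz]) (use J van in auto)
  with degR show ?thesis by (simp add: mult.commute)
qed

section \<open>Character sums\<close>

lemma Legendre_values: "Legendre a p \<in> {-1, 0, 1}"
  by (simp add: Legendre_def)

text \<open>Two elements of \<open>{-1, 0, 1}\<close> differ by at most \<open>2 < p\<close>, so a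
  congruence between them is an equality.\<close>

lemma Legendre_eqI:
  assumes "2 < p" "[Legendre a (int p) = z] (mod int p)" "z \<in> {-1, 0, 1}"
  shows "Legendre a (int p) = z"
proof (rule ccontr)
  assume ne: "Legendre a (int p) \<noteq> z"
  have "int p dvd Legendre a (int p) - z" using assms(2) by (simp add: cong_iff_dvd_diff)
  then have "\<bar>int p\<bar> \<le> \<bar>Legendre a (int p) - z\<bar>" using ne by (intro dvd_imp_le_int) auto
  with assms(1,3) Legendre_values[of a "int p"] show False by auto
qed

lemma Legendre_mult:
  assumes "prime p" "2 < p"
  shows "Legendre (a * b) (int p) = Legendre a (int p) * Legendre b (int p)"
proof (rule Legendre_eqI[OF assms(2)])
  have "[Legendre (a * b) (int p) = (a * b) ^ ((p - 1) div 2)] (mod int p)"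
    by (rule euler_criterion[OF assms])
  also have "(a * b) ^ ((p - 1) div 2) = a ^ ((p - 1) div 2) * b ^ ((p - 1) div 2)"
    by (rule power_mult_distrib)
  also have "[\<dots> = Legendre a (int p) * Legendre b (int p)] (mod int p)"
    by (intro cong_mult cong_sym[OF euler_criterion] assms)
  finally show "[Legendre (a * b) (int p) = Legendre a (int p) * Legendre b (int p)] (mod int p)" .
  show "Legendre a (int p) * Legendre b (int p) \<in> {-1, 0, 1}"
    using Legendre_values[of a "int p"] Legendre_values[of b "int p"] by auto
qed

lemma Legendre_cong: "[a = b] (mod p) \<Longrightarrow> Legendre a p = Legendre b p"
  unfolding Legendre_def QuadRes_def cong_def by simp

lemma Legendre_eq_0_iff: "Legendre a p = 0 \<longleftrightarrow> p dvd a"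
  by (auto simp: Legendre_def cong_0_iff)

definition chi :: "nat \<Rightarrow> int \<Rightarrow> real" where
  "chi p x = of_int (Legendre x (int p))"

lemma chi_values: "chi p x \<in> {-1, 0, 1}"
  using Legendre_values[of x "int p"] by (auto simp: chi_def)

lemma chi_abs_le: "\<bar>chi p x\<bar> \<le> 1"
  using chi_values[of p x] by auto

lemma chi_cong: "[x = y] (mod int p) \<Longrightarrow> chi p x = chi p y"
  by (simp add: chi_def Legendre_cong)

lemma chi_eq_0_iff: "chi p x = 0 \<longleftrightarrow> int p dvd x"
  by (simp add: chi_def Legendre_eq_0_iff)

lemma chi_mult: "prime p \<Longrightarrow> 2 < p \<Longrightarrow> chi p (x * y) = chi p x * chi p y"
  by (simp add: chi_def Legendre_mult)

lemma chi_one: "prime p \<Longrightarrow> chi p 1 = 1"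
  using prime_gt_1_nat[of p] unfolding chi_def Legendre_def QuadRes_def
  by (auto simp: cong_0_iff intro!: exI[of _ 1])

lemma chi_prod:
  assumes "prime p" "2 < p"
  shows "chi p (\<Prod>u\<in>U. g u) = (\<Prod>u\<in>U. chi p (g u))"
  by (induction U rule: infinite_finite_induct) (auto simp: chi_one chi_mult assms)

lemma abs_prod_chi_le: "\<bar>\<Prod>u\<in>U. chi p (g u)\<bar> \<le> 1"
  unfolding abs_prod by (rule prod_le_1) (auto simp: chi_abs_le)

lemma finite_filter_residues: "finite {y\<in>{0..<int p}. P y}"
  by (rule finite_subset[of _ "{0..<int p}"]) auto

lemma card_roots_le:
  assumes "p > 0" "finite U"
  shows "card {y\<in>{0..<int p}. \<exists>u\<in>U. int p dvd y + int u} \<le> card U"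
proof -
  have "{y\<in>{0..<int p}. \<exists>u\<in>U. int p dvd y + int u} \<subseteq> (\<lambda>u. (- int u) mod int p) ` U"
  proof
    fix y assume "y \<in> {y\<in>{0..<int p}. \<exists>u\<in>U. int p dvd y + int u}"
    then obtain u where u: "u \<in> U" "y \<in> {0..<int p}" "int p dvd y - (- int u)" by auto
    then have "y mod int p = (- int u) mod int p" by (simp only: mod_eq_dvd_iff)
    with u show "y \<in> (\<lambda>u. (- int u) mod int p) ` U" by auto
  qed
  then show ?thesis by (rule surj_card_le[OF assms(2)])
qed

theorem complete_sum_bound:
  fixes U :: "nat set" and \<delta> :: real
  assumes U: "finite U" "U \<noteq> {}" "\<forall>u\<in>U. u > 0" and "\<delta> > 0"
  shows "\<forall>\<^sub>F p in at_top. prime p \<longrightarrow>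
    \<bar>\<Sum>y\<in>{0..<int p}. \<Prod>u\<in>U. chi p (y + int u)\<bar> \<le> \<delta> * real p"
proof -
  define d where "d = card U"
  \<comment> \<open>\<open>J\<close> is chosen so that \<open>2 d \<le> \<delta> l\<close>: the main
    error \<open>d p / l\<close> then uses at most half of \<open>\<delta> p\<close>, and the rest
    pays for the terms bounded independently of \<open>p\<close>.\<close>
  obtain J0 :: nat where J0: "real d * 2 / \<delta> < real J0" using reals_Archimedean2 by blast
  define J where "J = J0 + 1"
  define l where "l = 2 * J - 1"
  have l: "real d * 2 \<le> \<delta> * real l" "l \<ge> 1" "2 * J = l + 1" "J \<ge> 1"
  proof -
    have "real d * 2 < \<delta> * real J0" using J0 assms(4) by (simp add: field_simps)
    also have "\<dots> \<le> \<delta> * real l" unfolding l_def J_def using assms(4) by (intro mult_left_mono) auto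
    finally show "real d * 2 \<le> \<delta> * real l" by simp
  qed (auto simp: l_def J_def)
  \<comment> \<open>The summands guarantee in turn that \<open>U\<close> lies below
    \<open>p\<close>, that \<open>p > 2\<close>, that \<open>l \<le> p\<close>, that
    \<open>D > l (l d + J)\<close>, and that \<open>6 d \<le> \<delta> p\<close>.\<close>
  define p0 where "p0 = Max U + 3 + l + 2 * (d + l * (l * d + J) + 2) + nat \<lceil>6 * real d / \<delta>\<rceil>"
  have "\<bar>\<Sum>y\<in>{0..<int p}. \<Prod>u\<in>U. chi p (y + int u)\<bar> \<le> \<delta> * real p" if p: "p \<ge> p0" "prime p" for p
  proof -
    have p3: "p > 2" using p(1) unfolding p0_def by linarith
    then have odd: "odd p" using p(2) prime_odd_nat by auto
    define c where "c = (p - 1) div 2"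
    define D where "D = c - d"
    have pc: "p = 2 * c + 1" using odd unfolding c_def by (auto elim!: oddE)
    have Up: "U \<subseteq> {1..<p}"
    proof
      fix u assume "u \<in> U"
      moreover from this have "u \<le> Max U" using U by simp
      ultimately show "u \<in> {1..<p}" using U(3) p(1) unfolding p0_def by force
    qed
    have "2 * (d + l * (l * d + J) + 2) \<le> 2 * c + 1" using p(1) unfolding pc p0_def by simp
    then have "d + l * (l * d + J) + 1 \<le> c" by presburger
    then have Dl: "D > l * (l * d + J)" "c \<ge> d" unfolding D_def by auto
    have lp: "l \<le> p" using p(1) unfolding p0_def by linarith
    define f where "f = (\<Prod>u\<in>U. [:int u, 1:])"
    have pf: "poly f y = (\<Prod>u\<in>U. y + int u)" for y by (simp add: f_def poly_prod add.commute)
    define S where "S z = {y\<in>{0..<int p}. Legendre (poly f y) (int p) = z}" for z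
    have bound: "2 * real l * real (card (S z)) \<le> real l * real p + real d * real p + 2 * real l * real d" for z
    proof -
      have "l * card (S z) \<le> (J - 1) * p + (l + c) * d + D"
      proof (rule stepanov_bound[OF p(2) odd U(1,2) Up f_def c_def d_def l(4) l_def lp D_def Dl(1)])
        show "S z \<subseteq> {0..<int p}" by (auto simp: S_def)
        show "[poly f x ^ c = z] (mod int p)" if "x \<in> S z" for x
          using euler_criterion[OF p(2) p3, of "poly f x"] that unfolding S_def c_def by (auto intro: cong_sym)
      qed
      then have "2 * (l * card (S z)) \<le> (2 * J - 2) * p + (2 * l + 2 * c) * d + 2 * D"
        using l(4) by (simp add: algebra_simps diff_mult_distrib)
      also have "(2 * J - 2) * p = l * p - p" using l(3) by (simp add: diff_mult_distrib)
      also have "l * p - p + (2 * l + 2 * c) * d + 2 * D \<le> l * p + 2 * l * d + p * d"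
      proof -
        have "l * p \<ge> p" using l(2) by simp
        then obtain k where k: "l * p = p + k" using le_Suc_ex by blast
        have "2 * D + 1 \<le> p" unfolding D_def pc by simp
        moreover have "2 * c * d \<le> p * d" unfolding pc by simp
        ultimately show ?thesis unfolding k add_mult_distrib by linarith
      qed
      finally have "real (2 * (l * card (S z))) \<le> real (l * p + 2 * l * d + p * d)" by (rule of_nat_mono)
      then show ?thesis by (simp add: algebra_simps)
    qed
    have fin: "finite (S z)" for z unfolding S_def by (rule finite_filter_residues)
    have part: "{0..<int p} = S 1 \<union> S (-1) \<union> S 0"
      using Legendre_values by (auto simp: S_def)
    have disj: "S 1 \<inter> S (-1) = {}" "(S 1 \<union> S (-1)) \<inter> S 0 = {}" by (auto simp: S_def)
    have "real p = real (card {0..<int p})" by simp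
    also have "\<dots> = real (card (S 1)) + real (card (S (-1))) + real (card (S 0))"
      unfolding part using disj fin by (simp add: card_Un_disjoint)
    finally have cp: "real p = real (card (S 1)) + real (card (S (-1))) + real (card (S 0))" .
    have "S 0 \<subseteq> {y\<in>{0..<int p}. \<exists>u\<in>U. int p dvd y + int u}"
      unfolding S_def Legendre_eq_0_iff pf using p(2) U(1)
      by (auto simp: prime_dvd_prod_iff)
    from card_mono[OF finite_filter_residues this] card_roots_le[OF _ U(1), of p] p3
    have S0: "card (S 0) \<le> d" unfolding d_def by simp
    have "(\<Sum>y\<in>{0..<int p}. \<Prod>u\<in>U. chi p (y + int u)) = (\<Sum>y\<in>{0..<int p}. chi p (poly f y))"
      unfolding pf chi_prod[OF p(2) p3] ..
    also have "\<dots> = (\<Sum>y\<in>S 1. chi p (poly f y)) + (\<Sum>y\<in>S (-1). chi p (poly f y)) + (\<Sum>y\<in>S 0. chi p (poly f y))"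
      unfolding part using disj fin by (simp add: sum.union_disjoint)
    also have "\<dots> = (\<Sum>y\<in>S 1. 1) + (\<Sum>y\<in>S (-1). -1) + (\<Sum>y\<in>S 0. 0)"
      by (intro arg_cong2[of _ _ _ _ "(+)"] sum.cong refl) (auto simp: S_def chi_def)
    finally have sum_eq: "(\<Sum>y\<in>{0..<int p}. \<Prod>u\<in>U. chi p (y + int u)) = real (card (S 1)) - real (card (S (-1)))"
      by simp
    \<comment> \<open>Replacing \<open>p\<close> in the bound for one fibre by the sum of the three
      fibre sizes turns the upper bound for that fibre into a bound for the difference of the two.
      The zeros of \<open>f\<close> contribute the third \<open>l d\<close>.\<close>
    have "real l * \<bar>real (card (S 1)) - real (card (S (-1)))\<bar> \<le> real d * real p + 3 * real l * real d"
    proof -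
      have "real l * real (card (S 0)) \<le> real l * real d" using S0 by (intro mult_left_mono) auto
      moreover have "real l * real p = real l * real (card (S 1)) + real l * real (card (S (-1))) + real l * real (card (S 0))"
        unfolding cp by (simp add: algebra_simps)
      ultimately show ?thesis using bound[of 1] bound[of "-1"]
        by (simp add: abs_if right_diff_distrib)
    qed
    also have "\<dots> \<le> real l * (\<delta> * real p)"
    proof -
      have "6 * real d / \<delta> \<le> real p" using p(1) unfolding p0_def by linarith
      then have "6 * real d \<le> \<delta> * real p" using assms(4) by (simp add: field_simps)
      then have "real l * (6 * real d) \<le> real l * (\<delta> * real p)" by (intro mult_left_mono) auto
      moreover have "(real d * 2) * real p \<le> (\<delta> * real l) * real p"
        using l(1) by (intro mult_right_mono) auto
      ultimately show ?thesis by (simp add: algebra_simps)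
    qed
    finally show ?thesis unfolding sum_eq using l(2) by simp
  qed
  then show ?thesis unfolding eventually_at_top_linorder by blast
qed

section \<open>Incomplete character sums\<close>

lemma sum_shift_le:
  fixes F :: "int \<Rightarrow> real"
  assumes "\<And>n. \<bar>F n\<bar> \<le> 1"
  shows "\<bar>(\<Sum>n<N. F (int n)) - (\<Sum>n<N. F (int n + int h))\<bar> \<le> 2 * real h"
proof (induction h)
  case (Suc h)
  define G where "G n = F (int n + int h)" for n :: nat
  have "(\<Sum>n<N. G (Suc n)) + G 0 = (\<Sum>n<N. G n) + G N"
    by (metis add.commute sum.lessThan_Suc sum.lessThan_Suc_shift)
  moreover have "(\<Sum>n<N. G (Suc n)) = (\<Sum>n<N. F (int n + int (Suc h)))"
    by (simp add: G_def algebra_simps)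
  moreover have "\<bar>G 0\<bar> \<le> 1" "\<bar>G N\<bar> \<le> 1" using assms by (auto simp: G_def)
  ultimately have "\<bar>(\<Sum>n<N. F (int n + int h)) - (\<Sum>n<N. F (int n + int (Suc h)))\<bar> \<le> 2"
    unfolding G_def by linarith
  with Suc show ?case by simp
qed simp

text \<open>Van der Corput: averaging over \<open>H\<close> shifts reduces an incomplete sum to complete correlations.\<close>

lemma van_der_Corput_periodic:
  fixes F :: "int \<Rightarrow> real"
  assumes bd: "\<And>n. \<bar>F n\<bar> \<le> 1" and "N \<le> p" "H \<ge> 1" "\<eta> \<ge> 0"
    and corr: "\<And>h h'. h \<in> {1..H} \<Longrightarrow> h' \<in> {1..H} \<Longrightarrow> h \<noteq> h' \<Longrightarrow>
      \<bar>\<Sum>n<p. F (int n + int h) * F (int n + int h')\<bar> \<le> \<eta> * real p"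
  shows "\<bar>\<Sum>n<N. F (int n)\<bar> \<le> real p * sqrt (1 / real H + \<eta>) + 2 * real H"
proof -
  define X where "X n = (\<Sum>h=1..H. F (int n + int h))" for n :: nat
  have sq: "(\<Sum>n<p. (X n)\<^sup>2) \<le> real H * real p + (real H)\<^sup>2 * (\<eta> * real p)"
  proof -
    have "(\<Sum>n<p. (X n)\<^sup>2) = (\<Sum>n<p. \<Sum>h=1..H. \<Sum>h'=1..H. F (int n + int h) * F (int n + int h'))"
      unfolding X_def power2_eq_square sum_product ..
    also have "\<dots> = (\<Sum>h=1..H. \<Sum>h'=1..H. \<Sum>n<p. F (int n + int h) * F (int n + int h'))"
      by (subst sum.swap, rule sum.cong[OF refl], subst sum.swap, rule refl)
    also have "\<dots> \<le> (\<Sum>h=1..H. \<Sum>h'=1..H. (if h = h' then real p else 0) + \<eta> * real p)"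
    proof (intro sum_mono)
      fix h h' assume h: "h \<in> {1..H}" "h' \<in> {1..H}"
      show "(\<Sum>n<p. F (int n + int h) * F (int n + int h')) \<le> (if h = h' then real p else 0) + \<eta> * real p"
      proof (cases "h = h'")
        case True
        have "(\<Sum>n<p. F (int n + int h) * F (int n + int h)) \<le> (\<Sum>n<p. 1)"
          using bd by (intro sum_mono) (metis abs_mult_self_eq abs_ge_zero mult_le_one)
        then show ?thesis using True assms(4) by (simp add: add_increasing2)
      next
        case False
        with corr[OF h] show ?thesis by auto
      qed
    qed
    also have "\<dots> = real H * real p + (real H)\<^sup>2 * (\<eta> * real p)"
      by (simp add: sum.distrib power2_eq_square distrib_left)
    finally show ?thesis .
  qed
  have cs: "(\<Sum>n<N. X n)\<^sup>2 \<le> (real H * real p * sqrt (1 / real H + \<eta>))\<^sup>2"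
  proof -
    have "(\<Sum>n<N. X n)\<^sup>2 \<le> (\<Sum>n<N. (X n)\<^sup>2) * (\<Sum>n<N. 1\<^sup>2)"
      using Cauchy_Schwarz_ineq_sum[of X "\<lambda>_. 1" "{..<N}"] by simp
    \<comment> \<open>Squares are nonnegative, so the range may be enlarged to a full period. Here
      the incomplete sum turns into complete ones.\<close>
    also have "\<dots> \<le> (\<Sum>n<p. (X n)\<^sup>2) * real p"
      using assms(2) by (intro mult_mono sum_mono2 sum_nonneg) auto
    also have "\<dots> \<le> (real H * real p + (real H)\<^sup>2 * (\<eta> * real p)) * real p"
      using sq by (intro mult_right_mono) auto
    also have "\<dots> = (real H * real p)\<^sup>2 * (1 / real H + \<eta>)"
      using assms(3) by (simp add: power2_eq_square field_simps)
    also have "\<dots> = (real H * real p * sqrt (1 / real H + \<eta>))\<^sup>2"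
      using assms(4) by (simp add: power_mult_distrib)
    finally show ?thesis .
  qed
  have "real H * real p * sqrt (1 / real H + \<eta>) \<ge> 0" using assms(4) by simp
  with cs have X: "\<bar>\<Sum>n<N. X n\<bar> \<le> real H * real p * sqrt (1 / real H + \<eta>)"
    by (metis abs_le_square_iff abs_of_nonneg)
  have "(\<Sum>n<N. X n) = (\<Sum>h=1..H. \<Sum>n<N. F (int n + int h))"
    unfolding X_def by (rule sum.swap)
  then have "real H * (\<Sum>n<N. F (int n)) - (\<Sum>n<N. X n) =
      (\<Sum>h=1..H. (\<Sum>n<N. F (int n)) - (\<Sum>n<N. F (int n + int h)))"
    by (simp add: sum_subtractf)
  also have "\<bar>\<dots>\<bar> \<le> (\<Sum>h=1..H. 2 * real H)"
    using sum_shift_le[of F N, OF bd] by (intro order.trans[OF sum_abs] sum_mono) (fastforce intro: order.trans)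
  finally have "\<bar>real H * (\<Sum>n<N. F (int n)) - (\<Sum>n<N. X n)\<bar> \<le> real H * (2 * real H)" by simp
  with X have "\<bar>real H * (\<Sum>n<N. F (int n))\<bar> \<le> real H * (real p * sqrt (1 / real H + \<eta>) + 2 * real H)"
    by (simp add: algebra_simps)
  then show ?thesis using assms(3) by (simp add: abs_mult)
qed

lemma sum_residues_mult:
  fixes G :: "int \<Rightarrow> real"
  assumes "\<And>x y. [x = y] (mod int p) \<Longrightarrow> G x = G y" "coprime B p" "p > 0"
  shows "(\<Sum>n<p. G (int B * int n)) = (\<Sum>y\<in>{0..<int p}. G y)"
proof -
  have inj: "inj_on (\<lambda>n. (int B * int n) mod int p) {..<p}"
  proof (rule inj_onI)
    fix m n assume mn: "m \<in> {..<p}" "n \<in> {..<p}" "int B * int m mod int p = int B * int n mod int p"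
    then have "[B * m = B * n] (mod p)"
      by (metis cong_def cong_int_iff of_nat_mult)
    then have "[m = n] (mod p)" using assms(2) by (simp add: cong_mult_lcancel_nat)
    with mn show "m = n" by (simp add: cong_def)
  qed
  have "(\<lambda>n. (int B * int n) mod int p) ` {..<p} = {0..<int p}"
  proof (rule card_subset_eq)
    show "(\<lambda>n. (int B * int n) mod int p) ` {..<p} \<subseteq> {0..<int p}" using assms(3) by auto
    show "card ((\<lambda>n. (int B * int n) mod int p) ` {..<p}) = card {0..<int p}"
      using card_image[OF inj] by simp
  qed simp
  then have "(\<Sum>y\<in>{0..<int p}. G y) = (\<Sum>n<p. G ((int B * int n) mod int p))"
    using sum.reindex[OF inj, of G] by simp
  also have "\<dots> = (\<Sum>n<p. G (int B * int n))"
    by (intro sum.cong refl assms(1)) (simp add: cong_def)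
  finally show ?thesis ..
qed

text \<open>The factors with \<open>v\<close> in both sets are squares, equal to \<open>1\<close> unless \<open>y + v\<close> vanishes.\<close>

lemma correlation_sum_bound:
  fixes V1 V2 :: "nat set" and \<delta> :: real
  assumes V: "finite V1" "finite V2" "V1 \<noteq> V2" "\<forall>v\<in>V1\<union>V2. v > 0" and "\<delta> > 0"
  shows "\<forall>\<^sub>F p in at_top. prime p \<longrightarrow>
    \<bar>\<Sum>y\<in>{0..<int p}. (\<Prod>v\<in>V1. chi p (y + int v)) * (\<Prod>v\<in>V2. chi p (y + int v))\<bar> \<le> \<delta> * real p"
proof -
  define W where "W = (V1 - V2) \<union> (V2 - V1)"
  define I where "I = V1 \<inter> V2"
  have fin: "finite W" "finite I" using V by (auto simp: W_def I_def)
  have "\<forall>\<^sub>F p in at_top. prime p \<longrightarrow> \<bar>\<Sum>y\<in>{0..<int p}. \<Prod>u\<in>W. chi p (y + int u)\<bar> \<le> \<delta> / 2 * real p"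
    using V assms(5) by (intro complete_sum_bound) (auto simp: W_def)
  moreover have "\<forall>\<^sub>F p in at_top. real p \<ge> 2 * real (card I) / \<delta>"
    by (rule eventually_compose_filterlim[OF eventually_ge_at_top filterlim_real_sequentially])
  moreover have "\<forall>\<^sub>F p in at_top. (p::nat) > 0" by (rule eventually_gt_at_top)
  ultimately show ?thesis
  proof eventually_elim
    case (elim p)
    show ?case
    proof
      assume p: "prime p"
      define Z where "Z = {y\<in>{0..<int p}. \<exists>u\<in>I. int p dvd y + int u}"
      let ?A = "\<lambda>y. (\<Prod>v\<in>V1. chi p (y + int v)) * (\<Prod>v\<in>V2. chi p (y + int v))"
      let ?W = "\<lambda>y. \<Prod>v\<in>W. chi p (y + int v)"
      have A: "?A y = ?W y * (\<Prod>v\<in>I. (chi p (y + int v))\<^sup>2)" for y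
      proof -
        have "V1 = (V1 - V2) \<union> I" "V2 = (V2 - V1) \<union> I" unfolding I_def by auto
        moreover have "prod g ((V1 - V2) \<union> I) = prod g (V1 - V2) * prod g I"
          "prod g ((V2 - V1) \<union> I) = prod g (V2 - V1) * prod g I"
          "prod g W = prod g (V1 - V2) * prod g (V2 - V1)" for g :: "nat \<Rightarrow> real"
          unfolding W_def I_def using V(1,2) by (auto intro!: prod.union_disjoint)
        ultimately have "prod g V1 * prod g V2 = prod g W * (\<Prod>v\<in>I. (g v)\<^sup>2)" for g :: "nat \<Rightarrow> real"
          by (simp add: power2_eq_square prod.distrib)
        then show ?thesis .
      qed
      have diff: "\<bar>?A y - ?W y\<bar> \<le> of_bool (y \<in> Z)" if y: "y \<in> {0..<int p}" for y
      proof (cases "y \<in> Z")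
        case True
        then have "(\<Prod>v\<in>I. (chi p (y + int v))\<^sup>2) = 0"
          unfolding Z_def using fin by (auto simp: chi_eq_0_iff)
        with True show ?thesis unfolding A using abs_prod_chi_le[of p "\<lambda>v. y + int v" W] by simp
      next
        case False
        then have "(chi p (y + int v))\<^sup>2 = 1" if "v \<in> I" for v
          using chi_values[of p "y + int v"] y that chi_eq_0_iff[of p "y + int v"] by (auto simp: Z_def)
        then show ?thesis unfolding A by simp
      qed
      have "\<bar>(\<Sum>y\<in>{0..<int p}. ?A y) - (\<Sum>y\<in>{0..<int p}. ?W y)\<bar> \<le> (\<Sum>y\<in>{0..<int p}. of_bool (y \<in> Z))"
        unfolding sum_subtractf[symmetric] by (intro order.trans[OF sum_abs] sum_mono diff)
      also have "\<dots> = real (card Z)"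
        by (simp add: Z_def Int_def)
      also have "\<dots> \<le> real (card I)" unfolding Z_def using card_roots_le[OF elim(3) fin(2)] by simp
      also have "\<dots> \<le> \<delta> / 2 * real p" using elim(2) assms(5) by (simp add: field_simps)
      finally have "\<bar>(\<Sum>y\<in>{0..<int p}. ?A y) - (\<Sum>y\<in>{0..<int p}. ?W y)\<bar> \<le> \<delta> / 2 * real p" .
      moreover have "\<bar>\<Sum>y\<in>{0..<int p}. ?W y\<bar> \<le> \<delta> / 2 * real p" using elim(1) p by simp
      moreover have "\<delta> / 2 * real p + \<delta> / 2 * real p = \<delta> * real p" by simp
      ultimately show "\<bar>\<Sum>y\<in>{0..<int p}. ?A y\<bar> \<le> \<delta> * real p" by linarith
    qed
  qed
qed

text \<open>Shifting \<open>n\<close> by \<open>h\<close> translates the constants \<open>V\<close>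
  by \<open>B * h\<close>. Translates for different shifts are different sets, as their maxima
  differ, so every off-diagonal correlation has cancellation.\<close>

theorem incomplete_sum_bound:
  fixes V :: "nat set" and \<delta> :: real
  assumes V: "finite V" "V \<noteq> {}" and B: "B > 0" and \<delta>: "\<delta> > 0"
  shows "\<forall>\<^sub>F p in at_top. prime p \<longrightarrow> (\<forall>N\<le>p.
    \<bar>\<Sum>n<N. \<Prod>v\<in>V. chi p (int B * int n + int v)\<bar> \<le> \<delta> * real p)"
proof -
  \<comment> \<open>With \<open>1 / H\<close> and \<open>\<eta>\<close> both at most
    \<open>\<delta>^2 / 8\<close>, the square root in the van der Corput bound is at most
    \<open>\<delta> / 2\<close>; the remaining \<open>2 H\<close> is absorbed for large
    \<open>p\<close>.\<close>
  obtain H :: nat where H: "8 / \<delta>\<^sup>2 < real H" using reals_Archimedean2 by blast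
  have "8 / \<delta>\<^sup>2 > 0" using \<delta> by simp
  with H have H0: "H > 0" by (cases H) auto
  define \<eta> where "\<eta> = \<delta>\<^sup>2 / 8"
  have \<eta>: "\<eta> > 0" using \<delta> by (simp add: \<eta>_def)
  have "1 / real H \<le> \<eta>" using H H0 \<delta> by (simp add: \<eta>_def field_simps)
  then have "sqrt (1 / real H + \<eta>) \<le> sqrt ((\<delta> / 2)\<^sup>2)"
    by (intro real_sqrt_le_mono) (simp add: \<eta>_def power2_eq_square)
  then have sq: "sqrt (1 / real H + \<eta>) \<le> \<delta> / 2" using \<delta> by simp
  define sh where "sh h = (\<lambda>v. B * h + v) ` V" for h
  have ne: "sh h \<noteq> sh h'" if "h \<noteq> h'" for h h'
  proof
    assume eq: "sh h = sh h'"
    have "Max (sh h) = B * h + Max V" for h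
      unfolding sh_def using V by (intro mono_Max_commute[symmetric]) (auto simp: mono_def)
    with eq have "B * h = B * h'" by (metis add_right_cancel)
    with B that show False by simp
  qed
  have "\<forall>\<^sub>F p in at_top. \<forall>hh\<in>{hh\<in>{1..H}\<times>{1..H}. fst hh \<noteq> snd hh}. prime p \<longrightarrow>
      \<bar>\<Sum>y\<in>{0..<int p}. (\<Prod>v\<in>sh (fst hh). chi p (y + int v)) * (\<Prod>v\<in>sh (snd hh). chi p (y + int v))\<bar> \<le> \<eta> * real p"
    using \<eta> V B by (intro eventually_ball_finite ballI correlation_sum_bound ne) (auto simp: sh_def)
  moreover have "\<forall>\<^sub>F p in at_top. real p \<ge> 4 * real H / \<delta>"
    by (rule eventually_compose_filterlim[OF eventually_ge_at_top filterlim_real_sequentially])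
  moreover have "\<forall>\<^sub>F p in at_top. p > B" by (rule eventually_gt_at_top)
  ultimately show ?thesis
  proof eventually_elim
    case (elim p)
    show ?case
    proof (intro impI allI)
      fix N assume p: "prime p" and N: "N \<le> p"
      have p0: "p > 0" using p by (rule prime_gt_0_nat)
      have "\<not> p dvd B" using elim(3) B by (auto dest: dvd_imp_le)
      then have cop: "coprime B p" using p by (metis coprime_commute prime_imp_coprime)
      define F where "F n = (\<Prod>v\<in>V. chi p (int B * n + int v))" for n
      have "\<bar>\<Sum>n<N. F (int n)\<bar> \<le> real p * sqrt (1 / real H + \<eta>) + 2 * real H"
      proof (rule van_der_Corput_periodic)
        show "\<bar>F n\<bar> \<le> 1" for n unfolding F_def by (rule abs_prod_chi_le)
        show "N \<le> p" "1 \<le> H" "0 \<le> \<eta>" using N H0 \<eta> by auto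
        fix h h' assume h: "h \<in> {1..H}" "h' \<in> {1..H}" "h \<noteq> h'"
        define G where "G y = (\<Prod>v\<in>sh h. chi p (y + int v)) * (\<Prod>v\<in>sh h'. chi p (y + int v))" for y
        have FG: "F (int n + int h) = (\<Prod>v\<in>sh h. chi p (int B * int n + int v))" for n h
          unfolding F_def sh_def by (subst prod.reindex) (auto simp: algebra_simps intro!: inj_onI)
        have "(\<Sum>n<p. F (int n + int h) * F (int n + int h')) = (\<Sum>n<p. G (int B * int n))"
          unfolding G_def FG ..
        also have "\<dots> = (\<Sum>y\<in>{0..<int p}. G y)"
        proof (rule sum_residues_mult[OF _ cop p0])
          fix x y assume "[x = y] (mod int p)"
          then have "chi p (x + int v) = chi p (y + int v)" for v
            by (intro chi_cong cong_add cong_refl)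
          then show "G x = G y" unfolding G_def by simp
        qed
        finally show "\<bar>\<Sum>n<p. F (int n + int h) * F (int n + int h')\<bar> \<le> \<eta> * real p"
          unfolding G_def using bspec[OF elim(1), of "(h, h')"] h p by simp
      qed
      also have "\<dots> \<le> real p * (\<delta> / 2) + 2 * real H"
        using sq by (intro add_right_mono mult_left_mono) auto
      also have "\<dots> \<le> \<delta> * real p" using elim(2) \<delta> by (simp add: field_simps)
      finally show "\<bar>\<Sum>n<N. \<Prod>v\<in>V. chi p (int B * int n + int v)\<bar> \<le> \<delta> * real p"
        unfolding F_def .
    qed
  qed
qed

section \<open>Primes with a given quadratic non-residue\<close>

text \<open>Gauss's lemma: with \<open>c = (p - 1) / 2\<close>, the sign is the parity of the number
  of \<open>x \<le> c\<close> whose double exceeds \<open>c\<close>. The doubles are below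
  \<open>p\<close> and need no reduction, and \<open>c - c div 2\<close> of them are large.\<close>

lemma Legendre_two:
  assumes "prime p" "2 < p"
  shows "Legendre 2 (int p) = (if p mod 8 = 1 \<or> p mod 8 = 7 then 1 else -1)"
proof -
  have "\<not> p dvd 2" using assms by (auto dest: dvd_imp_le)
  then have "\<not> int p dvd 2" by (metis int_dvd_int_iff of_nat_numeral)
  then interpret GAUSS p 2 using assms by unfold_locales (auto simp: cong_0_iff)
  define c where "c = (p - 1) div 2"
  have "odd p" using assms prime_odd_nat by blast
  then have pc: "p = 2 * c + 1" unfolding c_def by (auto elim!: oddE)
  have ci: "(int p - 1) div 2 = int c" using pc by simp
  have A: "A = {0<..int c}" unfolding A_def ci ..
  have C: "C = (\<lambda>x. x * 2) ` {0<..int c}"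
    unfolding C_def B_def A image_image using pc by (intro image_cong refl) auto
  have "E = (\<lambda>x. x * 2) ` {int (c div 2)<..int c}"
    unfolding E_def C ci by (auto simp: image_iff)
  then have "card E = c - c div 2"
    by (subst \<open>E = _\<close>, subst card_image) (auto intro!: inj_onI)
  then have *: "Legendre 2 (int p) = (-1) ^ (c - c div 2)" using gauss_lemma by simp
  have "even (c - c div 2) \<longleftrightarrow> p mod 8 = 1 \<or> p mod 8 = 7" unfolding pc by presburger
  then show ?thesis unfolding * by auto
qed

text \<open>For an odd prime \<open>p \<noteq> q\<close>, reciprocity turns \<open>Legendre q p\<close> into a function of \<open>p\<close> that is
  multiplicative and periodic.\<close>

definition rec_char :: "nat \<Rightarrow> nat \<Rightarrow> int" where
  "rec_char q n = (if q = 2 then (if n mod 8 = 1 \<or> n mod 8 = 7 then 1 else -1)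
     else Legendre (int n) (int q) * (if n mod 4 = 3 \<and> q mod 4 = 3 then -1 else 1))"

lemma Legendre_eq_rec_char:
  assumes "prime p" "2 < p" "prime q" "p \<noteq> q"
  shows "Legendre (int q) (int p) = rec_char q p"
proof (cases "q = 2")
  case True then show ?thesis using Legendre_two[OF assms(1,2)] by (simp add: rec_char_def)
next
  case False
  then have q: "2 < q" using prime_ge_2_nat[OF assms(3)] by simp
  have "odd p" "odd q" using assms q prime_odd_nat by blast+
  then obtain c d where c: "p = 2 * c + 1" "q = 2 * d + 1" by (auto elim!: oddE)
  have "\<not> q dvd p" using assms prime_nat_iff[of p] q by auto
  then have "Legendre (int p) (int q) \<noteq> 0" by (simp add: Legendre_eq_0_iff)
  then have sq: "Legendre (int p) (int q) * Legendre (int p) (int q) = 1"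
    using Legendre_values[of "int p" "int q"] by auto
  have "Legendre (int q) (int p) = (Legendre (int p) (int q) * Legendre (int q) (int p)) * Legendre (int p) (int q)"
    using sq by (simp add: algebra_simps)
  also have "Legendre (int p) (int q) * Legendre (int q) (int p) = (-1) ^ (c * d)"
    using Quadratic_Reciprocity[OF assms(1,2,3) q assms(4)] c by simp
  also have "(-1::int) ^ (c * d) = (if p mod 4 = 3 \<and> q mod 4 = 3 then -1 else 1)"
  proof -
    have "odd c \<longleftrightarrow> p mod 4 = 3" "odd d \<longleftrightarrow> q mod 4 = 3" unfolding c by presburger+
    then show ?thesis by auto
  qed
  finally show ?thesis using False by (simp add: rec_char_def)
qed

text \<open>Oddness matters: for \<open>q = 2\<close> an even argument receives the default
  \<open>-1\<close>, and the sign depending on residues modulo 4 is a character on odd numbers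
  only.\<close>

lemma rec_char_mult:
  assumes "prime q" "odd m" "odd n"
  shows "rec_char q (m * n) = rec_char q m * rec_char q n"
proof (cases "q = 2")
  case True
  have c: "m mod 8 = 1 \<or> m mod 8 = 3 \<or> m mod 8 = 5 \<or> m mod 8 = 7"
    "n mod 8 = 1 \<or> n mod 8 = 3 \<or> n mod 8 = 5 \<or> n mod 8 = 7" using assms(2,3) by presburger+
  have "(m * n) mod 8 = ((m mod 8) * (n mod 8)) mod 8" by (simp only: mod_mult_eq)
  then have "((m * n) mod 8 = 1 \<or> (m * n) mod 8 = 7) \<longleftrightarrow>
      ((m mod 8 = 1 \<or> m mod 8 = 7) \<longleftrightarrow> (n mod 8 = 1 \<or> n mod 8 = 7))"
    using c by (elim disjE) simp_all
  then show ?thesis using True by (simp add: rec_char_def)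
next
  case False
  then have q: "2 < q" using prime_ge_2_nat[OF assms(1)] by simp
  have c: "m mod 4 = 1 \<or> m mod 4 = 3" "n mod 4 = 1 \<or> n mod 4 = 3" using assms(2,3) by presburger+
  have "(m * n) mod 4 = ((m mod 4) * (n mod 4)) mod 4" by (simp only: mod_mult_eq)
  then have "(m * n) mod 4 = 3 \<longleftrightarrow> (m mod 4 = 3) \<noteq> (n mod 4 = 3)"
    using c by (elim disjE) simp_all
  then show ?thesis using False Legendre_mult[OF assms(1) q, of "int m" "int n"]
    by (simp add: rec_char_def)
qed

lemma Legendre_one: "prime q \<Longrightarrow> Legendre 1 (int q) = 1"
  using chi_one[of q] by (simp add: chi_def)

lemma rec_char_eq_1:
  assumes "prime q" "n mod 8 = 1" "q = 2 \<or> [n = 1] (mod q)"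
  shows "rec_char q n = 1"
proof -
  have "n mod 4 = 1" using assms(2) by presburger
  moreover have "Legendre (int n) (int q) = 1" if "q \<noteq> 2"
  proof -
    have "[int n = int 1] (mod int q)" using assms(3) that cong_int_iff by blast
    then show ?thesis using Legendre_cong Legendre_one[OF assms(1)] by fastforce
  qed
  ultimately show ?thesis using assms by (auto simp: rec_char_def)
qed

text \<open>Otherwise squaring would map the nonzero residues onto themselves and hence injectively,
  but \<open>1\<close> and \<open>q - 1\<close> have the same square.\<close>

lemma exists_nonresidue:
  assumes "prime q" "2 < q"
  shows "\<exists>r::nat. Legendre (int r) (int q) = -1"
proof (rule ccontr)
  assume no: "\<nexists>r::nat. Legendre (int r) (int q) = -1"
  define f where "f y = y\<^sup>2 mod q" for y
  have "{1..<q} \<subseteq> f ` {1..<q}"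
  proof
    fix r assume r: "r \<in> {1..<q}"
    then have "\<not> q dvd r" by (auto dest: dvd_imp_le)
    then have "Legendre (int r) (int q) \<noteq> 0" by (simp add: Legendre_eq_0_iff)
    then have "Legendre (int r) (int q) = 1" using no Legendre_values[of "int r" "int q"] by auto
    then have "QuadRes (int q) (int r)" by (auto simp: Legendre_def split: if_splits)
    then obtain y where y: "[y\<^sup>2 = int r] (mod int q)" by (auto simp: QuadRes_def)
    define z where "z = nat (y mod int q)"
    have z: "int z = y mod int q" using assms by (simp add: z_def)
    have "[int (z\<^sup>2) = y\<^sup>2] (mod int q)" by (simp add: z cong_def power_mod)
    then have "[z\<^sup>2 = r] (mod q)" using y cong_trans cong_int_iff by blast
    then have fz: "f z = r" using r by (simp add: f_def cong_def)
    have "z < q" using assms by (simp add: z_def nat_less_iff)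
    moreover have "z \<noteq> 0" using fz r by (auto simp: f_def intro!: gr0I)
    ultimately show "r \<in> f ` {1..<q}" using fz by force
  qed
  then have "card {1..<q} \<le> card (f ` {1..<q})" by (intro card_mono) auto
  then have "inj_on f {1..<q}"
    using card_image_le[of "{1..<q}" f] by (intro eq_card_imp_inj_on) auto
  moreover have "f 1 = f (q - 1)"
  proof -
    obtain k where k: "q = k + 2" using assms(2) by (metis add.commute le_add_diff_inverse2 less_imp_le)
    have "(q - 1)\<^sup>2 = 1 + q * k" unfolding k by (simp add: power2_eq_square)
    then show ?thesis by (simp only: f_def power_one mod_mult_self2)
  qed
  ultimately have "1 = q - 1" by (rule inj_onD) (use assms(2) in auto)
  then show False using assms(2) by linarith
qed

text \<open>For positive \<open>D\<close> and odd \<open>n\<close> this is the Jacobi symbol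
  \<open>(D / n)\<close>, written by reciprocity as a function of residues of \<open>n\<close>, so
  that the Chinese remainder theorem can prescribe its value.\<close>

definition rec_char_prod :: "nat \<Rightarrow> nat \<Rightarrow> int" where
  "rec_char_prod D n = (\<Prod>q\<in>prime_factors D. rec_char q n ^ multiplicity q D)"

lemma Legendre_eq_rec_char_prod:
  assumes "prime p" "2 < p" "D > 0" "\<not> p dvd D"
  shows "Legendre (int D) (int p) = rec_char_prod D p"
proof -
  have "D = (\<Prod>q\<in>prime_factors D. q ^ multiplicity q D)"
    using assms(3) by (metis prod_prime_factors normalize_nat_def id_apply less_not_refl)
  then have "int D = (\<Prod>q\<in>prime_factors D. int q ^ multiplicity q D)"
    by (metis (no_types, lifting) of_nat_power of_nat_prod prod.cong)
  then have "chi p (int D) = (\<Prod>q\<in>prime_factors D. chi p (int q ^ multiplicity q D))"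
    using chi_prod[OF assms(1,2)] by metis
  also have "\<dots> = (\<Prod>q\<in>prime_factors D. chi p (int q) ^ multiplicity q D)"
  proof (intro prod.cong refl)
    fix q
    show "chi p (int q ^ n) = chi p (int q) ^ n" for n
      by (induction n) (auto simp: chi_one chi_mult assms)
  qed
  also have "\<dots> = (\<Prod>q\<in>prime_factors D. of_int (rec_char q p) ^ multiplicity q D)"
  proof (intro prod.cong refl arg_cong2[of _ _ _ _ "(^)"])
    fix q assume "q \<in> prime_factors D"
    then have "prime q" "p \<noteq> q" using assms(4) by (auto simp: in_prime_factors_iff)
    then show "chi p (int q) = of_int (rec_char q p)"
      unfolding chi_def using Legendre_eq_rec_char[OF assms(1,2)] by simp
  qed
  also have "\<dots> = of_int (rec_char_prod D p)" unfolding rec_char_prod_def by simp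
  finally show ?thesis unfolding chi_def by simp
qed

lemma rec_char_prod_mult:
  "odd m \<Longrightarrow> odd n \<Longrightarrow> rec_char_prod D (m * n) = rec_char_prod D m * rec_char_prod D n"
  unfolding rec_char_prod_def prod.distrib[symmetric] power_mult_distrib[symmetric]
  by (intro prod.cong refl) (simp add: rec_char_mult in_prime_factors_iff)

lemma rec_char_prod_eq_1_if_prime_divisors:
  assumes "odd n" "\<And>p. prime p \<Longrightarrow> p dvd n \<Longrightarrow> rec_char_prod D p = 1"
  shows "rec_char_prod D n = 1"
  using assms
proof (induction n rule: less_induct)
  case (less n)
  show ?case
  proof (cases "n = 1")
    case True
    then show ?thesis unfolding rec_char_prod_def
      by (intro prod.neutral ballI) (simp add: rec_char_eq_1 in_prime_factors_iff)
  next
    case False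
    then obtain p where p: "prime p" "p dvd n" using prime_factor_nat by blast
    then obtain k where k: "n = p * k" by (auto elim: dvdE)
    have "n > 0" using less.prems(1) by (auto intro!: gr0I)
    then have "k < n" using prime_gt_1_nat[OF p(1)] unfolding k by simp
    have "odd k" "odd p" using less.prems(1) unfolding k by auto
    have "rec_char_prod D k = 1"
    proof (rule less.IH)
      show "rec_char_prod D r = 1" if "prime r" "r dvd k" for r
        using less.prems(2)[OF that(1)] that(2) unfolding k by simp
    qed fact+
    with \<open>odd k\<close> \<open>odd p\<close> show ?thesis using less.prems(2)[OF p] unfolding k by (simp add: rec_char_prod_mult)
  qed
qed

lemma odd_multiplicity_if_not_square:
  fixes D :: nat
  assumes "\<not> is_square D"
  obtains l where "prime l" "odd (multiplicity l D)"
proof -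
  have "D > 0" using assms by (auto intro!: gr0I)
  then have "\<exists>l. prime l \<and> \<not> 2 dvd multiplicity l D"
    using assms is_nth_power_conv_multiplicity_nat[of 2 D] by auto
  with that show ?thesis by blast
qed

text \<open>A prime \<open>l\<close> with odd multiplicity in \<open>D\<close> can carry a sign
  alone: \<open>n\<close> is chosen with local value \<open>-1\<close> at \<open>l\<close> and local
  value \<open>1\<close> at every other prime factor of \<open>D\<close>.\<close>

theorem infinite_inert_primes:
  fixes D :: nat
  assumes "\<not> is_square D"
  shows "infinite {p. prime p \<and> odd p \<and> Legendre (int D) (int p) = -1}"
proof -
  have D0: "D > 0" using assms by (auto intro!: gr0I)
  obtain l where l: "prime l" "odd (multiplicity l D)" by (rule odd_multiplicity_if_not_square[OF assms])
  have lD: "l \<in> prime_factors D"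
    using l D0 by (auto simp: prime_factors_multiplicity intro!: gr0I) 
  have "\<exists>p>N. prime p \<and> odd p \<and> Legendre (int D) (int p) = -1" for N
  proof -
    \<comment> \<open>The congruence \<open>n = 1\<close> modulo these primes serves twice: the odd
      prime factors of \<open>D\<close> other than \<open>l\<close> get local value
      \<open>1\<close>, and no prime in \<open>Ps\<close> divides \<open>n\<close>. A prime factor
      of \<open>n\<close> must therefore exceed \<open>N + D\<close>, so it also does not divide
      \<open>D\<close>.\<close>
    define Ps where "Ps = {q. prime q \<and> q \<noteq> 2 \<and> q \<noteq> l \<and> q \<le> N + D}"
    define M where "M = \<Prod>Ps"
    have finP: "finite Ps" unfolding Ps_def by simp
    have Modd: "odd M"
    proof
      assume "even M"
      then have "\<exists>q\<in>Ps. 2 dvd q" unfolding M_def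
        using finP by (subst (asm) prime_dvd_prod_iff) auto
      then show False using prime_nat_iff by (auto simp: Ps_def)
    qed
    have Ml: "coprime l M"
    proof -
      have "coprime l q" if "q \<in> Ps" for q using that l(1) by (auto simp: Ps_def intro: primes_coprime)
      then show ?thesis unfolding M_def by (rule prod_coprime_right)
    qed
    have Mdvd: "q dvd M" if "q \<in> Ps" for q unfolding M_def using that finP by (rule dvd_prodI[rotated])
    have "\<exists>n. rec_char_prod D n = -1 \<and> odd n \<and> (\<forall>q\<in>Ps. [n = 1] (mod q)) \<and> \<not> l dvd n"
    proof (cases "l = 2")
      case True
      \<comment> \<open>The class \<open>5\<close> modulo \<open>8\<close> gives value
        \<open>-1\<close> at the prime 2, and being \<open>1\<close> modulo \<open>4\<close> it
        produces no reciprocity sign at the odd primes.\<close>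
      have "coprime 8 M" using Modd by (simp add: coprime_power_left_iff[of 2 3, simplified])
      from binary_chinese_remainder_nat[OF this, of 5 1]
      obtain n where n: "[n = 5] (mod 8)" "[n = 1] (mod M)" by blast
      have n8: "n mod 8 = 5" using n(1) by (simp add: cong_def)
      have nq: "[n = 1] (mod q)" if "q \<in> Ps" for q using n(2) Mdvd[OF that] cong_dvd_modulus_nat by blast
      have rc: "rec_char q n = (if q = 2 then -1 else 1)" if "q \<in> prime_factors D" for q
      proof (cases "q = 2")
        case True then show ?thesis using n8 by (simp add: rec_char_def)
      next
        case False
        have "q \<in> Ps" using that False True D0 by (auto simp: Ps_def in_prime_factors_iff dest: dvd_imp_le)
        then have "[int n = int 1] (mod int q)" using nq by (simp only: cong_int_iff)
        then have "Legendre (int n) (int q) = 1"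
          using Legendre_cong Legendre_one[of q] that by (fastforce simp: in_prime_factors_iff)
        moreover have "n mod 4 = 1" using n8 by presburger
        ultimately show ?thesis using False by (simp add: rec_char_def)
      qed
      have "rec_char_prod D n = (\<Prod>q\<in>prime_factors D. (if q = 2 then -1 else 1))"
        unfolding rec_char_prod_def using rc l(2) True by (intro prod.cong refl) auto
      also have "\<dots> = -1" using lD True by (subst prod.delta) auto
      finally have "rec_char_prod D n = -1" .
      moreover have "odd n" using n8 by presburger
      ultimately show ?thesis using nq True by blast
    next
      case False
      then have l2: "2 < l" using prime_ge_2_nat[OF l(1)] by simp
      then have lodd: "odd l" using l(1) prime_odd_nat by blast
      obtain r where r: "Legendre (int r) (int l) = -1" using exists_nonresidue[OF l(1) l2] by blast
      \<comment> \<open>A non-residue modulo \<open>l\<close> gives value \<open>-1\<close> at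
        \<open>l\<close> and keeps \<open>l\<close> from dividing \<open>n\<close>; the class
        \<open>1\<close> modulo \<open>8\<close> neutralises the prime 2 and all reciprocity
        signs.\<close>
      have "coprime l (8 * M)"
        using lodd Ml by (simp add: coprime_power_right_iff[of _ 2 3, simplified])
      from binary_chinese_remainder_nat[OF this, of r 1]
      obtain n where n: "[n = r] (mod l)" "[n = 1] (mod 8 * M)" by blast
      have "[n = 1] (mod 8)" using n(2) cong_dvd_modulus_nat dvd_triv_left by blast
      then have n8: "n mod 8 = 1" by (simp add: cong_def)
      have nM: "[n = 1] (mod M)" using n(2) cong_dvd_modulus_nat dvd_triv_right by blast
      have nq: "[n = 1] (mod q)" if "q \<in> Ps" for q using nM Mdvd[OF that] cong_dvd_modulus_nat by blast
      have "[int n = int r] (mod int l)" using n(1) by (simp only: cong_int_iff)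
      then have ln: "Legendre (int n) (int l) = -1" using r Legendre_cong by metis
      have n4: "n mod 4 = 1" using n8 by presburger
      have rc: "rec_char q n = (if q = l then -1 else 1)" if "q \<in> prime_factors D" for q
      proof (cases "q = l")
        case True then show ?thesis using ln n4 False by (simp add: rec_char_def)
      next
        case ne: False
        show ?thesis
        proof (cases "q = 2")
          case True then show ?thesis using n8 ne by (simp add: rec_char_def)
        next
          case q2: False
          have "q \<in> Ps" using that q2 ne D0 by (auto simp: Ps_def in_prime_factors_iff dest: dvd_imp_le)
          then show ?thesis using rec_char_eq_1[OF _ n8, of q] nq ne that by (simp add: in_prime_factors_iff)
        qed
      qed
      have "rec_char_prod D n = (\<Prod>q\<in>prime_factors D. (if q = l then -1 else 1))"
        unfolding rec_char_prod_def using rc l(2) by (intro prod.cong refl) auto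
      also have "\<dots> = -1" using lD by (subst prod.delta) auto
      finally have "rec_char_prod D n = -1" .
      moreover have "odd n" using n8 by presburger
      moreover have "\<not> l dvd n" using ln Legendre_eq_0_iff[of "int n" "int l"] by auto
      ultimately show ?thesis using nq by blast
    qed
    then obtain n where n: "rec_char_prod D n = -1" "odd n" "\<forall>q\<in>Ps. [n = 1] (mod q)" "\<not> l dvd n" by blast
    obtain p where p: "prime p" "p dvd n" "rec_char_prod D p \<noteq> 1"
      using rec_char_prod_eq_1_if_prime_divisors[OF n(2), of D] n(1) by fastforce
    have podd: "odd p" using p(2) n(2) by auto
    have "p \<notin> Ps"
    proof
      assume "p \<in> Ps"
      then have "[n = 1] (mod p)" using n(3) by blast
      then have "p dvd 1" using p(2) cong_dvd_iff by blast
      with p(1) show False by simp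
    qed
    moreover have "p \<noteq> l" using p(2) n(4) by auto
    ultimately have big: "p > N + D" using p(1) podd by (auto simp: Ps_def)
    then have nd: "\<not> p dvd D" using D0 by (auto dest: dvd_imp_le)
    have p2: "2 < p" using prime_ge_2_nat[OF p(1)] podd by (cases "p = 2") auto
    have "Legendre (int D) (int p) \<noteq> 1"
      using Legendre_eq_rec_char_prod[OF p(1) p2 D0 nd] p(3) by simp
    moreover have "Legendre (int D) (int p) \<noteq> 0" using nd by (simp add: Legendre_eq_0_iff)
    ultimately have "Legendre (int D) (int p) = -1" using Legendre_values[of "int D" "int p"] by auto
    with big p(1) podd show ?thesis by (intro exI[of _ p]) auto
  qed
  then show ?thesis unfolding infinite_nat_iff_unbounded by blast
qed

section \<open>Primes with given quadratic residues\<close>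

lemma rat_poly_clear_denominators:
  fixes q :: "rat poly"
  shows "\<exists>(c::int) Q. c \<noteq> 0 \<and> (\<forall>x::int. of_int (poly Q x) = of_int c * poly q (of_int x))"
proof (induction q)
  case 0
  show ?case by (intro exI[of _ 1] exI[of _ 0]) auto
next
  case (pCons a q)
  then obtain c Q where Q: "c \<noteq> 0" "\<And>x::int. of_int (poly Q x) = of_int c * poly q (of_int x)" by blast
  obtain n d where "quotient_of a = (n, d)" by (cases "quotient_of a")
  then have a: "a = of_int n / of_int d" "d > 0"
    by (rule quotient_of_div, rule quotient_of_denom_pos)
  have "of_int (poly (pCons (n * c) ([:d:] * Q)) x) = of_int (c * d) * poly (pCons a q) (of_int x)" for x :: int
  proof -
    have n: "rat_of_int n = a * of_int d" using a by simp
    show ?thesis unfolding poly_pCons of_int_add of_int_mult poly_mult n Q(2)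
      by (simp add: algebra_simps)
  qed
  moreover have "c * d \<noteq> 0" using Q(1) a(2) by simp
  ultimately show ?case by blast
qed

definition rat_eval :: "complex \<Rightarrow> rat poly \<Rightarrow> complex" where
  "rat_eval z q = poly (map_poly of_rat q) z"

lemma rat_eval_simps [simp]:
  "rat_eval z 0 = 0" "rat_eval z (pCons a q) = of_rat a + z * rat_eval z q"
  by (simp_all add: rat_eval_def map_poly_pCons)

lemma rat_eval_add: "rat_eval z (p + q) = rat_eval z p + rat_eval z q"
  by (induction p q rule: poly_induct2) (simp_all add: of_rat_add algebra_simps)

lemma rat_eval_smult: "rat_eval z (Polynomial.smult c q) = of_rat c * rat_eval z q"
  by (induction q) (simp_all add: of_rat_mult algebra_simps)

lemma rat_eval_mult: "rat_eval z (p * q) = rat_eval z p * rat_eval z q"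
  by (induction p) (simp_all add: rat_eval_add rat_eval_smult algebra_simps)

lemma rat_eval_one [simp]: "rat_eval z 1 = 1"
  by (simp add: one_pCons)

lemma rat_eval_monom_minus_one: "rat_eval z (Polynomial.monom 1 n - 1) = z ^ n - 1"
proof -
  have "rat_eval z (Polynomial.monom 1 n) = z ^ n" by (induction n) (simp_all add: monom_Suc monom_0)
  then have "rat_eval z ((Polynomial.monom 1 n - 1) + 1) = z ^ n" by simp
  then show ?thesis unfolding rat_eval_add by (simp add: algebra_simps)
qed

lemma rat_eval_prod: "rat_eval z (\<Prod>i\<in>I. f i) = (\<Prod>i\<in>I. rat_eval z (f i))"
  by (induction I rule: infinite_finite_induct) (simp_all add: rat_eval_mult)

text \<open>The factor is the minimal polynomial of a primitive \<open>m\<close>-th root of unity.\<close>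

lemma primitive_factor:
  assumes "m > 0"
  obtains \<pi> w u v :: "rat poly" where "degree \<pi> > 0" "\<pi> * w = Polynomial.monom 1 m - 1"
    "u * \<pi> + v * (\<Prod>d\<in>{1..<m}. Polynomial.monom 1 d - 1) = 1"
proof -
  define z where "z = exp (2 * of_real pi * \<i> * of_nat 1 / of_nat m)"
  define g where "g = Polynomial.monom (1::rat) m - 1"
  define h where "h = (\<Prod>d\<in>{1..<m}. Polynomial.monom (1::rat) d - 1)"
  have zd: "z ^ d = exp (2 * of_real pi * \<i> * of_nat d / of_nat m)" for d
    unfolding z_def exp_of_nat_mult[symmetric] by (simp add: algebra_simps)
  have "rat_eval z g = 0" unfolding g_def rat_eval_monom_minus_one zd
    using complex_root_unity_eq_1[of m m] assms by simp
  have "rat_eval z h \<noteq> 0" unfolding h_def rat_eval_prod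
  proof (subst prod_zero_iff, simp, rule notI, elim bexE)
    fix d assume d: "d \<in> {1..<m}" "rat_eval z (Polynomial.monom 1 d - 1) = 0"
    then have "m dvd d" unfolding rat_eval_monom_minus_one zd
      using complex_root_unity_eq_1[of m d] assms by simp
    with d show False by (auto dest: dvd_imp_le)
  qed
  have "Polynomial.coeff g m = 1" using assms by (simp add: g_def)
  then have g0: "g \<noteq> 0" by auto
  define P where "P q \<longleftrightarrow> q \<noteq> 0 \<and> rat_eval z q = 0" for q
  have "P g" using g0 \<open>rat_eval z g = 0\<close> by (simp add: P_def)
  then obtain \<pi> where \<pi>: "P \<pi>" "\<And>q. P q \<Longrightarrow> degree \<pi> \<le> degree q"
    using ex_has_least_nat[of P g degree] by blast
  have deg: "degree \<pi> > 0"
  proof (rule ccontr)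
    assume "\<not> degree \<pi> > 0"
    then obtain a where "\<pi> = [:a:]" by (auto elim: degree_eq_zeroE)
    with \<pi>(1) show False by (auto simp: P_def)
  qed
  have "rat_eval z (g div \<pi> * \<pi> + g mod \<pi>) = 0" using \<open>rat_eval z g = 0\<close> by simp
  then have "rat_eval z (g mod \<pi>) = 0" using \<pi>(1) unfolding rat_eval_add rat_eval_mult P_def by simp
  moreover have "g mod \<pi> = 0 \<or> degree (g mod \<pi>) < degree \<pi>" using degree_mod_less[of \<pi> g] \<pi>(1) by (auto simp: P_def)
  ultimately have "g mod \<pi> = 0" using \<pi>(2)[of "g mod \<pi>"] unfolding P_def by fastforce
  then have "\<pi> * (g div \<pi>) = g" by (metis dvd_imp_mod_0 dvd_mult_div_cancel mod_0_imp_dvd)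
  \<comment> \<open>Bezout by least degree: a nonzero element of minimal degree in the ideal
    generated by \<open>\<pi>\<close> and \<open>h\<close> divides both.\<close>
  define Id where "Id e \<longleftrightarrow> e \<noteq> 0 \<and> (\<exists>u v. e = u * \<pi> + v * h)" for e
  have "Id \<pi>" using \<pi>(1) unfolding Id_def P_def by (metis add_0_right mult_1 mult_zero_left)
  then obtain D where D: "Id D" "\<And>e. Id e \<Longrightarrow> degree D \<le> degree e"
    using ex_has_least_nat[of Id \<pi> degree] by blast
  from D(1) obtain u v where uv: "D = u * \<pi> + v * h" and D0: "D \<noteq> 0" unfolding Id_def by blast
  have D_dvd: "D dvd x" if "x = u' * \<pi> + v' * h" for x u' v'
  proof -
    have "x mod D = x - x div D * D" by (simp add: minus_div_mult_eq_mod)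
    also have "\<dots> = (u' - x div D * u) * \<pi> + (v' - x div D * v) * h"
      unfolding that uv by (simp add: algebra_simps)
    finally have "x mod D = 0 \<or> Id (x mod D)" unfolding Id_def by blast
    moreover have "x mod D = 0 \<or> degree (x mod D) < degree D" using degree_mod_less[OF D0] by blast
    ultimately have "x mod D = 0" using D(2)[of "x mod D"] by fastforce
    then show ?thesis by (rule mod_0_imp_dvd)
  qed
  \<comment> \<open>Dividing \<open>h\<close>, which is nonzero at \<open>z\<close>,
    \<open>D\<close> does not vanish at \<open>z\<close>. So the cofactor of \<open>D\<close> in
    \<open>\<pi>\<close> does, and minimality of \<open>degree \<pi>\<close> leaves degree
    \<open>0\<close> for \<open>D\<close>.\<close>
  have "D dvd h" by (rule D_dvd[of h 0 1]) simp
  then obtain h' where "h = D * h'" by (elim dvdE)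
  then have eD: "rat_eval z D \<noteq> 0" using \<open>rat_eval z h \<noteq> 0\<close> by (auto simp: rat_eval_mult)
  have "D dvd \<pi>" by (rule D_dvd[of \<pi> 1 0]) simp
  then obtain w where w: "\<pi> = D * w" by (elim dvdE)
  have "P w" using \<pi>(1) eD unfolding w P_def rat_eval_mult by auto
  then have "degree \<pi> \<le> degree w" by (rule \<pi>(2))
  moreover have "degree \<pi> = degree D + degree w"
    unfolding w using \<pi>(1) w by (intro degree_mult_eq) (auto simp: P_def)
  ultimately have "degree D = 0" by simp
  then obtain c where c: "D = [:c:]" by (auto elim: degree_eq_zeroE)
  have "Polynomial.smult (inverse c) D = 1" using D0 unfolding c by (simp add: one_pCons)
  then have "Polynomial.smult (inverse c) u * \<pi> + Polynomial.smult (inverse c) v * h = 1"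
    unfolding uv by (simp add: smult_add_right)
  with deg \<open>\<pi> * (g div \<pi>) = g\<close> show ?thesis using that unfolding g_def h_def by blast
qed

lemma dvd_poly_diff: "(x - y :: int) dvd poly q x - poly q y"
proof (induction q)
  case (pCons a q)
  have "poly (pCons a q) x - poly (pCons a q) y = (x - y) * poly q x + y * (poly q x - poly q y)"
    by (simp add: algebra_simps)
  with pCons show ?case by (metis dvd_add dvd_mult dvd_triv_left)
qed simp

text \<open>Euclid's argument: the values of \<open>Q\<close> at \<open>a + Q(a) N! t\<close> are \<open>Q(a)\<close> times numbers coprime to \<open>N!\<close>.\<close>

lemma large_prime_divisor_of_value:
  fixes Q :: "int poly" and q :: "rat poly"
  assumes "degree q > 0" "c \<noteq> 0" "\<And>x::int. of_int (poly Q x) = of_int c * poly q (of_int x)"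
  shows "\<exists>p x. prime (p::nat) \<and> p > N \<and> int p dvd poly Q x"
proof -
  have fin: "finite {x. poly Q x = y}" for y
  proof -
    have "degree (Polynomial.smult (of_int c) q + [:- of_int y:]) > 0"
      using assms(1,2) by (subst degree_add_eq_left) auto
    then have "Polynomial.smult (of_int c) q + [:- of_int y:] \<noteq> 0" by auto
    then have "finite {x::rat. poly (Polynomial.smult (of_int c) q + [:- of_int y:]) x = 0}" by (rule poly_roots_finite)
    then have "finite ((of_int :: int \<Rightarrow> rat) -` {x. poly (Polynomial.smult (of_int c) q + [:- of_int y:]) x = 0})"
      by (intro finite_vimageI) (auto intro: injI)
    moreover have "{x. poly Q x = y} \<subseteq> (of_int :: int \<Rightarrow> rat) -` {x. poly (Polynomial.smult (of_int c) q + [:- of_int y:]) x = 0}"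
      using assms(3) by (auto simp flip: of_int_mult)
    ultimately show ?thesis by (rule rev_finite_subset)
  qed
  obtain a where a: "poly Q a \<noteq> 0"
    using fin[of 0] infinite_UNIV_int ex_new_if_finite[of "{x. poly Q x = 0}"] by auto
  define A where "A = poly Q a"
  define M where "M = int (fact N)"
  have inj: "inj (\<lambda>t. a + A * M * t)" using a by (auto intro!: injI simp: A_def M_def)
  \<comment> \<open>The values \<open>A\<close> and \<open>-A\<close> are taken only finitely often.
    Avoiding them keeps the cofactor \<open>1 + M * (t * k)\<close> away from \<open>1\<close> and
    \<open>-1\<close>, so it has a prime divisor.\<close>
  have "finite ((\<lambda>t. a + A * M * t) -` ({x. poly Q x = A} \<union> {x. poly Q x = - A}))"
    using fin by (intro finite_vimageI inj) auto
  from ex_new_if_finite[OF infinite_UNIV_int this]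
  obtain t where "t \<notin> (\<lambda>t. a + A * M * t) -` ({x. poly Q x = A} \<union> {x. poly Q x = - A})" by blast
  then have t: "poly Q (a + A * M * t) \<noteq> A" "poly Q (a + A * M * t) \<noteq> - A" by simp_all
  define x where "x = a + A * M * t"
  have "x - a dvd poly Q x - poly Q a" by (rule dvd_poly_diff)
  then obtain k where k: "poly Q x - A = A * M * t * k" by (auto simp: x_def A_def)
  then have Qx: "poly Q x = A * (1 + M * (t * k))" by (simp add: algebra_simps)
  have "1 + M * (t * k) \<noteq> 1" "1 + M * (t * k) \<noteq> -1" using t unfolding x_def[symmetric] Qx by (metis mult.right_neutral, metis mult_minus1_right)
  then have "nat \<bar>1 + M * (t * k)\<bar> \<noteq> 1" by linarith
  then obtain p where p: "prime p" "p dvd nat \<bar>1 + M * (t * k)\<bar>" using prime_factor_nat by blast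
  then have pd: "int p dvd 1 + M * (t * k)" by (simp add: int_dvd_int_iff flip: int_dvd_int_iff)
  have "p > N"
  proof (rule ccontr)
    assume "\<not> p > N"
    then have "p dvd fact N" using prime_ge_1_nat[OF p(1)] by (intro dvd_fact) auto
    then have "int p dvd M" unfolding M_def by (subst int_dvd_int_iff)
    then have "int p dvd 1" using pd by (metis dvd_add_left_iff dvd_mult2)
    with p(1) show False by simp
  qed
  moreover have "int p dvd poly Q x" unfolding Qx using pd by simp
  ultimately show ?thesis using p(1) by blast
qed

text \<open>A prime dividing a value of the primitive factor at \<open>x\<close> divides
  \<open>x ^ m - 1\<close>. By the Bezout identity, if it is large it divides no
  \<open>x ^ d - 1\<close> with \<open>0 < d < m\<close>. Then \<open>x\<close> has order exactly
  \<open>m\<close>, and \<open>m\<close> divides \<open>p - 1\<close>.\<close>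

theorem exists_prime_cong_1:
  fixes m N :: nat
  assumes "m > 0"
  shows "\<exists>p>N. prime p \<and> [p = 1] (mod m)"
proof -
  obtain \<pi> w u v :: "rat poly" where P: "degree \<pi> > 0" "\<pi> * w = Polynomial.monom 1 m - 1"
    "u * \<pi> + v * (\<Prod>d\<in>{1..<m}. Polynomial.monom 1 d - 1) = 1"
    by (rule primitive_factor[OF assms])
  obtain c\<pi> Q\<pi> where Q\<pi>: "c\<pi> \<noteq> 0" "\<And>x::int. of_int (poly Q\<pi> x) = of_int c\<pi> * poly \<pi> (of_int x)"
    using rat_poly_clear_denominators[of \<pi>] by blast
  obtain cw Qw where Qw: "cw \<noteq> 0" "\<And>x::int. of_int (poly Qw x) = of_int cw * poly w (of_int x)"
    using rat_poly_clear_denominators[of w] by blast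
  obtain cu Qu where Qu: "cu \<noteq> 0" "\<And>x::int. of_int (poly Qu x) = of_int cu * poly u (of_int x)"
    using rat_poly_clear_denominators[of u] by blast
  obtain cv Qv where Qv: "cv \<noteq> 0" "\<And>x::int. of_int (poly Qv x) = of_int cv * poly v (of_int x)"
    using rat_poly_clear_denominators[of v] by blast
  have e1: "poly Q\<pi> x * poly Qw x = c\<pi> * cw * (x ^ m - 1)" for x
  proof -
    have "(of_int (poly Q\<pi> x * poly Qw x) :: rat) = of_int (c\<pi> * cw) * poly (\<pi> * w) (of_int x)"
      by (simp add: Q\<pi> Qw)
    also have "\<dots> = of_int (c\<pi> * cw * (x ^ m - 1))" unfolding P(2) by (simp add: poly_monom)
    finally show ?thesis by (simp only: of_int_eq_iff)
  qed
  have e2: "cv * poly Qu x * poly Q\<pi> x + cu * c\<pi> * poly Qv x * (\<Prod>d\<in>{1..<m}. x ^ d - 1) = c\<pi> * cu * cv" for x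
  proof -
    have "(of_int (cv * poly Qu x * poly Q\<pi> x + cu * c\<pi> * poly Qv x * (\<Prod>d\<in>{1..<m}. x ^ d - 1)) :: rat)
       = of_int (c\<pi> * cu * cv) * poly (u * \<pi> + v * (\<Prod>d\<in>{1..<m}. Polynomial.monom 1 d - 1)) (of_int x)"
      by (simp add: Q\<pi> Qu Qv poly_prod poly_monom algebra_simps)
    also have "\<dots> = of_int (c\<pi> * cu * cv)" unfolding P(3) by simp
    finally show ?thesis by (simp only: of_int_eq_iff)
  qed
  \<comment> \<open>All constants introduced by clearing denominators. A prime above
    \<open>\<bar>K\<bar>\<close> divides none of them, so both integer identities keep their force
    modulo \<open>p\<close>.\<close>
  define K where "K = c\<pi> * cw * cu * cv"
  obtain p x where p: "prime p" "p > N + nat \<bar>K\<bar>" "int p dvd poly Q\<pi> x"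
    using large_prime_divisor_of_value[OF P(1) Q\<pi>] by blast
  have K0: "K \<noteq> 0" using Q\<pi>(1) Qw(1) Qu(1) Qv(1) by (simp add: K_def)
  have "\<not> int p dvd K"
  proof
    assume "int p dvd K"
    then have "\<bar>int p\<bar> \<le> \<bar>K\<bar>" using K0 by (intro dvd_imp_le_int)
    with p(2) show False by linarith
  qed
  moreover have "K = (c\<pi> * cw) * (cu * cv)" "K = (c\<pi> * cu * cv) * cw" by (simp_all add: K_def)
  ultimately have nK: "\<not> int p dvd c\<pi> * cw" "\<not> int p dvd c\<pi> * cu * cv" by (metis dvd_mult2)+
  have pp: "prime (int p)" using p(1) by simp
  have "int p dvd c\<pi> * cw * (x ^ m - 1)" using p(3) unfolding e1[symmetric] by simp
  then have xm: "int p dvd x ^ m - 1" using nK(1) pp prime_dvd_mult_iff by blast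
  have nd: "\<not> int p dvd x ^ d - 1" if "d \<in> {1..<m}" for d
  proof
    assume "int p dvd x ^ d - 1"
    moreover have "x ^ d - 1 dvd (\<Prod>d\<in>{1..<m}. x ^ d - 1)" using that by (intro dvd_prodI) auto
    ultimately have "int p dvd (\<Prod>d\<in>{1..<m}. x ^ d - 1)" by (rule dvd_trans)
    with p(3) have "int p dvd c\<pi> * cu * cv" unfolding e2[of x, symmetric] by (intro dvd_add dvd_mult)
    with nK(2) show False by simp
  qed
  define y where "y = nat (x mod int p)"
  have y: "int y = x mod int p" using p(1) prime_gt_0_nat by (simp add: y_def)
  have iff: "[y ^ d = 1] (mod p) \<longleftrightarrow> int p dvd x ^ d - 1" for d
  proof -
    have "[y ^ d = 1] (mod p) \<longleftrightarrow> [int y ^ d = 1] (mod int p)"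
      by (metis cong_int_iff of_nat_1 of_nat_power)
    also have "\<dots> \<longleftrightarrow> [x ^ d = 1] (mod int p)" unfolding y by (simp add: cong_def power_mod)
    finally show ?thesis by (simp add: cong_iff_dvd_diff)
  qed
  have om: "ord p y dvd m" using xm iff ord_divides by blast
  then have o0: "ord p y > 0" using assms by (auto intro!: gr0I)
  have "ord p y = m"
  proof (rule ccontr)
    assume "ord p y \<noteq> m"
    moreover have "ord p y \<le> m" using om assms by (rule dvd_imp_le)
    ultimately have "ord p y \<in> {1..<m}" using o0 unfolding atLeastLessThan_iff by linarith
    then show False using nd iff ord[of y p] by blast
  qed
  moreover have "coprime p y" using o0 by simp
  ultimately have "m dvd p - 1" using order_divides_totient[of p y] p(1) by (simp add: totient_prime)
  then have "[p = 1] (mod m)"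
    using prime_ge_1_nat[OF p(1)] by (metis cong_altdef_nat cong_sym)
  with p(1,2) show ?thesis by (intro exI[of _ p]) auto
qed

text \<open>The modulus makes every local factor trivial at \<open>p\<close>: the factor
  \<open>8\<close> settles the prime 2 and the reciprocity signs, and \<open>D\<close> settles the
  odd primes dividing \<open>b\<close>.\<close>

lemma Legendre_eq_1_if_cong_1:
  assumes "prime p" "2 < p" "[p = 1] (mod 8 * D)" "b dvd D" "D > 0"
  shows "Legendre (int b) (int p) = 1"
proof -
  have b0: "b > 0" using assms(4,5) by (auto intro!: gr0I)
  have "coprime p (8 * D)" using assms(3) by (metis cong_imp_coprime cong_sym coprime_1_left)
  then have "coprime p D" by simp
  then have "coprime p b" by (rule coprime_divisors[OF dvd_refl assms(4)])
  then have nd: "\<not> p dvd b" using assms(1) coprime_common_divisor[of p b p] by auto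
  have "[p = 1] (mod 8)" using assms(3) cong_dvd_modulus_nat dvd_triv_left by blast
  then have p8: "p mod 8 = 1" by (simp add: cong_def)
  have "rec_char_prod b p = 1"
    unfolding rec_char_prod_def
  proof (intro prod.neutral ballI)
    fix q assume q: "q \<in> prime_factors b"
    then have "q dvd 8 * D" using assms(4) by (meson dvd_mult dvd_trans in_prime_factors_imp_dvd)
    then have "[p = 1] (mod q)" using assms(3) cong_dvd_modulus_nat by blast
    then show "rec_char q p ^ multiplicity q b = 1"
      using q rec_char_eq_1[OF _ p8, of q] by (simp add: in_prime_factors_iff)
  qed
  then show ?thesis using Legendre_eq_rec_char_prod[OF assms(1,2) b0 nd] by simp
qed

theorem infinite_split_primes:
  assumes "D > 0"
  shows "infinite {p. prime p \<and> odd p \<and> (\<forall>b. b dvd D \<longrightarrow> Legendre (int b) (int p) = 1)}"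
proof -
  have "\<exists>p>N. prime p \<and> odd p \<and> (\<forall>b. b dvd D \<longrightarrow> Legendre (int b) (int p) = 1)" for N
  proof -
    obtain p where p: "p > N + 2" "prime p" "[p = 1] (mod 8 * D)"
      using exists_prime_cong_1[of "8 * D" "N + 2"] assms by auto
    have "odd p" using p prime_odd_nat by simp
    with p show ?thesis using Legendre_eq_1_if_cong_1[OF p(2) _ p(3)] assms by (intro exI[of _ p]) auto
  qed
  then show ?thesis unfolding infinite_nat_iff_unbounded by blast
qed

section \<open>Sign patterns and incidences\<close>

text \<open>The product of the factors \<open>1 + \<eta> v * \<chi>\<close> is
  \<open>2 ^ card V\<close> times the indicator of the pattern, except at the at most
  \<open>card V\<close> values of \<open>n\<close> where some character value is \<open>0\<close>.
  Expanded over subsets of \<open>V\<close>, the empty set yields \<open>N\<close> and every other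
  subset an incomplete sum.\<close>

theorem sign_pattern_count:
  fixes V :: "nat set" and \<delta> :: real
  assumes V: "finite V" and B: "B > 0" and \<delta>: "\<delta> > 0"
  shows "\<forall>\<^sub>F p in at_top. prime p \<longrightarrow> (\<forall>\<eta> N. (\<forall>v\<in>V. \<eta> v \<in> {-1, 1}) \<longrightarrow> N \<le> p \<longrightarrow>
    \<bar>2 ^ card V * real (card {n\<in>{..<N}. \<forall>v\<in>V. chi p (int B * int n + int v) = \<eta> v}) - real N\<bar> \<le> \<delta> * real p)"
proof -
  \<comment> \<open>There are fewer than \<open>2 ^ card V\<close> nonempty subsets, so their sums
    use half of \<open>\<delta> p\<close>; the other half covers the zeros.\<close>
  define \<delta>' where "\<delta>' = \<delta> / (2 * 2 ^ card V)"
  have \<delta>': "\<delta>' > 0" using \<delta> by (simp add: \<delta>'_def)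
  have "\<forall>\<^sub>F p in at_top. \<forall>W\<in>Pow V - {{}}. prime p \<longrightarrow> (\<forall>N\<le>p.
    \<bar>\<Sum>n<N. \<Prod>v\<in>W. chi p (int B * int n + int v)\<bar> \<le> \<delta>' * real p)"
    using V B \<delta>' by (intro eventually_ball_finite ballI incomplete_sum_bound) (auto intro: finite_subset)
  moreover have "\<forall>\<^sub>F p in at_top. real p \<ge> 2 * (real (card V) * 2 ^ card V) / \<delta>"
    by (rule eventually_compose_filterlim[OF eventually_ge_at_top filterlim_real_sequentially])
  moreover have "\<forall>\<^sub>F p in at_top. p > B" by (rule eventually_gt_at_top)
  ultimately show ?thesis
  proof eventually_elim
    case (elim p)
    show ?case
    proof (intro impI allI)
      fix \<eta> :: "nat \<Rightarrow> real" and N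
      assume p: "prime p" and \<eta>: "\<forall>v\<in>V. \<eta> v \<in> {-1, 1}" and N: "N \<le> p"
      have p0: "p > 0" using p by (rule prime_gt_0_nat)
      have "\<not> p dvd B" using elim(3) B by (auto dest: dvd_imp_le)
      then have cop: "coprime B p" using p by (metis coprime_commute prime_imp_coprime)
      define c where "c v n = chi p (int B * int n + int v)" for v n
      define M where "M n \<longleftrightarrow> (\<forall>v\<in>V. c v n = \<eta> v)" for n
      define Z where "Z n \<longleftrightarrow> (\<exists>v\<in>V. int p dvd int B * int n + int v)" for n
      define E where "E n = (\<Prod>v\<in>V. 1 + \<eta> v * c v n)" for n
      have E_near: "\<bar>2 ^ card V * of_bool (M n) - E n\<bar> \<le> 2 ^ card V * of_bool (Z n)" for n
      proof (cases "Z n")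
        case True
        have nM: "\<not> M n"
        proof
          assume "M n"
          from True obtain v where v: "v \<in> V" "c v n = 0" unfolding Z_def c_def chi_eq_0_iff by blast
          with \<open>M n\<close> have "\<eta> v = 0" by (simp add: M_def)
          with v \<eta> show False by force
        qed
        have "\<bar>E n\<bar> \<le> (\<Prod>v\<in>V. 2)" unfolding E_def abs_prod
        proof (intro prod_mono conjI)
          fix v assume "v \<in> V"
          then have "\<eta> v = 1 \<or> \<eta> v = -1" using \<eta> by auto
          then show "\<bar>1 + \<eta> v * c v n\<bar> \<le> 2" using chi_values[of p "int B * int n + int v"] unfolding c_def by auto
        qed simp
        then show ?thesis using True nM by simp
      next
        case False
        have val: "1 + \<eta> v * c v n = 2 * of_bool (c v n = \<eta> v)" if "v \<in> V" for v
        proof -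
          have "\<eta> v = 1 \<or> \<eta> v = -1" using \<eta> that by auto
          moreover have "c v n \<noteq> 0" using False that unfolding Z_def c_def chi_eq_0_iff by blast
          then have "c v n = 1 \<or> c v n = -1" using chi_values[of p "int B * int n + int v"] unfolding c_def by auto
          ultimately show ?thesis by auto
        qed
        have "E n = (\<Prod>v\<in>V. 2 * of_bool (c v n = \<eta> v))" unfolding E_def using val by (rule prod.cong[OF refl])
        also have "\<dots> = 2 ^ card V * (\<Prod>v\<in>V. of_bool (c v n = \<eta> v))" by (simp add: prod.distrib)
        also have "(\<Prod>v\<in>V. of_bool (c v n = \<eta> v) :: real) = of_bool (M n)"
          unfolding M_def using V by (induction V rule: finite_induct) auto
        finally show ?thesis by simp
      qed
      have Zcount: "(\<Sum>n<N. of_bool (Z n) :: real) \<le> real (card V)"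
      proof -
        define G where "G y = (of_bool (\<exists>v\<in>V. int p dvd y + int v) :: real)" for y
        have "(\<Sum>n<N. of_bool (Z n) :: real) \<le> (\<Sum>n<p. of_bool (Z n))"
          using N by (intro sum_mono2) auto
        also have "\<dots> = (\<Sum>n<p. G (int B * int n))" unfolding G_def Z_def ..
        also have "\<dots> = (\<Sum>y\<in>{0..<int p}. G y)"
        proof (rule sum_residues_mult[OF _ cop p0])
          fix x y assume "[x = y] (mod int p)"
          then have "[x + int v = y + int v] (mod int p)" for v by (intro cong_add cong_refl)
          then have "int p dvd x + int v \<longleftrightarrow> int p dvd y + int v" for v by (rule cong_dvd_iff)
          then show "G x = G y" unfolding G_def by simp
        qed
        also have "\<dots> = real (card {y\<in>{0..<int p}. \<exists>v\<in>V. int p dvd y + int v})"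
          unfolding G_def by (simp add: Int_def)
        also have "\<dots> \<le> real (card V)" using card_roots_le[OF p0 V] by (rule of_nat_mono)
        finally show ?thesis .
      qed
      have card_eq: "real (card {n\<in>{..<N}. M n}) = (\<Sum>n<N. of_bool (M n))" by (simp add: Int_def)
      have 1: "\<bar>2 ^ card V * real (card {n\<in>{..<N}. M n}) - (\<Sum>n<N. E n)\<bar> \<le> 2 ^ card V * real (card V)"
      proof -
        have "2 ^ card V * real (card {n\<in>{..<N}. M n}) - (\<Sum>n<N. E n) = (\<Sum>n<N. 2 ^ card V * of_bool (M n) - E n)"
          unfolding card_eq sum_subtractf sum_distrib_left ..
        also have "\<bar>\<dots>\<bar> \<le> (\<Sum>n<N. 2 ^ card V * of_bool (Z n))"
          by (intro order.trans[OF sum_abs] sum_mono E_near)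
        also have "\<dots> = 2 ^ card V * (\<Sum>n<N. of_bool (Z n))" unfolding sum_distrib_left ..
        also have "\<dots> \<le> 2 ^ card V * real (card V)" using Zcount by (intro mult_left_mono) auto
        finally show ?thesis .
      qed
      have expand: "E n = (\<Sum>W\<in>Pow V. \<Prod>v\<in>W. \<eta> v * c v n)" for n
        unfolding E_def using prod_add[OF V, of "\<lambda>v. \<eta> v * c v n" "\<lambda>_. 1"] by (simp add: add.commute)
      have "(\<Sum>n<N. E n) = (\<Sum>W\<in>Pow V. \<Sum>n<N. \<Prod>v\<in>W. \<eta> v * c v n)"
        unfolding expand by (rule sum.swap)
      also have "\<dots> = real N + (\<Sum>W\<in>Pow V - {{}}. \<Sum>n<N. \<Prod>v\<in>W. \<eta> v * c v n)"
        using V by (subst sum.remove[of _ "{}"]) auto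
      finally have "(\<Sum>n<N. E n) - real N = (\<Sum>W\<in>Pow V - {{}}. (\<Prod>v\<in>W. \<eta> v) * (\<Sum>n<N. \<Prod>v\<in>W. c v n))"
        by (simp add: prod.distrib sum_distrib_left)
      also have "\<bar>\<dots>\<bar> \<le> (\<Sum>W\<in>Pow V - {{}}. \<delta>' * real p)"
      proof (intro order.trans[OF sum_abs] sum_mono)
        fix W assume W: "W \<in> Pow V - {{}}"
        have "\<bar>\<Prod>v\<in>W. \<eta> v\<bar> = 1" unfolding abs_prod
        proof (intro prod.neutral ballI)
          fix v assume "v \<in> W"
          with W \<eta> have "\<eta> v \<in> {-1, 1}" by blast
          then show "\<bar>\<eta> v\<bar> = 1" by auto
        qed
        then show "\<bar>(\<Prod>v\<in>W. \<eta> v) * (\<Sum>n<N. \<Prod>v\<in>W. c v n)\<bar> \<le> \<delta>' * real p"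
          unfolding abs_mult c_def using elim(1) W p N by auto
      qed
      also have "\<dots> \<le> 2 ^ card V * (\<delta>' * real p)"
        using V \<delta>' by (simp add: card_Diff_subset card_Pow of_nat_diff algebra_simps)
      also have "\<dots> = \<delta> / 2 * real p" by (simp add: \<delta>'_def)
      finally have 2: "\<bar>(\<Sum>n<N. E n) - real N\<bar> \<le> \<delta> / 2 * real p" .
      have 3: "2 ^ card V * real (card V) \<le> \<delta> / 2 * real p" using elim(2) \<delta> by (simp add: field_simps)
      have "\<delta> / 2 * real p + \<delta> / 2 * real p = \<delta> * real p" by simp
      with 1 2 3 show "\<bar>2 ^ card V * real (card {n\<in>{..<N}. \<forall>v\<in>V. chi p (int B * int n + int v) = \<eta> v}) - real N\<bar> \<le> \<delta> * real p"
        unfolding M_def c_def by linarith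
    qed
  qed
qed

section \<open>Points of the union and the index sets through them\<close>

definition incidence :: "nat \<Rightarrow> (nat \<Rightarrow> 'a set) \<Rightarrow> 'a \<Rightarrow> nat set" where
  "incidence k R r = {i\<in>{1..k}. r \<in> R i}"

lemma finite_incidence: "finite (incidence k R r)"
  by (simp add: incidence_def)

lemma T_set_eq_incidence:
  assumes "K \<noteq> {}" "K \<subseteq> {1..k}"
  shows "T_set k R K = {r\<in>(\<Union>i\<in>{1..k}. R i). incidence k R r = K}"
proof (rule Set.set_eqI)
  fix r
  have "r \<in> T_set k R K \<longleftrightarrow> (\<forall>i\<in>{1..k}. r \<in> R i \<longleftrightarrow> i \<in> K)"
    using assms unfolding T_set_def by blast
  also have "\<dots> \<longleftrightarrow> r \<in> {r\<in>(\<Union>i\<in>{1..k}. R i). incidence k R r = K}"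
    using assms unfolding incidence_def by blast
  finally show "r \<in> T_set k R K \<longleftrightarrow> r \<in> {r\<in>(\<Union>i\<in>{1..k}. R i). incidence k R r = K}" .
qed

text \<open>The sets \<open>T(K)\<close> are the fibres of the map \<open>incidence k R\<close> on
  the union, and \<open>K_max\<close> is its image. Sums over \<open>K_max\<close> weighted by
  \<open>card (T_set k R K)\<close> thus become sums over points.\<close>

lemma K_max_eq_incidence: "K_max k R = incidence k R ` (\<Union>i\<in>{1..k}. R i)"
proof (intro Set.set_eqI iffI)
  fix K assume "K \<in> K_max k R"
  then have "K \<noteq> {}" "K \<subseteq> {1..k}" "T_set k R K \<noteq> {}" by (auto simp: K_max_def K_family_def)
  then show "K \<in> incidence k R ` (\<Union>i\<in>{1..k}. R i)" using T_set_eq_incidence[of K k R] by blast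
next
  fix K assume "K \<in> incidence k R ` (\<Union>i\<in>{1..k}. R i)"
  then obtain r where r: "r \<in> (\<Union>i\<in>{1..k}. R i)" "K = incidence k R r" by blast
  then have K: "K \<noteq> {}" "K \<subseteq> {1..k}" by (auto simp: incidence_def)
  with r have "r \<in> T_set k R K" by (simp add: T_set_eq_incidence)
  moreover have "r \<in> (\<Inter>i\<in>K. R i)" unfolding r(2) by (auto simp: incidence_def)
  ultimately show "K \<in> K_max k R" using K by (auto simp: K_max_def K_family_def)
qed

lemma Lambda_K_eq_incidence:
  "Lambda_K k R = {I. I \<noteq> {} \<and> even (card I) \<and> (\<exists>r\<in>(\<Union>i\<in>{1..k}. R i). I \<subseteq> incidence k R r)}"
  unfolding Lambda_K_def K_max_eq_incidence nonempty_even_subsets_def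
  using finite_subset[OF _ finite_incidence[of k R]] by blast

lemma excess_eq_incidence:
  assumes "\<And>i. i \<in> {1..k} \<Longrightarrow> finite (R i)"
  shows "(\<Sum>K\<in>K_max k R. card (T_set k R K) * (card K - 1)) =
    (\<Sum>r\<in>(\<Union>i\<in>{1..k}. R i). card (incidence k R r) - 1)"
proof -
  let ?U = "\<Union>i\<in>{1..k}. R i"
  have fin: "finite ?U" using assms by auto
  have "(\<Sum>r\<in>?U. card (incidence k R r) - 1) =
      (\<Sum>K\<in>K_max k R. \<Sum>r | r \<in> ?U \<and> incidence k R r = K. card (incidence k R r) - 1)"
    unfolding K_max_eq_incidence by (intro sum.group[symmetric] fin finite_imageI) auto
  also have "\<dots> = (\<Sum>K\<in>K_max k R. card (T_set k R K) * (card K - 1))"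
  proof (intro sum.cong refl)
    fix K assume "K \<in> K_max k R"
    then have "K \<noteq> {}" "K \<subseteq> {1..k}" by (auto simp: K_max_def K_family_def)
    then show "(\<Sum>r | r \<in> ?U \<and> incidence k R r = K. card (incidence k R r) - 1) = card (T_set k R K) * (card K - 1)"
      by (simp add: T_set_eq_incidence)
  qed
  finally show ?thesis ..
qed

text \<open>Double counting: the left side counts a point once for every index through it, the
  excess counts all of these but one.\<close>

lemma sum_card_eq_excess_plus_card:
  assumes "\<And>i. i \<in> {1..k} \<Longrightarrow> finite (R i)"
  shows "(\<Sum>i=1..k. card (R i)) =
    (\<Sum>K\<in>K_max k R. card (T_set k R K) * (card K - 1)) + card (\<Union>i\<in>{1..k}. R i)"
proof -
  let ?U = "\<Union>i\<in>{1..k}. R i"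
  have fin: "finite ?U" using assms by auto
  have "(\<Sum>i=1..k. card (R i)) = (\<Sum>i=1..k. \<Sum>r\<in>?U. of_bool (r \<in> R i))"
  proof (intro sum.cong refl)
    fix i assume "i \<in> {1..k}"
    then have "?U \<inter> R i = R i" by auto
    then show "card (R i) = (\<Sum>r\<in>?U. of_bool (r \<in> R i))" using fin by (simp add: Int_def)
  qed
  also have "\<dots> = (\<Sum>r\<in>?U. \<Sum>i=1..k. of_bool (r \<in> R i))" by (rule sum.swap)
  also have "\<dots> = (\<Sum>r\<in>?U. (card (incidence k R r) - 1) + 1)"
  proof (intro sum.cong refl)
    fix r assume "r \<in> ?U"
    then have "incidence k R r \<noteq> {}" "finite (incidence k R r)" by (auto simp: incidence_def)
    then have "card (incidence k R r) \<ge> 1" by (simp add: Suc_le_eq card_gt_0_iff)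
    moreover have "(\<Sum>i=1..k. of_bool (r \<in> R i)) = card (incidence k R r)"
      by (simp add: incidence_def Int_def)
    ultimately show "(\<Sum>i=1..k. of_bool (r \<in> R i)) = (card (incidence k R r) - 1) + 1" by simp
  qed
  finally show ?thesis unfolding sum.distrib using excess_eq_incidence[of k R, OF assms] by simp
qed

section \<open>From error bounds to asymptotic equivalence\<close>

lemma sim_insideI:
  assumes "c > 0" and "\<And>\<delta>. \<delta> > 0 \<Longrightarrow> \<forall>\<^sub>F p in at_top. p \<in> P \<longrightarrow> \<bar>c * q p - real p\<bar> \<le> \<delta> * real p"
  shows "sim_inside P q (\<lambda>p. inverse c * real p)"
  unfolding sim_inside_def
proof (rule tendstoI)
  fix e :: real assume "e > 0"
  have "\<forall>\<^sub>F p in at_top. (p \<in> P \<longrightarrow> \<bar>c * q p - real p\<bar> \<le> e / 2 * real p) \<and> (p :: nat) > 0"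
    using assms(2)[of "e / 2"] \<open>e > 0\<close> by (intro eventually_conj eventually_gt_at_top) auto
  then show "\<forall>\<^sub>F p in inf at_top (principal P). dist (q p / (inverse c * real p)) 1 < e"
    unfolding eventually_inf_principal
  proof (eventually_elim, intro impI)
    fix p assume "(p \<in> P \<longrightarrow> \<bar>c * q p - real p\<bar> \<le> e / 2 * real p) \<and> p > 0" and "p \<in> P"
    then have p: "\<bar>c * q p - real p\<bar> \<le> e / 2 * real p" "p > 0" by auto
    have "q p / (inverse c * real p) - 1 = (c * q p - real p) / real p" using p(2) assms(1) by (simp add: field_simps)
    then have "dist (q p / (inverse c * real p)) 1 = \<bar>c * q p - real p\<bar> / real p" by (simp add: dist_real_def)
    also have "\<dots> \<le> e / 2" using p by (simp add: field_simps)
    also have "\<dots> < e" using \<open>e > 0\<close> by simp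
    finally show "dist (q p / (inverse c * real p)) 1 < e" .
  qed
qed

section \<open>The progressions\<close>

locale progressions =
  fixes m s k :: nat and a b \<beta> :: "nat \<Rightarrow> nat"
  assumes m_pos: "m \<ge> 1" and s_pos: "s \<ge> 1" and b_pos: "\<forall>j\<in>{1..m}. b j > 0"
    and bij: "bij_betw \<beta> {1..k} (b ` {1..m})"
begin

abbreviation S :: "nat \<Rightarrow> nat set" where "S \<equiv> S_set m a b s \<beta>"
abbreviation R :: "nat \<Rightarrow> rat set" where "R \<equiv> (\<lambda>i. inv_scale (\<beta> i) (S i))"
definition U :: "rat set" where "U = (\<Union>i\<in>{1..k}. R i)"
definition B :: nat where "B = (\<Prod>i\<in>{1..k}. \<beta> i)"
text \<open>For \<open>r\<close> in \<open>U\<close> the number \<open>B r\<close> is already a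
  natural number, so rounding only changes the type.\<close>

definition w :: "rat \<Rightarrow> nat" where "w r = nat \<lfloor>of_nat B * r\<rfloor>"
definition member :: "nat \<Rightarrow> nat set" where
  "member n = (\<Union>j\<in>{1..m}. {a j + b j * (n + i) | i. i \<in> {0..<s}})"
definition consistent :: "nat \<Rightarrow> bool" where
  "consistent p \<longleftrightarrow> (\<forall>I\<in>Lambda_K k R. Legendre (int (\<Prod>i\<in>I. \<beta> i)) (int p) = 1)"

lemma \<beta>_pos: "i \<in> {1..k} \<Longrightarrow> \<beta> i > 0"
  using b_pos bij_betwE[OF bij] by force

lemma B_pos: "B > 0"
  unfolding B_def by (intro prod_pos) (simp add: \<beta>_pos)

lemma mem_S_iff: "z \<in> S i \<longleftrightarrow> (\<exists>j\<in>{1..m}. b j = \<beta> i \<and> (\<exists>l<s. z = a j + \<beta> i * l))"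
  unfolding S_set_def A_set_def by fastforce

lemma finite_S: "finite (S i)"
proof -
  have "S i \<subseteq> (\<lambda>(j, l). a j + \<beta> i * l) ` ({1..m} \<times> {..<s})" by (auto simp: mem_S_iff)
  then show ?thesis by (rule finite_subset) auto
qed

lemma index_of_b:
  assumes "j \<in> {1..m}" obtains i where "i \<in> {1..k}" "\<beta> i = b j"
  using assms bij unfolding bij_betw_def by (metis image_eqI imageE)

lemma member_eq: "member n = {\<beta> i * n + z | i z. i \<in> {1..k} \<and> z \<in> S i}"
proof (intro equalityI subsetI)
  fix x assume "x \<in> member n"
  then obtain j l where jl: "j \<in> {1..m}" "l < s" "x = a j + b j * (n + l)" unfolding member_def by auto
  obtain i where i: "i \<in> {1..k}" "\<beta> i = b j" by (rule index_of_b[OF jl(1)])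
  have "a j + \<beta> i * l \<in> S i" unfolding mem_S_iff using jl i by auto
  moreover have "x = \<beta> i * n + (a j + \<beta> i * l)" unfolding jl(3) i(2) by (simp add: algebra_simps)
  ultimately show "x \<in> {\<beta> i * n + z | i z. i \<in> {1..k} \<and> z \<in> S i}" using i(1) by blast
next
  fix x assume "x \<in> {\<beta> i * n + z | i z. i \<in> {1..k} \<and> z \<in> S i}"
  then obtain i j l where "j \<in> {1..m}" "b j = \<beta> i" "l < s" "x = \<beta> i * n + (a j + \<beta> i * l)"
    unfolding mem_S_iff by blast
  then have "j \<in> {1..m}" "l \<in> {0..<s}" "x = a j + b j * (n + l)" by (auto simp: algebra_simps)
  then show "x \<in> member n" unfolding member_def by blast
qed

lemma finite_member: "finite (member n)"
  unfolding member_def by auto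

lemma exists_S:
  assumes "i \<in> {1..k}"
  shows "\<exists>z. z \<in> S i"
proof -
  obtain j where "j \<in> {1..m}" "b j = \<beta> i" using bij_betwE[OF bij] assms by force
  moreover have "0 < s" using s_pos by simp
  ultimately have "a j + \<beta> i * 0 \<in> S i" unfolding mem_S_iff by blast
  then show ?thesis ..
qed

lemma k_pos: "k \<ge> 1"
  using index_of_b[of 1] m_pos by fastforce

lemma member_nonempty: "member n \<noteq> {}"
  using exists_S[of 1] k_pos unfolding member_eq by fastforce

text \<open>The largest element of \<open>member n\<close> grows strictly with \<open>n\<close>.
  Counting sets is therefore the same as counting \<open>n\<close>.\<close>

lemma inj_member: "inj member"
proof -
  have "strict_mono (\<lambda>n. Max (member n))"
  proof (rule strict_monoI)
    fix n n' :: nat assume n: "n < n'"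
    have "Max (member n) \<in> member n" by (intro Max_in finite_member member_nonempty)
    then obtain i z where iz: "i \<in> {1..k}" "z \<in> S i" "Max (member n) = \<beta> i * n + z" unfolding member_eq by blast
    have "\<beta> i * n' + z \<in> member n'" using iz unfolding member_eq by blast
    then have "\<beta> i * n' + z \<le> Max (member n')" by (intro Max_ge finite_member)
    moreover have "\<beta> i * n < \<beta> i * n'" using n \<beta>_pos[OF iz(1)] by simp
    ultimately show "Max (member n) < Max (member n')" using iz(3) by linarith
  qed
  then have "inj (Max \<circ> member)" unfolding comp_def by (rule strict_mono_imp_inj_on)
  then show ?thesis by (rule inj_on_imageI2)
qed

definition good :: "int \<Rightarrow> nat \<Rightarrow> nat set" where
  "good \<epsilon> p = {n. \<forall>i\<in>{1..k}. \<forall>z\<in>S i. \<beta> i * n + z \<in> {1..p - 1} \<and> chi p (int (\<beta> i * n + z)) = of_int \<epsilon>}"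

lemma q_count_eq: "q_count m a b s \<epsilon> p = card (good \<epsilon> p)"
proof -
  have "{A \<in> AP m a b s \<inter> Pow {1..p - 1}. \<forall>x\<in>A. Legendre (int x) (int p) = \<epsilon>} = member ` good \<epsilon> p"
  proof -
    have iff: "n \<in> good \<epsilon> p \<longleftrightarrow> member n \<in> Pow {1..p - 1} \<and> (\<forall>x\<in>member n. Legendre (int x) (int p) = \<epsilon>)" for n
      unfolding good_def member_eq chi_def of_int_eq_iff by (simp only: mem_Collect_eq) blast
    have "AP m a b s = range member" unfolding AP_def member_def by blast
    then show ?thesis using iff by (simp del: Pow_iff) blast
  qed
  then show ?thesis unfolding q_count_def
    using card_image[OF inj_on_subset[OF inj_member]] by simp
qed

lemma w_eq:
  assumes "i \<in> {1..k}"
  shows "\<beta> i * w (of_nat z / of_nat (\<beta> i)) = B * z"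
    and "of_nat (w (of_nat z / of_nat (\<beta> i))) = (of_nat B * (of_nat z / of_nat (\<beta> i)) :: rat)"
proof -
  have "\<beta> i dvd B" unfolding B_def using assms by (intro dvd_prodI) auto
  then obtain c where c: "B = \<beta> i * c" by (auto elim: dvdE)
  have "of_nat B * (of_nat z / of_nat (\<beta> i)) = (of_nat (c * z) :: rat)"
    using \<beta>_pos[OF assms] unfolding c by simp
  then have wc: "w (of_nat z / of_nat (\<beta> i)) = c * z"
    and eq: "of_nat B * (of_nat z / of_nat (\<beta> i)) = (of_nat (c * z) :: rat)"
    unfolding w_def by (simp_all only: floor_of_nat nat_int)
  show "\<beta> i * w (of_nat z / of_nat (\<beta> i)) = B * z" unfolding wc c by simp
  show "of_nat (w (of_nat z / of_nat (\<beta> i))) = (of_nat B * (of_nat z / of_nat (\<beta> i)) :: rat)"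
    unfolding wc eq ..
qed

lemma mem_R_iff: "r \<in> R i \<longleftrightarrow> (\<exists>z\<in>S i. r = of_nat z / of_nat (\<beta> i))"
  unfolding inv_scale_def by auto

lemma R_eq_image: "R i = (\<lambda>z. of_nat z / of_nat (\<beta> i)) ` S i"
  by (auto simp: inv_scale_def)

lemma finite_R: "finite (R i)"
  unfolding R_eq_image using finite_S by simp

lemma card_R: "i \<in> {1..k} \<Longrightarrow> card (R i) = card (S i)"
proof -
  assume i: "i \<in> {1..k}"
  have "inj_on (\<lambda>z. of_nat z / of_nat (\<beta> i) :: rat) (S i)" using \<beta>_pos[OF i] by (auto intro!: inj_onI)
  then show ?thesis unfolding R_eq_image by (rule card_image)
qed

lemma finite_U: "finite U"
  unfolding U_def using finite_R by auto

lemma U_nonempty: "U \<noteq> {}"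
  using exists_S[of 1] k_pos unfolding U_def by (fastforce simp: mem_R_iff)

lemma inj_w: "inj_on w U"
proof (rule inj_onI)
  fix r r' assume "r \<in> U" "r' \<in> U" "w r = w r'"
  moreover have "of_nat (w r) = of_nat B * r" if "r \<in> U" for r
    using that w_eq(2) unfolding U_def by (auto simp: mem_R_iff)
  ultimately have "of_nat B * r = (of_nat B * r' :: rat)" by metis
  then show "r = r'" using B_pos by simp
qed

text \<open>Both sides are the character of \<open>B (\<beta> i n + z)\<close>. A condition on one
  progression thereby becomes a condition at the integer \<open>w r\<close>, shared by all
  progressions through the point \<open>r\<close>.\<close>

lemma chi_relation:
  assumes "prime p" "2 < p" "i \<in> {1..k}"
  shows "chi p (int (\<beta> i)) * chi p (int B * int n + int (w (of_nat z / of_nat (\<beta> i)))) =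
    chi p (int B) * chi p (int (\<beta> i * n + z))"
proof -
  have "int (\<beta> i) * (int B * int n + int (w (of_nat z / of_nat (\<beta> i)))) =
      int B * int (\<beta> i) * int n + int (\<beta> i * w (of_nat z / of_nat (\<beta> i)))" by (simp add: algebra_simps)
  also have "\<dots> = int B * int (\<beta> i * n + z)" unfolding w_eq(1)[OF assms(3)] by (simp add: algebra_simps)
  finally show ?thesis unfolding chi_mult[OF assms(1,2), symmetric] by (rule arg_cong)
qed

lemma chi_unit:
  assumes "p > B" "i \<in> {1..k}"
  shows "chi p (int (\<beta> i)) \<in> {-1, 1}" "chi p (int B) \<in> {-1, 1}"
proof -
  have "\<beta> i dvd B" unfolding B_def using assms by (intro dvd_prodI) auto
  then have "\<beta> i \<le> B" using B_pos by (intro dvd_imp_le) auto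
  then have "\<not> p dvd \<beta> i" using assms \<beta>_pos[OF assms(2)] by (auto dest: dvd_imp_le)
  then have "chi p (int (\<beta> i)) \<noteq> 0" by (simp add: chi_eq_0_iff)
  then show "chi p (int (\<beta> i)) \<in> {-1, 1}" using chi_values by blast
  have "\<not> p dvd B" using assms B_pos by (auto dest: dvd_imp_le)
  then have "chi p (int B) \<noteq> 0" by (simp add: chi_eq_0_iff)
  then show "chi p (int B) \<in> {-1, 1}" using chi_values by blast
qed

lemma Lambda_subset: "I \<in> Lambda_K k R \<Longrightarrow> I \<subseteq> {1..k}"
  unfolding Lambda_K_eq_incidence incidence_def by blast

text \<open>A single admissible \<open>n\<close> would give
  \<open>\<chi>\<^sub>p(\<beta>\<^sub>i)\<close> one common sign \<open>\<kappa>\<close> for all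
  \<open>i\<close> through the point \<open>r\<close>; over an even index set the product of these
  signs is \<open>1\<close>.\<close>

lemma good_empty:
  assumes p: "prime p" "2 < p" "p > B" and \<epsilon>: "\<epsilon> \<in> {-1, 1}"
    and I: "I \<in> Lambda_K k R" "Legendre (int (\<Prod>i\<in>I. \<beta> i)) (int p) = -1"
  shows "good \<epsilon> p = {}"
proof (rule ccontr)
  assume "good \<epsilon> p \<noteq> {}"
  then obtain n where n: "\<And>i z. i \<in> {1..k} \<Longrightarrow> z \<in> S i \<Longrightarrow> chi p (int (\<beta> i * n + z)) = of_int \<epsilon>"
    unfolding good_def by blast
  from I(1) obtain r where r: "even (card I)" "I \<subseteq> incidence k R r" unfolding Lambda_K_eq_incidence by blast
  define \<kappa> where "\<kappa> = chi p (int B) * of_int \<epsilon> * chi p (int B * int n + int (w r))"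
  have c: "chi p (int (\<beta> i)) = \<kappa> \<and> \<kappa> * \<kappa> = 1" if "i \<in> I" for i
  proof -
    have i: "i \<in> {1..k}" "r \<in> R i" using that r(2) by (auto simp: incidence_def)
    then obtain z where z: "z \<in> S i" "r = of_nat z / of_nat (\<beta> i)" by (auto simp: mem_R_iff)
    have "chi p (int (\<beta> i)) * chi p (int B * int n + int (w r)) = chi p (int B) * of_int \<epsilon>"
      using chi_relation[OF p(1,2) i(1), of n z] n[OF i(1) z(1)] unfolding z(2) by simp
    then show ?thesis using chi_unit[OF p(3) i(1)] \<epsilon> chi_values[of p "int B * int n + int (w r)"]
      unfolding \<kappa>_def by auto
  qed
  have "chi p (int (\<Prod>i\<in>I. \<beta> i)) = (\<Prod>i\<in>I. chi p (int (\<beta> i)))"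
    by (simp add: chi_prod[OF p(1,2)])
  also have "\<dots> = (\<Prod>i\<in>I. \<kappa>)" using c by (intro prod.cong) auto
  also have "\<dots> = (\<kappa> * \<kappa>) ^ (card I div 2)" using r(1) by (simp flip: power_mult power2_eq_square)
  also have "\<dots> = 1"
  proof -
    have "I \<noteq> {}" using I(1) unfolding Lambda_K_eq_incidence by blast
    then show ?thesis using c by auto
  qed
  finally show False using I(2) by (simp add: chi_def)
qed

text \<open>Two distinct indices through one point form a member of \<open>Lambda_K\<close>, and a
  product of two signs is \<open>1\<close> only if they agree.\<close>

lemma consistent_chi_eq:
  assumes p: "prime p" "2 < p" "p > B" "consistent p"
    and r: "i \<in> incidence k R r" "i' \<in> incidence k R r"
  shows "chi p (int (\<beta> i)) = chi p (int (\<beta> i'))"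
proof (cases "i = i'")
  case False
  have i: "i \<in> {1..k}" "i' \<in> {1..k}" "r \<in> R i" using r by (auto simp: incidence_def)
  have "{i, i'} \<in> Lambda_K k R" unfolding Lambda_K_eq_incidence using False r i by auto
  then have "Legendre (int (\<beta> i) * int (\<beta> i')) (int p) = 1" using p(4) False unfolding consistent_def by fastforce
  then have "chi p (int (\<beta> i) * int (\<beta> i')) = 1" by (simp add: chi_def)
  then have "chi p (int (\<beta> i)) * chi p (int (\<beta> i')) = 1" by (simp add: chi_mult[OF p(1,2)])
  then show ?thesis using chi_unit[OF p(3) i(1)] chi_unit[OF p(3) i(2)] by auto
qed simp

lemma good_iff_pattern:
  assumes p: "prime p" "2 < p" "p > B" "consistent p" and \<epsilon>: "\<epsilon> \<in> {-1, 1}"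
  shows "\<exists>\<eta>. (\<forall>v\<in>w ` U. \<eta> v \<in> {-1, 1}) \<and>
    (\<forall>n. (\<forall>i\<in>{1..k}. \<forall>z\<in>S i. chi p (int (\<beta> i * n + z)) = of_int \<epsilon>) \<longleftrightarrow>
      (\<forall>v\<in>w ` U. chi p (int B * int n + int v) = \<eta> v))"
proof -
  \<comment> \<open>One index through each point is selected to write down the required sign;
    consistency makes the sign independent of the selection.\<close>
  define i0 where "i0 r = (SOME i. i \<in> incidence k R r)" for r
  have i0: "i0 r \<in> incidence k R r" if "r \<in> U" for r
  proof -
    have "\<exists>i. i \<in> incidence k R r" using that unfolding U_def incidence_def by auto
    then show ?thesis unfolding i0_def by (rule someI_ex)
  qed
  define \<eta> where "\<eta> v = chi p (int B) * of_int \<epsilon> * chi p (int (\<beta> (i0 (the_inv_into U w v))))" for v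
  have \<eta>w: "\<eta> (w r) = chi p (int B) * of_int \<epsilon> * chi p (int (\<beta> (i0 r)))" if "r \<in> U" for r
    unfolding \<eta>_def the_inv_into_f_f[OF inj_w that] ..
  show ?thesis
  proof (intro exI[of _ \<eta>] conjI allI)
    show "\<forall>v\<in>w ` U. \<eta> v \<in> {-1, 1}"
    proof
      fix v assume "v \<in> w ` U"
      then obtain r where r: "r \<in> U" "v = w r" by blast
      have "i0 r \<in> {1..k}" using i0[OF r(1)] by (auto simp: incidence_def)
      from chi_unit[OF p(3) this] \<epsilon> show "\<eta> v \<in> {-1, 1}" unfolding r(2) \<eta>w[OF r(1)] by auto
    qed
    fix n
    have equiv: "chi p (int (\<beta> i * n + z)) = of_int \<epsilon> \<longleftrightarrow>
        chi p (int B * int n + int (w (of_nat z / of_nat (\<beta> i)))) = \<eta> (w (of_nat z / of_nat (\<beta> i)))"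
      if iz: "i \<in> {1..k}" "z \<in> S i" for i z
    proof -
      define r :: rat where "r = of_nat z / of_nat (\<beta> i)"
      have "r \<in> R i" using iz unfolding r_def mem_R_iff by blast
      then have ri: "r \<in> U" "i \<in> incidence k R r" using iz(1) by (auto simp: U_def incidence_def)
      have "\<eta> (w r) = chi p (int B) * of_int \<epsilon> * chi p (int (\<beta> i))"
        unfolding \<eta>w[OF ri(1)] using consistent_chi_eq[OF p ri(2) i0[OF ri(1)]] by simp
      moreover have "chi p (int (\<beta> i)) * chi p (int B * int n + int (w r)) =
          chi p (int B) * chi p (int (\<beta> i * n + z))"
        unfolding r_def by (rule chi_relation[OF p(1,2) iz(1)])
      ultimately show ?thesis unfolding r_def[symmetric]
        using chi_unit[OF p(3) iz(1)] chi_values[of p "int (\<beta> i * n + z)"] \<epsilon> by auto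
    qed
    have "(\<forall>v\<in>w ` U. chi p (int B * int n + int v) = \<eta> v) \<longleftrightarrow>
        (\<forall>i\<in>{1..k}. \<forall>z\<in>S i. chi p (int B * int n + int (w (of_nat z / of_nat (\<beta> i)))) = \<eta> (w (of_nat z / of_nat (\<beta> i))))"
      unfolding U_def R_eq_image by blast
    then show "(\<forall>i\<in>{1..k}. \<forall>z\<in>S i. chi p (int (\<beta> i * n + z)) = of_int \<epsilon>) \<longleftrightarrow>
      (\<forall>v\<in>w ` U. chi p (int B * int n + int v) = \<eta> v)" using equiv by blast
  qed
qed

section \<open>Counting the admissible \<open>n\<close>\<close>

definition b_max :: nat where "b_max = Max (\<beta> ` {1..k})"

lemma b_max_ge: "i \<in> {1..k} \<Longrightarrow> \<beta> i \<le> b_max"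
  unfolding b_max_def by simp

lemma b_max_attained: obtains i where "i \<in> {1..k}" "\<beta> i = b_max"
proof -
  have "b_max \<in> \<beta> ` {1..k}" unfolding b_max_def using k_pos by (intro Max_in) auto
  then show ?thesis by (rule imageE) (rule that, simp_all)
qed

lemma b_max_pos: "b_max > 0"
  using b_max_attained \<beta>_pos by metis

definition z_max :: nat where "z_max = Max (\<Union>i\<in>{1..k}. S i)"

lemma z_max_ge: "i \<in> {1..k} \<Longrightarrow> z \<in> S i \<Longrightarrow> z \<le> z_max"
  unfolding z_max_def using finite_S by (intro Max_ge) auto

text \<open>Up to boundedly many exceptions, the range condition on \<open>n\<close> is \<open>n < p div b_max\<close>.\<close>

lemma good_count:
  assumes p: "p > 0" and pat: "\<And>n. (\<forall>i\<in>{1..k}. \<forall>z\<in>S i. chi p (int (\<beta> i * n + z)) = of_int \<epsilon>) \<longleftrightarrow> n \<in> X"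
  shows "\<bar>real (card (good \<epsilon> p)) - real (card ({..<p div b_max} \<inter> X))\<bar> \<le> real (z_max + 2)"
proof -
  define N where "N = p div b_max"
  \<comment> \<open>The value \<open>n = N\<close> may still satisfy the range condition, while the
    reference count runs over \<open>n < N\<close>; this is the one exceptional element.\<close>
  have up: "good \<epsilon> p \<subseteq> insert N ({..<N} \<inter> X)"
  proof
    fix n assume n: "n \<in> good \<epsilon> p"
    obtain i where i: "i \<in> {1..k}" "\<beta> i = b_max" by (rule b_max_attained)
    obtain z where z: "z \<in> S i" using exists_S[OF i(1)] by blast
    have "b_max * n + z \<le> p" using n i z unfolding good_def by fastforce
    then have "b_max * n \<le> p" by simp
    then have "n \<le> N" unfolding N_def using b_max_pos by (simp add: less_eq_div_iff_mult_less_eq mult.commute)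
    moreover have "n \<in> X" using n pat unfolding good_def by blast
    ultimately show "n \<in> insert N ({..<N} \<inter> X)" by auto
  qed
  \<comment> \<open>At \<open>n = 0\<close> an element can be \<open>0\<close>, outside
    \<open>{1..p - 1}\<close>. The last \<open>z_max + 1\<close> values are given up so that
    \<open>b_max * (n + z_max + 1) \<le> p\<close> leaves room for every \<open>z\<close> and for
    the strict bound below \<open>p\<close>.\<close>
  have low: "{..<N} \<inter> X \<subseteq> good \<epsilon> p \<union> insert 0 {N - (z_max + 1)..<N}"
  proof
    fix n assume n: "n \<in> {..<N} \<inter> X"
    show "n \<in> good \<epsilon> p \<union> insert 0 {N - (z_max + 1)..<N}"
    proof (cases "n = 0 \<or> n \<ge> N - (z_max + 1)")
      case False
      then have "n + z_max + 1 \<le> N" by linarith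
      then have "b_max * (n + z_max + 1) \<le> b_max * N" by (rule mult_le_mono2)
      also have "\<dots> \<le> p" unfolding N_def by simp
      finally have bN: "b_max * n + b_max * z_max + b_max \<le> p" by (simp add: algebra_simps)
      have "\<beta> i * n + z \<in> {1..p - 1}" if "i \<in> {1..k}" "z \<in> S i" for i z
      proof -
        have "\<beta> i * n \<le> b_max * n" using b_max_ge[OF that(1)] by simp
        moreover have "z \<le> b_max * z_max" using z_max_ge[OF that] b_max_pos
          by (metis One_nat_def Suc_leI le_trans mult_le_mono1 nat_mult_1)
        moreover have "\<beta> i * n > 0" using \<beta>_pos[OF that(1)] False by simp
        ultimately show ?thesis using bN b_max_pos unfolding atLeastAtMost_iff by linarith
      qed
      then show ?thesis using n pat unfolding good_def by blast
    qed (use n in auto)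
  qed
  have "card (good \<epsilon> p) \<le> card (insert N ({..<N} \<inter> X))" using up by (intro card_mono) auto
  then have 1: "card (good \<epsilon> p) \<le> card ({..<N} \<inter> X) + 1"
    using card_insert_le_m1[of "card ({..<N} \<inter> X) + 1" "{..<N} \<inter> X" N] by simp
  have fg: "finite (good \<epsilon> p)" using up by (rule finite_subset) auto
  have "card ({..<N} \<inter> X) \<le> card (good \<epsilon> p \<union> insert 0 {N - (z_max + 1)..<N})"
    using low fg by (intro card_mono) auto
  also have "\<dots> \<le> card (good \<epsilon> p) + card (insert 0 {N - (z_max + 1)..<N})" by (rule card_Un_le)
  also have "card (insert 0 {N - (z_max + 1)..<N}) \<le> Suc (card {N - (z_max + 1)..<N})"
    by (rule card_insert_le_m1) auto
  finally have 2: "card ({..<N} \<inter> X) \<le> card (good \<epsilon> p) + (z_max + 2)" by simp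
  from 1 2 show ?thesis unfolding N_def by linarith
qed

theorem q_asymptotics:
  assumes \<epsilon>: "\<epsilon> \<in> {-1, 1}" and \<delta>: "\<delta> > 0"
  shows "\<forall>\<^sub>F p in at_top. prime p \<longrightarrow> consistent p \<longrightarrow>
    \<bar>real b_max * 2 ^ card U * real (q_count m a b s \<epsilon> p) - real p\<bar> \<le> \<delta> * real p"
proof -
  define t where "t = card U"
  define \<delta>' where "\<delta>' = \<delta> / (2 * real b_max)"
  \<comment> \<open>The bounded errors: \<open>z_max + 2\<close> from the range of \<open>n\<close>,
    multiplied by \<open>2 ^ t\<close>, and \<open>1\<close> from rounding in
    \<open>p div b_max\<close>, all scaled by \<open>b_max\<close>.\<close>
  define C where "C = real b_max * (2 ^ t * real (z_max + 2) + 1)"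
  have \<delta>': "\<delta>' > 0" using \<delta> b_max_pos by (simp add: \<delta>'_def)
  have cV: "card (w ` U) = t" unfolding t_def by (rule card_image[OF inj_w])
  have "\<forall>\<^sub>F p in at_top. prime p \<longrightarrow> (\<forall>\<eta> N. (\<forall>v\<in>w ` U. \<eta> v \<in> {-1, 1}) \<longrightarrow> N \<le> p \<longrightarrow>
    \<bar>2 ^ card (w ` U) * real (card {n\<in>{..<N}. \<forall>v\<in>w ` U. chi p (int B * int n + int v) = \<eta> v}) - real N\<bar> \<le> \<delta>' * real p)"
    using finite_U B_pos \<delta>' by (intro sign_pattern_count) auto
  moreover have "\<forall>\<^sub>F p in at_top. real p \<ge> 2 * C / \<delta>"
    by (rule eventually_compose_filterlim[OF eventually_ge_at_top filterlim_real_sequentially])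
  moreover have "\<forall>\<^sub>F p in at_top. p > B" by (rule eventually_gt_at_top)
  moreover have "\<forall>\<^sub>F p in at_top. p > (2::nat)" by (rule eventually_gt_at_top)
  ultimately show ?thesis
  proof eventually_elim
    case (elim p)
    show ?case
    proof (intro impI)
      assume p: "prime p" "consistent p"
      define N where "N = p div b_max"
      obtain \<eta> where \<eta>: "\<forall>v\<in>w ` U. \<eta> v \<in> {-1, 1}"
        "\<And>n. (\<forall>i\<in>{1..k}. \<forall>z\<in>S i. chi p (int (\<beta> i * n + z)) = of_int \<epsilon>) \<longleftrightarrow>
          (\<forall>v\<in>w ` U. chi p (int B * int n + int v) = \<eta> v)"
        using good_iff_pattern[OF p(1) elim(4,3) p(2) \<epsilon>] by (elim exE conjE) (rule that, assumption, erule spec)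
      define X where "X = {n. \<forall>v\<in>w ` U. chi p (int B * int n + int v) = \<eta> v}"
      define Q where "Q = real (card (good \<epsilon> p))"
      define Q' where "Q' = real (card ({..<N} \<inter> X))"
      have "N \<le> p" unfolding N_def by simp
      then have "\<bar>2 ^ t * real (card {n\<in>{..<N}. \<forall>v\<in>w ` U. chi p (int B * int n + int v) = \<eta> v}) - real N\<bar> \<le> \<delta>' * real p"
        using elim(1) p(1) \<eta>(1) unfolding cV by blast
      moreover have "{n\<in>{..<N}. \<forall>v\<in>w ` U. chi p (int B * int n + int v) = \<eta> v} = {..<N} \<inter> X"
        unfolding X_def by auto
      ultimately have 1: "\<bar>2 ^ t * Q' - real N\<bar> \<le> \<delta>' * real p" unfolding Q'_def by simp
      have 2: "\<bar>Q - Q'\<bar> \<le> real (z_max + 2)" unfolding Q_def Q'_def N_def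
        by (rule good_count) (use elim \<eta>(2) in \<open>auto simp: X_def\<close>)
      have "\<bar>2 ^ t * Q - 2 ^ t * Q'\<bar> \<le> 2 ^ t * real (z_max + 2)"
        unfolding right_diff_distrib[symmetric] abs_mult using 2 by (simp add: mult_left_mono)
      with 1 have 3: "\<bar>2 ^ t * Q - real N\<bar> \<le> \<delta>' * real p + 2 ^ t * real (z_max + 2)" by linarith
      have "real b_max * real N \<le> real p" "real p \<le> real b_max * real N + real b_max"
      proof -
        have "b_max * N + p mod b_max = p" unfolding N_def by simp
        moreover have "p mod b_max < b_max" using b_max_pos by simp
        ultimately have "b_max * N \<le> p" "p \<le> b_max * N + b_max" by linarith+
        then show "real b_max * real N \<le> real p" "real p \<le> real b_max * real N + real b_max"
          by (simp_all flip: of_nat_mult of_nat_add)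
      qed
      moreover have "\<bar>real b_max * (2 ^ t * Q) - real b_max * real N\<bar> \<le> real b_max * (\<delta>' * real p + 2 ^ t * real (z_max + 2))"
        unfolding right_diff_distrib[symmetric] abs_mult using 3 by (simp add: mult_left_mono)
      ultimately have "\<bar>real b_max * (2 ^ t * Q) - real p\<bar> \<le> real b_max * (\<delta>' * real p) + C"
        unfolding C_def by (simp add: distrib_left)
      also have "real b_max * (\<delta>' * real p) = \<delta> / 2 * real p" unfolding \<delta>'_def using b_max_pos by simp
      also have "C \<le> \<delta> / 2 * real p" using elim(2) \<delta> by (simp add: field_simps)
      finally show "\<bar>real b_max * 2 ^ card U * real (q_count m a b s \<epsilon> p) - real p\<bar> \<le> \<delta> * real p"
        unfolding q_count_eq Q_def t_def by (simp add: mult.assoc)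
    qed
  qed
qed

lemma R_meet_iff:
  assumes ij: "i \<in> {1..k}" "j \<in> {1..k}"
  shows "R i \<inter> R j \<noteq> {} \<longleftrightarrow>
    (\<exists>x\<in>A_set m a b \<beta> i. \<exists>x'\<in>A_set m a b \<beta> j. \<exists>l<s. \<exists>l'<s.
      int x' * int (\<beta> i) - int x * int (\<beta> j) = int (\<beta> i) * int (\<beta> j) * (int l - int l'))"
proof -
  have eq: "(of_nat (x + \<beta> i * l) / of_nat (\<beta> i) = (of_nat (x' + \<beta> j * l') / of_nat (\<beta> j) :: rat)) \<longleftrightarrow>
      int x' * int (\<beta> i) - int x * int (\<beta> j) = int (\<beta> i) * int (\<beta> j) * (int l - int l')" for x x' l l'
  proof -
    have "(of_nat (x + \<beta> i * l) / of_nat (\<beta> i) = (of_nat (x' + \<beta> j * l') / of_nat (\<beta> j) :: rat)) \<longleftrightarrow>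
        (of_nat ((x + \<beta> i * l) * \<beta> j) = (of_nat ((x' + \<beta> j * l') * \<beta> i) :: rat))"
      using \<beta>_pos[OF ij(1)] \<beta>_pos[OF ij(2)] by (subst frac_eq_eq) simp_all
    also have "\<dots> \<longleftrightarrow> int ((x + \<beta> i * l) * \<beta> j) = int ((x' + \<beta> j * l') * \<beta> i)"
      by (simp only: of_nat_eq_iff)
    also have "\<dots> \<longleftrightarrow> int x' * int (\<beta> i) - int x * int (\<beta> j) = int (\<beta> i) * int (\<beta> j) * (int l - int l')"
    proof -
      have "int ((x + \<beta> i * l) * \<beta> j) - int ((x' + \<beta> j * l') * \<beta> i) =
          int (\<beta> i) * int (\<beta> j) * (int l - int l') - (int x' * int (\<beta> i) - int x * int (\<beta> j))"
        by (simp add: algebra_simps)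
      then show ?thesis by linarith
    qed
    finally show ?thesis .
  qed
  have mem: "r \<in> R i \<longleftrightarrow> (\<exists>x\<in>A_set m a b \<beta> i. \<exists>l<s. r = of_nat (x + \<beta> i * l) / of_nat (\<beta> i))" for r i
  proof -
    have "S i = (\<Union>x\<in>A_set m a b \<beta> i. (\<lambda>l. x + \<beta> i * l) ` {..<s})"
      unfolding S_set_def by auto
    then have "R i = (\<Union>x\<in>A_set m a b \<beta> i. (\<lambda>l. of_nat (x + \<beta> i * l) / of_nat (\<beta> i)) ` {..<s})"
      unfolding R_eq_image by (simp only: image_UN image_image)
    then show ?thesis by (simp only: UN_iff image_iff Bex_def lessThan_iff)
  qed
  have "R i \<inter> R j \<noteq> {} \<longleftrightarrow> (\<exists>r. r \<in> R i \<and> r \<in> R j)" by blast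
  also have "\<dots> \<longleftrightarrow> (\<exists>x\<in>A_set m a b \<beta> i. \<exists>x'\<in>A_set m a b \<beta> j. \<exists>l<s. \<exists>l'<s.
      of_nat (x + \<beta> i * l) / of_nat (\<beta> i) = (of_nat (x' + \<beta> j * l') / of_nat (\<beta> j) :: rat))"
    unfolding mem by blast
  finally show ?thesis unfolding eq .
qed

text \<open>The differences \<open>l - l'\<close> of two indices below \<open>s\<close> are exactly
  the integers of modulus at most \<open>s - 1\<close>, so the negation of the arithmetic condition
  says that two elements coincide after division.\<close>

lemma star_condition_iff:
  "star_condition m a b s k \<beta> \<longleftrightarrow> (\<forall>i\<in>{1..k}. \<forall>j\<in>{1..k}. i \<noteq> j \<longrightarrow> R i \<inter> R j = {})"
proof -
  have "(\<not> d dvd t \<or> (d dvd t \<and> \<bar>t div d\<bar> > int s - 1)) \<longleftrightarrow>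
      \<not> (\<exists>l<s. \<exists>l'<s. t = d * (int l - int l'))" if "d > 0" for d t :: int
  proof -
    have "(\<exists>l<s. \<exists>l'<s. t = d * (int l - int l')) \<longleftrightarrow> d dvd t \<and> \<bar>t div d\<bar> \<le> int s - 1"
    proof
      assume "\<exists>l<s. \<exists>l'<s. t = d * (int l - int l')"
      then obtain l l' where l: "l < s" "l' < s" "t = d * (int l - int l')" by blast
      have "t div d = int l - int l'" unfolding l(3) using that by simp
      then show "d dvd t \<and> \<bar>t div d\<bar> \<le> int s - 1" using l by auto
    next
      assume t: "d dvd t \<and> \<bar>t div d\<bar> \<le> int s - 1"
      define u where "u = t div d"
      have "t = d * u" using t unfolding u_def by simp
      \<comment> \<open>Positive and negative part of \<open>u\<close>: one of them is
        \<open>0\<close>, so both are below \<open>s\<close>.\<close>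
      moreover have "u = int (nat u) - int (nat (- u))" by simp
      ultimately have "t = d * (int (nat u) - int (nat (- u)))" by simp
      moreover have "nat u < s" "nat (- u) < s" using t s_pos unfolding u_def by linarith+
      ultimately show "\<exists>l<s. \<exists>l'<s. t = d * (int l - int l')" by blast
    qed
    then show ?thesis by auto
  qed
  note key = this
  have "(\<forall>x\<in>A_set m a b \<beta> i. \<forall>x'\<in>A_set m a b \<beta> j.
           let d = int (\<beta> i) * int (\<beta> j);
               t = int x' * int (\<beta> i) - int x * int (\<beta> j)
           in \<not> d dvd t \<or> (d dvd t \<and> \<bar>t div d\<bar> > int s - 1)) \<longleftrightarrow> R i \<inter> R j = {}"
    if "i \<in> {1..k}" "j \<in> {1..k}" for i j
  proof -
    have "int (\<beta> i) * int (\<beta> j) > 0" using \<beta>_pos that by simp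
    note pos = this
    have "R i \<inter> R j = {} \<longleftrightarrow> \<not> (R i \<inter> R j \<noteq> {})" by simp
    then show ?thesis unfolding Let_def key[OF pos] R_meet_iff[OF that] by blast
  qed
  then show ?thesis unfolding star_condition_def by (simp del: atLeastAtMost_iff)
qed

definition excess :: nat where "excess = (\<Sum>K\<in>K_max k R. card (T_set k R K) * (card K - 1))"

lemma excess_eq: "excess = (\<Sum>r\<in>U. card (incidence k R r) - 1)"
  unfolding excess_def U_def by (rule excess_eq_incidence) (rule finite_R)

lemma sum_card_S: "(\<Sum>i=1..k. card (S i)) = excess + card U"
proof -
  have "(\<Sum>i=1..k. card (S i)) = (\<Sum>i=1..k. card (R i))" by (intro sum.cong refl) (simp add: card_R)
  also have "\<dots> = excess + card U" unfolding excess_def U_def by (rule sum_card_eq_excess_plus_card) (rule finite_R)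
  finally show ?thesis .
qed

lemma star_incidence:
  assumes "star_condition m a b s k \<beta>" "i \<in> incidence k R r" "j \<in> incidence k R r"
  shows "i = j"
  using assms unfolding star_condition_iff incidence_def by blast

lemma star_imp_excess: "star_condition m a b s k \<beta> \<Longrightarrow> excess = 0"
proof -
  assume star: "star_condition m a b s k \<beta>"
  have "card (incidence k R r) - 1 = 0" for r
  proof -
    have "card (incidence k R r) \<le> 1"
      using star_incidence[OF star] by (simp add: card_le_Suc0_iff_eq[OF finite_incidence])
    then show ?thesis by simp
  qed
  then show ?thesis unfolding excess_eq by simp
qed

lemma star_imp_consistent: "star_condition m a b s k \<beta> \<Longrightarrow> consistent p"
proof -
  assume star: "star_condition m a b s k \<beta>"
  have "Lambda_K k R = {}"
  proof (rule ccontr)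
    assume "Lambda_K k R \<noteq> {}"
    then obtain I r where I: "I \<noteq> {}" "even (card I)" "I \<subseteq> incidence k R r"
      unfolding Lambda_K_eq_incidence by blast
    have "finite I" using I(3) finite_incidence by (rule finite_subset)
    have "card I \<le> Suc 0" unfolding card_le_Suc0_iff_eq[OF \<open>finite I\<close>]
    proof (intro ballI)
      fix i j assume "i \<in> I" "j \<in> I"
      then have "i \<in> incidence k R r" "j \<in> incidence k R r" using I(3) by (auto dest: subsetD)
      then show "i = j" by (rule star_incidence[OF star])
    qed
    moreover have "card I > 0" using I(1) \<open>finite I\<close> by (simp add: card_gt_0_iff)
    ultimately have "card I = 1" by linarith
    then show False using I(2) by simp
  qed
  then show ?thesis unfolding consistent_def by simp
qed

lemma not_star_imp_excess: "\<not> star_condition m a b s k \<beta> \<Longrightarrow> excess > 0"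
proof -
  assume "\<not> star_condition m a b s k \<beta>"
  then obtain i j r where ij: "i \<in> {1..k}" "j \<in> {1..k}" "i \<noteq> j" "r \<in> R i" "r \<in> R j"
    unfolding star_condition_iff by blast
  have "card {i, j} \<le> card (incidence k R r)"
    using ij by (intro card_mono finite_incidence) (auto simp: incidence_def)
  then have "card (incidence k R r) - 1 > 0" using ij(3) by simp
  moreover have "r \<in> U" unfolding U_def using ij by blast
  ultimately show ?thesis unfolding excess_eq by (intro sum_pos2[OF finite_U]) auto
qed

lemma prod_dvd_B: "I \<in> Lambda_K k R \<Longrightarrow> (\<Prod>i\<in>I. \<beta> i) dvd B"
  unfolding B_def using Lambda_subset by (intro prod_dvd_prod_subset) auto

lemma Legendre_Lambda:
  assumes "p > B" "I \<in> Lambda_K k R"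
  shows "Legendre (int (\<Prod>i\<in>I. \<beta> i)) (int p) \<in> {-1, 1}"
proof -
  have "\<not> p dvd (\<Prod>i\<in>I. \<beta> i)"
  proof
    assume "p dvd (\<Prod>i\<in>I. \<beta> i)"
    then have "p dvd B" using prod_dvd_B[OF assms(2)] by (rule dvd_trans)
    then show False using assms(1) B_pos by (auto dest: dvd_imp_le)
  qed
  then have "Legendre (int (\<Prod>i\<in>I. \<beta> i)) (int p) \<noteq> 0" by (simp only: Legendre_eq_0_iff int_dvd_int_iff not_False_eq_True)
  then show ?thesis using Legendre_values by blast
qed

lemma squares_imp_consistent:
  assumes sq: "\<forall>I\<in>Lambda_K k R. is_square (\<Prod>i\<in>I. \<beta> i)" and p: "prime p" "2 < p" "p > B"
  shows "consistent p"
  unfolding consistent_def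
proof
  fix I assume I: "I \<in> Lambda_K k R"
  from sq I obtain y where y: "(\<Prod>i\<in>I. \<beta> i) = y ^ 2" by (auto elim: is_nth_powerE)
  have "Legendre (int (\<Prod>i\<in>I. \<beta> i)) (int p) = Legendre (int y) (int p) * Legendre (int y) (int p)"
    unfolding y power2_eq_square of_nat_mult by (rule Legendre_mult[OF p(1,2)])
  moreover have "Legendre (int (\<Prod>i\<in>I. \<beta> i)) (int p) \<in> {-1, 1}" by (rule Legendre_Lambda[OF p(3) I])
  ultimately show "Legendre (int (\<Prod>i\<in>I. \<beta> i)) (int p) = 1"
    using Legendre_values[of "int y" "int p"] by auto
qed

text \<open>The threshold \<open>M\<close> admits families of primes whose small members may be
  inconsistent.\<close>

lemma sim_inside_q:
  assumes \<epsilon>: "\<epsilon> \<in> {-1, 1}" and P: "\<And>p. p \<in> P \<Longrightarrow> prime p" "\<And>p. p \<in> P \<Longrightarrow> p > M \<Longrightarrow> consistent p"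
  shows "sim_inside P (\<lambda>p. real (q_count m a b s \<epsilon> p)) (\<lambda>p. inverse (real b_max * 2 ^ card U) * real p)"
proof (rule sim_insideI)
  show "0 < real b_max * 2 ^ card U" using b_max_pos by simp
  fix \<delta> :: real assume "\<delta> > 0"
  from q_asymptotics[OF \<epsilon> this] eventually_gt_at_top[of M]
  show "\<forall>\<^sub>F p in at_top. p \<in> P \<longrightarrow>
      \<bar>real b_max * 2 ^ card U * real (q_count m a b s \<epsilon> p) - real p\<bar> \<le> \<delta> * real p"
    by eventually_elim (use P in blast)
qed

text \<open>Consistency itself separates the two classes; the primes up to \<open>B\<close>, and
  \<open>2\<close>, are the finitely many left out. Every product over a member of
  \<open>Lambda_K\<close> divides \<open>B\<close>, so primes splitting all divisors of
  \<open>B\<close> are consistent, while primes inert for the given non-square are not.\<close>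

theorem split_and_inert_classes:
  assumes \<epsilon>: "\<epsilon> \<in> {-1, 1}" and I: "I \<in> Lambda_K k R" "\<not> is_square (\<Prod>i\<in>I. \<beta> i)"
  shows "\<exists>P N. P \<subseteq> odd_primes \<and> N \<subseteq> odd_primes \<and> infinite P \<and> infinite N \<and> P \<inter> N = {} \<and>
    finite ({p. prime p} - (P \<union> N)) \<and> (\<forall>p\<in>N. real (q_count m a b s \<epsilon> p) = 0) \<and>
    sim_inside P (\<lambda>p. real (q_count m a b s \<epsilon> p)) (\<lambda>p. inverse (real b_max * 2 ^ card U) * real p)"
proof (intro exI conjI ballI)
  define P where "P = {p. prime p \<and> odd p \<and> p > B \<and> consistent p}"
  define N where "N = {p. prime p \<and> odd p \<and> p > B \<and> \<not> consistent p}"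
  have gt2: "2 < p" if "prime p" "odd p" for p :: nat
    using that prime_ge_2_nat[of p] by (cases "p = 2") auto
  show "P \<subseteq> odd_primes" "N \<subseteq> odd_primes" "P \<inter> N = {}" by (auto simp: P_def N_def odd_primes_def)
  show "infinite P"
  proof
    assume "finite P"
    then have "finite (P \<union> {..B})" by simp
    moreover have "{p. prime p \<and> odd p \<and> (\<forall>b. b dvd B \<longrightarrow> Legendre (int b) (int p) = 1)} \<subseteq> P \<union> {..B}"
    proof
      fix p assume "p \<in> {p. prime p \<and> odd p \<and> (\<forall>b. b dvd B \<longrightarrow> Legendre (int b) (int p) = 1)}"
      then have p: "prime p" "odd p" "\<And>b. b dvd B \<Longrightarrow> Legendre (int b) (int p) = 1" by blast+
      have "consistent p" unfolding consistent_def by (intro ballI p(3) prod_dvd_B)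
      then show "p \<in> P \<union> {..B}" unfolding P_def using p(1,2) by auto
    qed
    ultimately have "finite {p. prime p \<and> odd p \<and> (\<forall>b. b dvd B \<longrightarrow> Legendre (int b) (int p) = 1)}"
      by (rule rev_finite_subset)
    with infinite_split_primes[OF B_pos] show False by (rule notE)
  qed
  show "infinite N"
  proof
    assume "finite N"
    then have "finite (N \<union> {..B})" by simp
    moreover have "{p. prime p \<and> odd p \<and> Legendre (int (\<Prod>i\<in>I. \<beta> i)) (int p) = -1} \<subseteq> N \<union> {..B}"
    proof
      fix p assume "p \<in> {p. prime p \<and> odd p \<and> Legendre (int (\<Prod>i\<in>I. \<beta> i)) (int p) = -1}"
      then have p: "prime p" "odd p" "Legendre (int (\<Prod>i\<in>I. \<beta> i)) (int p) \<noteq> 1" by auto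
      then have "\<not> consistent p" unfolding consistent_def using I(1) by blast
      then show "p \<in> N \<union> {..B}" unfolding N_def using p(1,2) by auto
    qed
    ultimately have "finite {p. prime p \<and> odd p \<and> Legendre (int (\<Prod>i\<in>I. \<beta> i)) (int p) = -1}"
      by (rule rev_finite_subset)
    with infinite_inert_primes[OF I(2)] show False by (rule notE)
  qed
  have "{p. prime p} - (P \<union> N) \<subseteq> {..B} \<union> {2}"
  proof
    fix p assume p: "p \<in> {p. prime p} - (P \<union> N)"
    show "p \<in> {..B} \<union> {2}"
    proof (cases "odd p")
      case True then show ?thesis using p unfolding P_def N_def by auto
    next
      case False then show ?thesis using p primes_dvd_imp_eq[OF two_is_prime_nat, of p] by auto
    qed
  qed
  then show "finite ({p. prime p} - (P \<union> N))" by (rule finite_subset) auto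
  show "real (q_count m a b s \<epsilon> p) = 0" if "p \<in> N" for p
  proof -
    have p: "prime p" "odd p" "p > B" "\<not> consistent p" using that by (auto simp: N_def)
    \<comment> \<open>The witness of inconsistency depends on \<open>p\<close> and may differ from
      the fixed non-square set.\<close>
    then obtain I where "I \<in> Lambda_K k R" "Legendre (int (\<Prod>i\<in>I. \<beta> i)) (int p) \<noteq> 1"
      unfolding consistent_def by blast
    moreover from this have "Legendre (int (\<Prod>i\<in>I. \<beta> i)) (int p) = -1"
      using Legendre_Lambda[OF p(3)] by blast
    ultimately have "good \<epsilon> p = {}" by (intro good_empty p gt2 \<epsilon>)
    then show ?thesis by (simp add: q_count_eq)
  qed
  show "sim_inside P (\<lambda>p. real (q_count m a b s \<epsilon> p)) (\<lambda>p. inverse (real b_max * 2 ^ card U) * real p)"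
    by (rule sim_inside_q[OF \<epsilon>, of P 0]) (auto simp: P_def)
qed

end

theorem mainTheorem3:
  fixes m s k :: nat and a b \<beta> :: "nat \<Rightarrow> nat" and \<epsilon> :: int
    and S :: "nat \<Rightarrow> nat set" and R :: "nat \<Rightarrow> rat set" and \<alpha> b_max e :: nat
    and q :: "nat \<Rightarrow> real"
  assumes "m \<ge> 1" and "s \<ge> 1" and "\<epsilon> \<in> {-1, 1}"
    and "\<forall>j\<in>{1..m}. b j > 0"
    and "\<forall>i\<in>{1..m}. \<forall>j\<in>{1..m}. i \<noteq> j \<longrightarrow> (a i, b i) \<noteq> (a j, b j)"
    and "bij_betw \<beta> {1..k} (b ` {1..m})"
  defines "S \<equiv> S_set m a b s \<beta>"
    and "R \<equiv> (\<lambda>i. inv_scale (\<beta> i) (S i))"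
    and "\<alpha> \<equiv> (\<Sum>i=1..k. card (S i))"
    and "b_max \<equiv> Max (\<beta> ` {1..k})"
    and "e \<equiv> (\<Sum>K\<in>K_max k R. card (T_set k R K) * (card K - 1))"
    and "q \<equiv> (\<lambda>p. real (q_count m a b s \<epsilon> p))"
  shows "(star_condition m a b s k \<beta> \<longrightarrow>
            sim_inside odd_primes q (\<lambda>p. inverse (real b_max * 2 ^ \<alpha>) * real p)) \<and>
         (\<not> star_condition m a b s k \<beta> \<longrightarrow>
            0 < e \<and> e < \<alpha> \<and>
            ((\<forall>I\<in>Lambda_K k R. is_square (\<Prod>i\<in>I. \<beta> i)) \<longrightarrow>
               sim_inside odd_primes q (\<lambda>p. inverse (real b_max * 2 ^ (\<alpha> - e)) * real p)) \<and>
            ((\<exists>I\<in>Lambda_K k R. \<not> is_square (\<Prod>i\<in>I. \<beta> i)) \<longrightarrow>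
               (\<exists>P N. P \<subseteq> odd_primes \<and> N \<subseteq> odd_primes \<and>
                  infinite P \<and> infinite N \<and> P \<inter> N = {} \<and>
                  finite ({p. prime p} - (P \<union> N)) \<and>
                  (\<forall>p\<in>N. q p = 0) \<and>
                  sim_inside P q (\<lambda>p. inverse (real b_max * 2 ^ (\<alpha> - e)) * real p))))"
proof -
  interpret pr: progressions m s k a b \<beta> by unfold_locales (use assms(1-6) in blast)+
  have R: "R = pr.R" unfolding R_def S_def ..
  have b: "b_max = pr.b_max" unfolding b_max_def pr.b_max_def ..
  have e: "e = pr.excess" unfolding e_def pr.excess_def R ..
  have \<alpha>: "\<alpha> = e + card pr.U" unfolding \<alpha>_def S_def e by (rule pr.sum_card_S)
  have U: "card pr.U > 0" using pr.U_nonempty pr.finite_U by (simp add: card_gt_0_iff)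
  have gt2: "2 < p" if "p \<in> odd_primes" for p
    using that prime_ge_2_nat[of p] by (cases "p = 2") (auto simp: odd_primes_def)
  have \<alpha>e: "\<alpha> - e = card pr.U" using \<alpha> by simp
  \<comment> \<open>Every asymptotic claim has the exponent \<open>card pr.U\<close>: it equals
    \<open>\<alpha> - e\<close>, and also \<open>\<alpha>\<close> when the excess vanishes. Only the
    supply of consistent primes differs between the cases.\<close>
  have sim: "sim_inside odd_primes q (\<lambda>p. inverse (real b_max * 2 ^ card pr.U) * real p)"
    if "\<And>p. prime p \<Longrightarrow> 2 < p \<Longrightarrow> p > pr.B \<Longrightarrow> pr.consistent p"
    unfolding q_def b
    by (rule pr.sim_inside_q[OF assms(3), of _ pr.B]) (use that gt2 in \<open>auto simp: odd_primes_def\<close>)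
  show ?thesis
  proof (intro conjI impI)
    assume star: "star_condition m a b s k \<beta>"
    have "\<alpha> = card pr.U" using \<alpha> pr.star_imp_excess[OF star] e by simp
    then show "sim_inside odd_primes q (\<lambda>p. inverse (real b_max * 2 ^ \<alpha>) * real p)"
      using sim[OF pr.star_imp_consistent[OF star]] by simp
  next
    assume "\<not> star_condition m a b s k \<beta>"
    then show "0 < e" unfolding e by (rule pr.not_star_imp_excess)
    show "e < \<alpha>" using \<alpha> U by simp
  next
    assume "\<forall>I\<in>Lambda_K k R. is_square (\<Prod>i\<in>I. \<beta> i)"
    then show "sim_inside odd_primes q (\<lambda>p. inverse (real b_max * 2 ^ (\<alpha> - e)) * real p)"
      unfolding \<alpha>e R by (intro sim pr.squares_imp_consistent)
  next
    assume "\<exists>I\<in>Lambda_K k R. \<not> is_square (\<Prod>i\<in>I. \<beta> i)"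
    then obtain I where I: "I \<in> Lambda_K k pr.R" "\<not> is_square (\<Prod>i\<in>I. \<beta> i)" unfolding R by blast
    show "\<exists>P N. P \<subseteq> odd_primes \<and> N \<subseteq> odd_primes \<and>
        infinite P \<and> infinite N \<and> P \<inter> N = {} \<and>
        finite ({p. prime p} - (P \<union> N)) \<and>
        (\<forall>p\<in>N. q p = 0) \<and>
        sim_inside P q (\<lambda>p. inverse (real b_max * 2 ^ (\<alpha> - e)) * real p)"
      unfolding \<alpha>e q_def b by (rule pr.split_and_inert_classes[OF assms(3) I])
  qed
qed

end
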